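(* Let $D$ be an $n\times n$ demand matrix with nonnegative rational entries whose maximum row sum and maximum column sum are at most $B>0$. There is a polynomial-time algorithm that computes an indirect integral routing satisfying $D$ whose makespan and average completion time are \[ \begin{cases} O(\log n) & \text{if } B\le 2,\\ O\!\left(\frac{B\log n}{\log B}\right) & \text{if } 2\le B\le n,\\ O(B) & \text{if } n\le B. \end{cases} \] Further, if every entry of $D$ equals $B/n$, then every indirect integral routing satisfying $D$ has makespan and average completion time $\Omega(\log n)$ if $B\le 2$, $\Omega\!\left(\frac{B\log n}{\log B}\right)$ if $2\le B\le n$, and $\Omega(B)$ if $n\le B$. Thus the algorithm is worst-case optimal (up to constant factors) with respect to both objectives.
   Context: Nodes $N=\{0,\dots,n-1\}$; $D_{ij}\ge 0$ is the amount of data to send from $i$ to $j$. For a horizon $T$, consider the time-expanded directed graph with vertex set $N\times\{0,\dots,T\}$, virtual edges $(i,t)\to(i,t+1)$ for all $i$ and $0\le t\le T-1$, and physical edges $(i,t)\to(j,t+1)$ with $i\neq j$, where for each $t$ the physical edges from layer $t$ to layer $t+1$ form a matching $M_t$ (each $(i,t)$ has at most one outgoing and each $(i,t+1)$ at most one incoming physical edge). Let $\mathcal P(i,j,t)$ be the set of directed paths from $(i,0)$ to $(j,t)$ and $\mathcal P$ their union over $i,j$ and $t\ge1$. A routing is a flow $f:\mathcal P\to\mathbb R_{\ge0}$; it is feasible for $D$ if every physical edge $e$ carries $\sum_{P\ni e}f(P)\le 1$ and for all $i,j$, $\sum_{t=1}^T\sum_{P\in\mathcal P(i,j,t)}f(P)\ge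 D_{ij}$. Such a routing is integral if, at every time step, every node has at most one incoming and at most one outgoing physical edge carrying positive flow; it is indirect in that paths may use any number of physical edges (data may be relayed via intermediate nodes). Its makespan is $T$. Its total completion time is $\sum_{t=1}^T\sum_{i,j}\sum_{P\in\mathcal P(i,j,t)} t\, f(P)$, and its average completion time is this divided by $\sum_{i,j}D_{ij}$. *)

theory Defs
  imports Complex_Main "HOL-Library.Log_Nat" "Graph_Theory.Arc_Walk"
begin

section \<open>Routings in the time-expanded graph\<close>

text \<open>A vertex \<open>(i, t)\<close> is node \<open>i\<close> at time \<open>t\<close>.\<close>

type_synonym vertex = "nat \<times> nat"
type_synonym arc = "vertex \<times> vertex"

text \<open>
  \<open>matching R t\<close> contains \<open>(i, j)\<close> iff the physical edge \<open>(i, t) \<rightarrow> (j, t + 1)\<close> is present.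
  A path is the list of its arcs.
\<close>

record routing =
  horizon :: nat
  matching :: "nat \<Rightarrow> (nat \<times> nat) set"
  flow :: "arc list \<Rightarrow> real"

definition virtual_arcs :: "nat \<Rightarrow> routing \<Rightarrow> arc set" where
  "virtual_arcs n R = {((i, t), (i, Suc t)) | i t. i < n \<and> t < horizon R}"

definition physical_arcs :: "routing \<Rightarrow> arc set" where
  "physical_arcs R = {((i, t), (j, Suc t)) | i j t. t < horizon R \<and> (i, j) \<in> matching R t}"

definition time_graph :: "nat \<Rightarrow> routing \<Rightarrow> (vertex, arc) pre_digraph" where
  "time_graph n R =
     \<lparr>verts = {..<n} \<times> {..horizon R}, arcs = virtual_arcs n R \<union> physical_arcs R,
      tail = fst, head = snd\<rparr>"

definition is_matching :: "nat \<Rightarrow> (nat \<times> nat) set \<Rightarrow> bool" where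
  "is_matching n M \<longleftrightarrow>
     M \<subseteq> {..<n} \<times> {..<n} \<and> (\<forall>(i, j) \<in> M. i \<noteq> j) \<and> inj_on fst M \<and> inj_on snd M"

definition paths :: "nat \<Rightarrow> routing \<Rightarrow> nat \<Rightarrow> nat \<Rightarrow> nat \<Rightarrow> arc list set" where
  "paths n R i j t = {P. pre_digraph.apath (time_graph n R) (i, 0) P (j, t)}"

definition all_paths :: "nat \<Rightarrow> routing \<Rightarrow> arc list set" where
  "all_paths n R = (\<Union>i<n. \<Union>j<n. \<Union>t\<in>{1..horizon R}. paths n R i j t)"

definition load :: "nat \<Rightarrow> routing \<Rightarrow> arc \<Rightarrow> real" where
  "load n R e = (\<Sum>P \<in> {P \<in> all_paths n R. e \<in> set P}. flow R P)"

text \<open>The flow is a function on \<^const>\<open>all_paths\<close>; it is extended by 0 to all arc lists.\<close>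

definition is_routing :: "nat \<Rightarrow> routing \<Rightarrow> bool" where
  "is_routing n R \<longleftrightarrow>
     (\<forall>t<horizon R. is_matching n (matching R t)) \<and>
     (\<forall>P \<in> all_paths n R. 0 \<le> flow R P) \<and>
     (\<forall>P. P \<notin> all_paths n R \<longrightarrow> flow R P = 0)"

definition feasible :: "nat \<Rightarrow> (nat \<Rightarrow> nat \<Rightarrow> rat) \<Rightarrow> routing \<Rightarrow> bool" where
  "feasible n D R \<longleftrightarrow>
     (\<forall>e \<in> physical_arcs R. load n R e \<le> 1) \<and>
     (\<forall>i<n. \<forall>j<n. (\<Sum>t = 1..horizon R. \<Sum>P \<in> paths n R i j t. flow R P) \<ge> of_rat (D i j))"

definition integral :: "nat \<Rightarrow> routing \<Rightarrow> bool" where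
  "integral n R \<longleftrightarrow>
     (\<forall>t<horizon R. \<forall>i<n.
        (\<exists>\<^sub>\<le>\<^sub>1 e. e \<in> physical_arcs R \<and> fst e = (i, t) \<and> load n R e > 0) \<and>
        (\<exists>\<^sub>\<le>\<^sub>1 e. e \<in> physical_arcs R \<and> snd e = (i, Suc t) \<and> load n R e > 0))"

text \<open>Paths may use any number of physical arcs, so these are the indirect integral routings.\<close>

definition integral_routing_for :: "nat \<Rightarrow> (nat \<Rightarrow> nat \<Rightarrow> rat) \<Rightarrow> routing \<Rightarrow> bool" where
  "integral_routing_for n D R \<longleftrightarrow> is_routing n R \<and> feasible n D R \<and> integral n R"

definition makespan :: "routing \<Rightarrow> real" where
  "makespan R = real (horizon R)"

definition total_completion_time :: "nat \<Rightarrow> routing \<Rightarrow> real" where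
  "total_completion_time n R =
     (\<Sum>t = 1..horizon R. \<Sum>i<n. \<Sum>j<n. \<Sum>P \<in> paths n R i j t. real t * flow R P)"

definition avg_completion_time :: "nat \<Rightarrow> (nat \<Rightarrow> nat \<Rightarrow> rat) \<Rightarrow> routing \<Rightarrow> real" where
  "avg_completion_time n D R =
     total_completion_time n R / (\<Sum>i<n. \<Sum>j<n. of_rat (D i j))"

text \<open>The sums above range over finite sets.\<close>

lemma finite_paths:
  assumes "\<And>t. t < horizon R \<Longrightarrow> is_matching n (matching R t)"
  shows "finite (paths n R i j t)"
proof -
  have sub: "arcs (time_graph n R) \<subseteq>
      ({..<n} \<times> {..horizon R}) \<times> ({..<n} \<times> {..horizon R})"
    using assms
    by (fastforce simp: time_graph_def virtual_arcs_def physical_arcs_def is_matching_def)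
  interpret fin_digraph "time_graph n R"
  proof
    show "finite (arcs (time_graph n R))"
      by (rule finite_subset[OF sub]) simp
  qed (use sub in \<open>auto simp: time_graph_def\<close>)
  show ?thesis unfolding paths_def by (rule apaths_finite)
qed

lemma finite_all_paths:
  assumes "is_routing n R"
  shows "finite (all_paths n R)"
  using assms by (auto simp: all_paths_def is_routing_def intro!: finite_paths)


section \<open>Demand matrices and rates\<close>

definition nonneg_matrix :: "nat \<Rightarrow> (nat \<Rightarrow> nat \<Rightarrow> rat) \<Rightarrow> bool" where
  "nonneg_matrix n D \<longleftrightarrow> (\<forall>i<n. \<forall>j<n. 0 \<le> D i j)"

definition demands :: "nat \<Rightarrow> real \<Rightarrow> (nat \<Rightarrow> nat \<Rightarrow> rat) set" where
  "demands n B = {D. nonneg_matrix n D \<and>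
     (\<forall>i<n. (\<Sum>j<n. of_rat (D i j)) \<le> B) \<and> (\<forall>j<n. (\<Sum>i<n. of_rat (D i j)) \<le> B)}"

text \<open>
  On the overlaps \<open>B = 2\<close> and \<open>B = n\<close> of the three regimes the competing expressions agree
  up to constant factors (for \<open>n \<ge> 2\<close>).
\<close>

definition rate :: "nat \<Rightarrow> real \<Rightarrow> real" where
  "rate n B =
     (if B \<le> 2 then ln (real n)
      else if B \<le> real n then B * ln (real n) / ln B
      else B)"


section \<open>Polynomial time\<close>

text \<open>
  Programs run on a random access machine with logarithmic cost: a store consists of unbounded
  arrays of natural numbers, a program addresses a fixed finite number of them, and every
  operation costs the bit length of its result, in addition to the cost of computing its operands
  and addresses. \<open>Sub\<close> is truncated.
\<close>

type_synonym store = "nat \<Rightarrow> nat \<Rightarrow> nat"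

datatype expr =
    Const nat
  | Read nat expr
  | Add expr expr
  | Sub expr expr
  | Mul expr expr
  | Div expr expr

datatype prog =
    Skip
  | Write nat expr expr
  | Seq prog prog
  | Cond expr prog prog
  | While expr prog

definition bits :: "nat \<Rightarrow> nat" where
  "bits x = Suc (floorlog 2 x)"

primrec eval_expr :: "store \<Rightarrow> expr \<Rightarrow> nat" where
  "eval_expr s (Const c) = c"
| "eval_expr s (Read a e) = s a (eval_expr s e)"
| "eval_expr s (Add e f) = eval_expr s e + eval_expr s f"
| "eval_expr s (Sub e f) = eval_expr s e - eval_expr s f"
| "eval_expr s (Mul e f) = eval_expr s e * eval_expr s f"
| "eval_expr s (Div e f) = eval_expr s e div eval_expr s f"

primrec cost :: "store \<Rightarrow> expr \<Rightarrow> nat" where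
  "cost s (Const c) = bits c"
| "cost s (Read a e) = cost s e + bits (eval_expr s (Read a e))"
| "cost s (Add e f) = cost s e + cost s f + bits (eval_expr s (Add e f))"
| "cost s (Sub e f) = cost s e + cost s f + bits (eval_expr s (Sub e f))"
| "cost s (Mul e f) = cost s e + cost s f + bits (eval_expr s (Mul e f))"
| "cost s (Div e f) = cost s e + cost s f + bits (eval_expr s (Div e f))"

text \<open>\<open>runs p s t s'\<close>: program \<open>p\<close> started in \<open>s\<close> halts in \<open>s'\<close> after time \<open>t\<close>.\<close>

inductive runs :: "prog \<Rightarrow> store \<Rightarrow> nat \<Rightarrow> store \<Rightarrow> bool" where
  runs_Skip: "runs Skip s 1 s"
| runs_Write:
    "runs (Write a e f) s (cost s e + cost s f)
       (s(a := (s a)(eval_expr s e := eval_expr s f)))"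
| runs_Seq:
    "runs p s t s' \<Longrightarrow> runs q s' u s'' \<Longrightarrow> runs (Seq p q) s (t + u) s''"
| runs_Cond_true:
    "eval_expr s e \<noteq> 0 \<Longrightarrow> runs p s t s' \<Longrightarrow> runs (Cond e p q) s (cost s e + t) s'"
| runs_Cond_false:
    "eval_expr s e = 0 \<Longrightarrow> runs q s t s' \<Longrightarrow> runs (Cond e p q) s (cost s e + t) s'"
| runs_While_true:
    "eval_expr s e \<noteq> 0 \<Longrightarrow> runs p s t s' \<Longrightarrow> runs (While e p) s' u s'' \<Longrightarrow>
     runs (While e p) s (cost s e + t + u) s''"
| runs_While_false:
    "eval_expr s e = 0 \<Longrightarrow> runs (While e p) s (cost s e) s"

lemma runs_deterministic:
  "runs p s t s' \<Longrightarrow> runs p s u s'' \<Longrightarrow> t = u \<and> s' = s''"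
proof (induction arbitrary: u s'' rule: runs.induct)
  case (runs_Seq p s t s' q v s2)
  from runs_Seq.prems obtain t' v' m where "u = t' + v'" "runs p s t' m" "runs q m v' s''"
    by (cases rule: runs.cases) simp_all
  with runs_Seq.IH show ?case by metis
next
  case (runs_While_true s e p t s' v s2)
  from runs_While_true.prems runs_While_true.hyps(1) obtain t' v' m
    where "u = cost s e + t' + v'" "runs p s t' m" "runs (While e p) m v' s''"
    by (cases rule: runs.cases) simp_all
  with runs_While_true.IH show ?case by metis
next
  case runs_Skip
  then show ?case by (cases rule: runs.cases) simp_all
next
  case runs_Write
  then show ?case by (cases rule: runs.cases) simp_all
next
  case (runs_Cond_true s e p t s' q)
  from runs_Cond_true.prems runs_Cond_true.hyps(1) obtain t'
    where "u = cost s e + t'" "runs p s t' s''"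
    by (cases rule: runs.cases) simp_all
  with runs_Cond_true.IH show ?case by metis
next
  case (runs_Cond_false s e q t s' p)
  from runs_Cond_false.prems runs_Cond_false.hyps(1) obtain t'
    where "u = cost s e + t'" "runs q s t' s''"
    by (cases rule: runs.cases) simp_all
  with runs_Cond_false.IH show ?case by metis
next
  case (runs_While_false s e p)
  from runs_While_false.prems runs_While_false.hyps show ?case
    by (cases rule: runs.cases) simp_all
qed

text \<open>Input is read from array 0, output is left in array 1; cell 0 holds the length.\<close>

definition initial_store :: "nat list \<Rightarrow> store" where
  "initial_store xs a k =
     (if a = 0 \<and> k \<le> length xs then (length xs # xs) ! k else 0)"

definition output_is :: "store \<Rightarrow> nat list \<Rightarrow> bool" where
  "output_is s ys \<longleftrightarrow> (\<forall>k \<le> length ys. s 1 k = (length ys # ys) ! k)"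

definition size_of :: "nat list \<Rightarrow> nat" where
  "size_of xs = (\<Sum>x \<leftarrow> length xs # xs. bits x)"

text \<open>Since \<^term>\<open>size_of xs \<ge> 1\<close>, a monomial bound is as general as a polynomial one.\<close>

definition computes_in_poly_time ::
    "prog \<Rightarrow> 'i set \<Rightarrow> ('i \<Rightarrow> nat list) \<Rightarrow> ('o \<Rightarrow> nat list) \<Rightarrow> ('i \<Rightarrow> 'o) \<Rightarrow> bool" where
  "computes_in_poly_time p I enc_in enc_out F \<longleftrightarrow>
     (\<exists>c k. \<forall>x \<in> I. \<exists>t s.
        runs p (initial_store (enc_in x)) t s \<and> output_is s (enc_out (F x)) \<and>
        t \<le> c * size_of (enc_in x) ^ k)"


section \<open>Input and output formats\<close>

text \<open>Row by row, each entry as numerator and denominator in lowest terms.\<close>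

definition encode_rat :: "rat \<Rightarrow> nat list" where
  "encode_rat r = [nat (fst (quotient_of r)), nat (snd (quotient_of r))]"

definition encode_demand :: "nat \<times> (nat \<Rightarrow> nat \<Rightarrow> rat) \<Rightarrow> nat list" where
  "encode_demand = (\<lambda>(n, D).
     n # concat (map (\<lambda>i. concat (map (\<lambda>j. encode_rat (D i j)) [0..<n])) [0..<n]))"

text \<open>
  The makespan can be exponential in the bit length of the demands, so a routing is described as a
  concatenation of blocks with multiplicities written in binary. A block lists its matchings, one
  per time step, and weighted paths, given as node sequences starting at the first time step of
  the block; the weight \<open>(a, d)\<close> stands for \<open>a / d\<close>. A pair \<open>(q, b)\<close> stands for \<open>q\<close> consecutive
  copies of \<open>b\<close>.
\<close>

type_synonym block = "(nat \<times> nat) list list \<times> (nat list \<times> nat \<times> nat) list"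
type_synonym schedule = "(nat \<times> block) list"

definition blocks :: "schedule \<Rightarrow> block list" where
  "blocks S = concat (map (\<lambda>(q, b). replicate q b) S)"

definition timed_path :: "nat list \<Rightarrow> arc list" where
  "timed_path vs = map (\<lambda>k. ((vs ! k, k), (vs ! Suc k, Suc k))) [0..<length vs - 1]"

text \<open>
  The flow of a block list beginning at time \<open>s\<close>: data listed in a block stays at its source from
  time 0 until the block begins.
\<close>

primrec blocks_flow :: "nat \<Rightarrow> block list \<Rightarrow> arc list \<Rightarrow> real" where
  "blocks_flow s [] P = 0"
| "blocks_flow s (b # bs) P =
     (\<Sum>(vs, a, d) \<leftarrow> snd b.
        if P = timed_path (replicate s (hd vs) @ vs) then real a / real d else 0) +
     blocks_flow (s + length (fst b)) bs P"

definition routing_of :: "schedule \<Rightarrow> routing" where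
  "routing_of S =
     (let ms = concat (map fst (blocks S)) in
        \<lparr>horizon = length ms,
         matching = (\<lambda>t. if t < length ms then set (ms ! t) else {}),
         flow = blocks_flow 0 (blocks S)\<rparr>)"

definition wf_schedule :: "schedule \<Rightarrow> bool" where
  "wf_schedule S \<longleftrightarrow> (\<forall>(q, b) \<in> set S. \<forall>(vs, a, d) \<in> set (snd b). vs \<noteq> [] \<and> d > 0)"

definition encode_list :: "('a \<Rightarrow> nat list) \<Rightarrow> 'a list \<Rightarrow> nat list" where
  "encode_list enc xs = length xs # concat (map enc xs)"

definition encode_block :: "block \<Rightarrow> nat list" where
  "encode_block = (\<lambda>(ms, fs).
     encode_list (encode_list (\<lambda>(i, j). [i, j])) ms @
     encode_list (\<lambda>(vs, a, d). encode_list (\<lambda>v. [v]) vs @ [a, d]) fs)"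

definition encode_schedule :: "schedule \<Rightarrow> nat list" where
  "encode_schedule = encode_list (\<lambda>(q, b). q # encode_block b)"


section \<open>Worst-case optimality\<close>

text \<open>
  Up to a constant factor, the worst value of algorithm \<open>A\<close> over all demands for \<open>n\<close> and \<open>B\<close> is
  the worst value, over the same demands, of the best integral routing.
\<close>

definition worst_case_optimal ::
    "(nat \<Rightarrow> (nat \<Rightarrow> nat \<Rightarrow> rat) \<Rightarrow> routing \<Rightarrow> real) \<Rightarrow>
     (nat \<times> (nat \<Rightarrow> nat \<Rightarrow> rat) \<Rightarrow> schedule) \<Rightarrow> bool" where
  "worst_case_optimal obj A \<longleftrightarrow>
     (\<exists>K>0. \<forall>n\<ge>2. \<forall>B>0. \<exists>E \<in> demands n B. \<forall>D \<in> demands n B. \<forall>R.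
        integral_routing_for n E R \<longrightarrow>
        obj n D (routing_of (A (n, D))) \<le> K * obj n E R)"

end

(*
  Upper bound: Valiant load balancing on a circulant digit network. In one block of 2 L r steps, step
  (k, d) rotates all nodes by d r^k modulo n, for k running twice through the digit positions. Data
  from i to j is split evenly over N words w < r^L, where N is a multiple of n with r^L <= 2 N: it
  moves according to the digits of w in the first half of the block and according to the digits of a
  word w' = j - i - w modulo N in the second half. Both w and w' are uniform, so an edge of step (k, d)
  carries at most B r^(L-1) / N <= 2 B / r, and q = O(1 + B / r) copies of the block suffice. With
  r = min n (B + O(1)) and L = log_r n + O(1) the makespan 2 q L r has the claimed order. The routing is
  given by closed formulas in i, j, w and the step, so nested bounded loops write it down.

  Lower bound: a node reaches few nodes by time T with at most h physical arcs, since a path is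
  determined by the times at which it leaves its current node. The demand towards the other nodes uses
  more than h units of capacity per unit of flow, while at most n T units exist up to time T; so a
  constant fraction of the demand completes after time T.
*)

theory Submission
  imports Defs
begin

section \<open>Paths as node sequences\<close>

text \<open>Digit steps along \<open>j - i\<close> alone could pile up many pairs on one edge. With
  an intermediate word, the position in the first half depends on \<open>i\<close> and
  \<open>w\<close> only, so edge and word fix the source and a row sum bounds the load; in the
  second half the remaining displacement depends on the partner only, so they fix the target and a
  column sum bounds the load. Rotations are matchings for every \<open>n\<close>, whereas
  \<open>r ^ L\<close> is rarely a multiple of \<open>n\<close>; the multiple \<open>N\<close> makes
  a pairing of words modulo \<open>N\<close> meaningful for nodes modulo \<open>n\<close>. The
  algorithm is not told \<open>B\<close>. It uses an integer estimate exceeding the largest line sum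
  by at most 1, which costs a constant factor. The number of copies may be exponential in the input
  size, so it is emitted as one binary number and never bounds a loop. To avoid store bookkeeping
  for each machine program, the program is compiled from a small scoped language whose correctness
  and time bound are proved once. As \<open>B\<close> may be irrational while demands are rational,
  worst-case optimality compares with a uniform matrix for a rational bound between
  \<open>B / 2\<close> and \<open>B\<close>.\<close>

lemma length_timed_path [simp]: "length (timed_path vs) = length vs - 1"
  by (simp add: timed_path_def)

lemma nth_timed_path [simp]:
  "k < length vs - 1 \<Longrightarrow> timed_path vs ! k = ((vs ! k, k), (vs ! Suc k, Suc k))"
  by (simp add: timed_path_def)

lemma in_timed_path_iff:
  "((v, t), (v', t')) \<in> set (timed_path vs) \<longleftrightarrow>
     Suc t < length vs \<and> t' = Suc t \<and> vs ! t = v \<and> vs ! Suc t = v'"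
  by (auto simp: timed_path_def)

text \<open>A single node yields the empty arc list, which forgets the node; from two nodes on,
  every node is an end of some arc.\<close>

lemma timed_path_inject:
  assumes "timed_path us = timed_path vs" "1 < length us" "1 < length vs"
  shows "us = vs"
proof (rule nth_equalityI)
  show len: "length us = length vs"
    using arg_cong[OF assms(1), of length] assms(2,3) by simp
  fix k assume k: "k < length us"
  show "us ! k = vs ! k"
  proof (cases k)
    case 0
    then show ?thesis
      using arg_cong[OF assms(1), of "\<lambda>P. P ! 0"] assms(2,3) by simp
  next
    case (Suc l)
    then have "timed_path us ! l = timed_path vs ! l" using assms(1) by simp
    then show ?thesis using Suc k len by simp
  qed
qed

text \<open>A path out of layer 0 without its time stamps: a repeated node is a virtual arc, since
  entry \<open>k\<close> stands for the vertex \<open>(vs ! k, k)\<close>.\<close>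

definition walk :: "nat \<Rightarrow> routing \<Rightarrow> nat \<Rightarrow> nat list \<Rightarrow> bool" where
  "walk n R t vs \<longleftrightarrow> length vs = Suc t \<and> set vs \<subseteq> {..<n} \<and> t \<le> horizon R \<and>
     (\<forall>k<t. vs ! k = vs ! Suc k \<or> (vs ! k, vs ! Suc k) \<in> matching R k)"

lemma time_arc_iff:
  "((i, a), (j, b)) \<in> arcs (time_graph n R) \<longleftrightarrow>
     b = Suc a \<and> a < horizon R \<and> (i = j \<and> i < n \<or> (i, j) \<in> matching R a)"
  by (auto simp: time_graph_def virtual_arcs_def physical_arcs_def)

text \<open>The start layer \<open>a\<close> is general because the induction removes the first arc,
  whose head lies one layer later. Every arc advances time by one, so the arcs carry no more
  information than the node sequence.\<close>

lemma cas_nodes: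
  assumes "pre_digraph.cas (time_graph n R) (i, a) P (j, b)" "set P \<subseteq> arcs (time_graph n R)"
  shows "b = a + length P \<and> (\<exists>vs. length vs = Suc (length P) \<and> vs ! 0 = i \<and> vs ! length P = j \<and>
    (\<forall>k<length P. P ! k = ((vs ! k, a + k), (vs ! Suc k, Suc (a + k))) \<and> a + k < horizon R \<and>
       (vs ! k = vs ! Suc k \<and> vs ! k < n \<or> (vs ! k, vs ! Suc k) \<in> matching R (a + k))))"
  using assms
proof (induction P arbitrary: i a)
  case Nil
  then show ?case by (auto simp: pre_digraph.cas.simps intro!: exI[of _ "[i]"])
next
  case (Cons e P)
  from Cons.prems have e: "fst e = (i, a)"
    by (simp add: pre_digraph.cas.simps time_graph_def)
  obtain i' a' where e': "e = ((i, a), (i', a'))" using e by (cases e) auto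
  with Cons.prems(2) have arc: "a' = Suc a" "a < horizon R" "i = i' \<and> i < n \<or> (i, i') \<in> matching R a"
    by (auto simp: time_arc_iff)
  have "pre_digraph.cas (time_graph n R) (i', Suc a) P (j, b)"
    using Cons.prems e' arc by (simp add: pre_digraph.cas.simps) (simp add: time_graph_def)
  from Cons.IH[OF this] Cons.prems(2) obtain vs where vs: "b = Suc a + length P"
    "length vs = Suc (length P)" "vs ! 0 = i'" "vs ! length P = j"
    "\<forall>k<length P. P ! k = ((vs ! k, Suc a + k), (vs ! Suc k, Suc (Suc a + k))) \<and>
       Suc a + k < horizon R \<and>
       (vs ! k = vs ! Suc k \<and> vs ! k < n \<or> (vs ! k, vs ! Suc k) \<in> matching R (Suc a + k))"
    by auto
  have "\<forall>k<length (e # P). (e # P) ! k = (((i # vs) ! k, a + k), ((i # vs) ! Suc k, Suc (a + k))) \<and>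
      a + k < horizon R \<and>
      ((i # vs) ! k = (i # vs) ! Suc k \<and> (i # vs) ! k < n \<or>
       ((i # vs) ! k, (i # vs) ! Suc k) \<in> matching R (a + k))"
    using vs(3,5) arc e' by (auto simp: less_Suc_eq_0_disj)
  then show ?case
    using vs(1,2,4) by (intro conjI exI[of _ "i # vs"]) simp_all
qed

lemma path_nodes:
  assumes M: "\<And>t. t < horizon R \<Longrightarrow> matching R t \<subseteq> {..<n} \<times> {..<n}"
    and P: "P \<in> paths n R i j t"
  shows "\<exists>vs. walk n R t vs \<and> P = timed_path vs \<and> vs ! 0 = i \<and> vs ! t = j"
proof -
  have P: "pre_digraph.cas (time_graph n R) (i, 0) P (j, t)" "set P \<subseteq> arcs (time_graph n R)"
    "(i, 0) \<in> verts (time_graph n R)"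
    using P by (auto simp: paths_def pre_digraph.apath_def pre_digraph.awalk_def)
  from cas_nodes[OF P(1,2)] obtain vs where vs: "length P = t" "length vs = Suc t"
    "vs ! 0 = i" "vs ! t = j"
    "\<forall>k<t. P ! k = ((vs ! k, k), (vs ! Suc k, Suc k)) \<and> k < horizon R \<and>
       (vs ! k = vs ! Suc k \<and> vs ! k < n \<or> (vs ! k, vs ! Suc k) \<in> matching R k)"
    by auto
  have nodes: "vs ! k < n" if "k \<le> t" for k
  proof (cases k)
    case 0
    then show ?thesis using P(3) vs(3) by (simp add: time_graph_def)
  next
    case (Suc l)
    then have "l < t" using that by simp
    then show ?thesis using vs(5) M[of l] Suc by auto
  qed
  then have "set vs \<subseteq> {..<n}" using vs(2) by (auto simp: in_set_conv_nth less_Suc_eq_le)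
  moreover have "t \<le> horizon R" using vs(5) by (cases t) auto
  moreover have "P = timed_path vs" using vs by (intro nth_equalityI) auto
  ultimately show ?thesis
    using vs by (intro exI[of _ vs]) (auto simp: walk_def)
qed

text \<open>Time stamps strictly increase along the walk, so its vertices are distinct even if nodes
  repeat; this gives the distinctness that \<open>apath\<close> demands.\<close>

lemma timed_path_in_paths:
  assumes "walk n R t vs"
  shows "timed_path vs \<in> paths n R (vs ! 0) (vs ! t) t"
proof -
  interpret pre_digraph "time_graph n R" .
  have vs: "length vs = Suc t" "t \<le> horizon R" and nodes: "\<And>k. k \<le> t \<Longrightarrow> vs ! k < n"
    and step: "\<And>k. k < t \<Longrightarrow> vs ! k = vs ! Suc k \<or> (vs ! k, vs ! Suc k) \<in> matching R k"
    using assms by (auto simp: walk_def less_Suc_eq_le dest!: subsetD[OF _ nth_mem])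
  \<comment> \<open>The suffix starting in layer \<open>k\<close>. Both \<open>cas\<close> and
    \<open>awalk_verts\<close> recurse on the first arc, hence the induction from \<open>t\<close>
    downwards.\<close>
  define P where "P k = map (\<lambda>k. ((vs ! k, k), (vs ! Suc k, Suc k))) [k..<t]" for k
  have P_Cons: "P k = ((vs ! k, k), (vs ! Suc k, Suc k)) # P (Suc k)" if "k < t" for k
    using that by (simp add: P_def upt_conv_Cons)
  have "cas (vs ! k, k) (P k) (vs ! t, t) \<and>
      awalk_verts (vs ! k, k) (P k) = map (\<lambda>k. (vs ! k, k)) [k..<Suc t]" if "k \<le> t" for k
    using that
  proof (induction k rule: inc_induct)
    case base
    then show ?case by (simp add: P_def)
  next
    case (step k)
    then show ?case by (simp add: P_Cons upt_conv_Cons) (simp add: time_graph_def)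
  qed
  from this[of 0] have *: "cas (vs ! 0, 0) (timed_path vs) (vs ! t, t)"
    "awalk_verts (vs ! 0, 0) (timed_path vs) = map (\<lambda>k. (vs ! k, k)) [0..<Suc t]"
    using vs by (simp_all add: P_def timed_path_def)
  have "set (timed_path vs) \<subseteq> arcs (time_graph n R)"
  proof
    fix e assume "e \<in> set (timed_path vs)"
    moreover obtain v a w b where "e = ((v, a), (w, b))" by (metis surj_pair)
    ultimately show "e \<in> arcs (time_graph n R)"
      using vs step[of a] nodes[of a] by (auto simp: time_arc_iff in_timed_path_iff)
  qed
  then show ?thesis
    using * nodes[of 0] unfolding paths_def apath_def awalk_def
    by (auto simp: time_graph_def distinct_map inj_on_def simp del: upt_Suc)
qed

lemma timed_path_in_paths_iff:
  assumes M: "\<And>t. t < horizon R \<Longrightarrow> matching R t \<subseteq> {..<n} \<times> {..<n}"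
    and vs: "walk n R t vs" "0 < t" "0 < t'"
  shows "timed_path vs \<in> paths n R i j t' \<longleftrightarrow> i = vs ! 0 \<and> j = vs ! t \<and> t' = t"
proof
  assume "timed_path vs \<in> paths n R i j t'"
  from path_nodes[OF M this] obtain us where us: "walk n R t' us" "timed_path vs = timed_path us"
    "us ! 0 = i" "us ! t' = j"
    by blast
  then have "vs = us" using vs by (intro timed_path_inject) (auto simp: walk_def)
  then show "i = vs ! 0 \<and> j = vs ! t \<and> t' = t" using us vs by (auto simp: walk_def)
qed (use timed_path_in_paths[OF vs(1)] in auto)

text \<open>The uniqueness holds already among all physical arcs that are present, loaded or
  not.\<close>

lemma integral_if_matchings:
  assumes "\<And>t. t < horizon R \<Longrightarrow> is_matching n (matching R t)"
  shows "integral n R"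
  unfolding integral_def Uniq_def
proof (intro allI impI conjI; elim conjE)
  fix t i e e'
  assume t: "t < horizon R" and *: "e \<in> physical_arcs R" "e' \<in> physical_arcs R"
  have inj: "inj_on fst (matching R t)" "inj_on snd (matching R t)"
    using assms[OF t] by (auto simp: is_matching_def)
  show "e' = e" if "fst e = (i, t)" "fst e' = (i, t)"
    using * that inj_onD[OF inj(1)] by (fastforce simp: physical_arcs_def)
  show "e' = e" if "snd e = (i, Suc t)" "snd e' = (i, Suc t)"
    using * that inj_onD[OF inj(2)] by (fastforce simp: physical_arcs_def)
qed

section \<open>Repeating a block\<close>

definition delayed :: "nat \<Rightarrow> nat list \<Rightarrow> nat list" where
  "delayed s vs = replicate s (hd vs) @ vs"

definition weight :: "nat list \<times> nat \<times> nat \<Rightarrow> real" where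
  "weight x = real (fst (snd x)) / real (snd (snd x))"

lemma weight_nonneg [simp]: "0 \<le> weight x"
  by (simp add: weight_def)

lemma sum_list_neutral: "(\<And>x. x \<in> set xs \<Longrightarrow> f x = 0) \<Longrightarrow> (\<Sum>x\<leftarrow>xs. f x) = (0 :: real)"
  by (induction xs) auto

lemma blocks_flow_replicate:
  "blocks_flow s (replicate q (ms, fs)) P =
     (\<Sum>c<q. \<Sum>x\<leftarrow>fs. if P = timed_path (delayed (s + c * length ms) (fst x)) then weight x else 0)"
proof (induction q arbitrary: s)
  case (Suc q)
  have "blocks_flow s (replicate (Suc q) (ms, fs)) P =
      (\<Sum>x\<leftarrow>fs. if P = timed_path (delayed s (fst x)) then weight x else 0) +
      blocks_flow (s + length ms) (replicate q (ms, fs)) P"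
    by (simp add: delayed_def weight_def case_prod_unfold cong: if_cong)
  then show ?case
    unfolding Suc by (simp add: sum.lessThan_Suc_shift algebra_simps del: sum.lessThan_Suc)
qed simp

lemma nth_concat_replicate:
  "t < q * length ms \<Longrightarrow> concat (replicate q ms) ! t = ms ! (t mod length ms)"
proof (induction q arbitrary: t)
  case (Suc q)
  show ?case
  proof (cases "t < length ms")
    case False
    then have "t - length ms < q * length ms" using Suc.prems by simp
    then show ?thesis using Suc.IH[of "t - length ms"] False by (simp add: nth_append le_mod_geq)
  qed (simp add: nth_append)
qed simp

lemma length_concat_replicate: "length (concat (replicate q xs)) = q * length xs"
  by (induction q) auto

lemma routing_of_repeated:
  "routing_of [(q, (ms, fs))] =
     \<lparr>horizon = q * length ms,
      matching = (\<lambda>t. if t < q * length ms then set (ms ! (t mod length ms)) else {}),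
      flow = blocks_flow 0 (replicate q (ms, fs))\<rparr>"
  by (simp add: routing_of_def blocks_def Let_def length_concat_replicate
      nth_concat_replicate cong: if_cong)

lemma sum_sum_list_swap: "(\<Sum>x\<in>A. \<Sum>y\<leftarrow>ys. f x y) = (\<Sum>y\<leftarrow>ys. \<Sum>x\<in>A. f x y :: real)"
  by (induction ys) (auto simp: sum.distrib)

text \<open>Conditions on one block under which \<open>q\<close> copies of it route
  \<open>D\<close>. Copies occupy disjoint layers, so \<open>capacity\<close> speaks of a single
  block. \<open>demand\<close> is an equality, so that no surplus flow enters the completion
  time.\<close>

locale repeated_block =
  fixes n q :: nat and D :: "nat \<Rightarrow> nat \<Rightarrow> rat"
    and ms :: "(nat \<times> nat) list list" and fs :: "(nat list \<times> nat \<times> nat) list"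
  assumes ms_nonempty: "ms \<noteq> []"
    and matching: "\<And>u. u < length ms \<Longrightarrow> is_matching n (set (ms ! u))"
    and listed: "\<And>vs a d. (vs, a, d) \<in> set fs \<Longrightarrow> length vs = Suc (length ms) \<and> 0 < d \<and>
      set vs \<subseteq> {..<n} \<and>
      (\<forall>u<length ms. vs ! u = vs ! Suc u \<or> (vs ! u, vs ! Suc u) \<in> set (ms ! u))"
    and capacity: "\<And>u v v'. u < length ms \<Longrightarrow> (v, v') \<in> set (ms ! u) \<Longrightarrow>
      (\<Sum>x\<leftarrow>fs. if fst x ! u = v \<and> fst x ! Suc u = v' then weight x else 0) \<le> 1"
    and demand: "\<And>i j. i < n \<Longrightarrow> j < n \<Longrightarrow>
      real q * (\<Sum>x\<leftarrow>fs. if fst x ! 0 = i \<and> fst x ! length ms = j then weight x else 0) =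
      of_rat (D i j)"
begin

abbreviation "len \<equiv> length ms"

definition R where "R = routing_of [(q, (ms, fs))]"

lemma horizon_R: "horizon R = q * len"
  by (simp add: R_def routing_of_repeated)

lemma matching_R: "t < q * len \<Longrightarrow> matching R t = set (ms ! (t mod len))"
  by (simp add: R_def routing_of_repeated)

lemma len_pos: "0 < len"
  using ms_nonempty by simp

lemma is_matching_R: "t < horizon R \<Longrightarrow> is_matching n (matching R t)"
  using matching len_pos by (simp add: horizon_R matching_R)

lemma matching_R_subset: "t < horizon R \<Longrightarrow> matching R t \<subseteq> {..<n} \<times> {..<n}"
  using is_matching_R by (simp add: is_matching_def)

lemma flow_R:
  "flow R P = (\<Sum>c<q. \<Sum>x\<leftarrow>fs. if P = timed_path (delayed (c * len) (fst x)) then weight x else 0)"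
  by (simp add: R_def routing_of_repeated blocks_flow_replicate)

lemma flow_R_nonneg: "0 \<le> flow R P"
  unfolding flow_R by (intro sum_nonneg sum_list_nonneg) auto

text \<open>Several list entries may describe the same path; summing over entries instead of paths
  counts each with its own weight.\<close>

lemma sum_flow_R:
  assumes "finite A"
  shows "(\<Sum>P\<in>A. flow R P) =
    (\<Sum>c<q. \<Sum>x\<leftarrow>fs. if timed_path (delayed (c * len) (fst x)) \<in> A then weight x else 0)"
  unfolding flow_R
  by (subst sum.swap) (simp add: sum_sum_list_swap assms)

lemma nth_delayed:
  assumes "vs \<noteq> []"
  shows "delayed s vs ! k = vs ! (k - s)"
  using assms by (auto simp: delayed_def nth_append hd_conv_nth)

lemma walk_delayed:
  assumes "x \<in> set fs" "c < q"
  shows "walk n R (Suc c * len) (delayed (c * len) (fst x))"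
proof -
  obtain vs a d where x: "x = (vs, a, d)" by (cases x)
  have vs: "length vs = Suc len" "set vs \<subseteq> {..<n}"
    "\<And>u. u < len \<Longrightarrow> vs ! u = vs ! Suc u \<or> (vs ! u, vs ! Suc u) \<in> set (ms ! u)"
    using listed assms(1) x by blast+
  have ne: "vs \<noteq> []" using vs(1) by auto
  have le: "Suc c * len \<le> q * len" using assms(2) by (intro mult_le_mono1) simp
  show ?thesis
    unfolding walk_def x fst_conv
  proof (intro conjI allI impI)
    show "length (delayed (c * len) vs) = Suc (Suc c * len)" using vs(1) by (simp add: delayed_def)
    show "set (delayed (c * len) vs) \<subseteq> {..<n}"
      using vs(2) subsetD[OF vs(2) hd_in_set[OF ne]] by (auto simp: delayed_def)
    show "Suc c * len \<le> horizon R" using le by (simp add: horizon_R)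
    fix k assume k: "k < Suc c * len"
    show "delayed (c * len) vs ! k = delayed (c * len) vs ! Suc k \<or>
      (delayed (c * len) vs ! k, delayed (c * len) vs ! Suc k) \<in> matching R k"
    proof (cases "k < c * len")
      case True
      then show ?thesis using ne by (simp add: nth_delayed)
    next
      case False
      define u where "u = k - c * len"
      have u: "k = c * len + u" "u < len" using False k by (auto simp: u_def)
      then have "matching R k = set (ms ! u)" using k le by (subst matching_R) auto
      then show ?thesis using vs(3)[OF u(2)] u ne by (auto simp: nth_delayed)
    qed
  qed
qed

lemma delayed_in_paths_iff:
  assumes "x \<in> set fs" "c < q" "0 < t"
  shows "timed_path (delayed (c * len) (fst x)) \<in> paths n R i j t \<longleftrightarrow>
    fst x ! 0 = i \<and> fst x ! len = j \<and> t = Suc c * len"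
proof -
  have ne: "fst x \<noteq> []" using listed[of "fst x" "fst (snd x)" "snd (snd x)"] assms(1) by auto
  have "timed_path (delayed (c * len) (fst x)) \<in> paths n R i j t \<longleftrightarrow>
    i = delayed (c * len) (fst x) ! 0 \<and> j = delayed (c * len) (fst x) ! (Suc c * len) \<and> t = Suc c * len"
    using len_pos assms
    by (intro timed_path_in_paths_iff matching_R_subset walk_delayed) auto
  then show ?thesis by (auto simp: nth_delayed[OF ne])
qed

lemma endpoints_lt:
  assumes "x \<in> set fs"
  shows "fst x ! 0 < n" "fst x ! len < n"
proof -
  have "length (fst x) = Suc len" "set (fst x) \<subseteq> {..<n}"
    using listed[of "fst x" "fst (snd x)" "snd (snd x)"] assms by auto
  then show "fst x ! 0 < n" "fst x ! len < n"
    using subsetD[OF _ nth_mem[of 0 "fst x"], of "{..<n}"]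
      subsetD[OF _ nth_mem[of len "fst x"], of "{..<n}"] by auto
qed

lemma delayed_in_all_paths:
  assumes "x \<in> set fs" "c < q"
  shows "timed_path (delayed (c * len) (fst x)) \<in> all_paths n R"
proof -
  have "1 \<le> Suc c * len" using mult_pos_pos[of "Suc c", OF _ len_pos] by linarith
  moreover have "Suc c * len \<le> horizon R" unfolding horizon_R
    using assms(2) by (intro mult_le_mono1) simp
  moreover have "timed_path (delayed (c * len) (fst x)) \<in> paths n R (fst x ! 0) (fst x ! len) (Suc c * len)"
    using delayed_in_paths_iff[OF assms, of "Suc c * len"] len_pos by simp
  ultimately show ?thesis
    using endpoints_lt[OF assms(1)] unfolding all_paths_def by force
qed

lemma is_routing_R: "is_routing n R"
  unfolding is_routing_def
proof (intro conjI allI ballI impI is_matching_R flow_R_nonneg)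
  fix P assume "P \<notin> all_paths n R"
  then show "flow R P = 0"
    unfolding flow_R using delayed_in_all_paths
    by (intro sum.neutral ballI) (auto intro!: sum_list_neutral)
qed auto

text \<open>Only copy \<open>t div len\<close> can use a physical arc of layer \<open>t\<close>:
  earlier copies have ended, and later ones still wait at their sources.\<close>

lemma load_R_le:
  assumes "e \<in> physical_arcs R"
  shows "load n R e \<le> 1"
proof -
  obtain v v' t where e: "e = ((v, t), (v', Suc t))" "t < q * len" "(v, v') \<in> matching R t"
    using assms by (auto simp: physical_arcs_def horizon_R)
  define c u where "c = t div len" and "u = t mod len"
  have t: "t = c * len + u" and u: "u < len" and c: "c < q"
    using e(2) len_pos by (auto simp: c_def u_def div_less_iff_less_mult)
  have m: "(v, v') \<in> set (ms ! u)" using e(2,3) by (simp add: matching_R u_def)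
  have neq: "v \<noteq> v'" using is_matching_R[of t] e(2,3) by (auto simp: is_matching_def horizon_R)
  have only: "c' = c \<and> fst x ! u = v \<and> fst x ! Suc u = v'"
    if "x \<in> set fs" "c' < q" "e \<in> set (timed_path (delayed (c' * len) (fst x)))" for x c'
  proof -
    have len: "length (fst x) = Suc len"
      using listed[of "fst x" "fst (snd x)" "snd (snd x)"] that(1) by auto
    then have ne: "fst x \<noteq> []" by auto
    have *: "Suc t < length (delayed (c' * len) (fst x))"
      "fst x ! (t - c' * len) = v" "fst x ! (Suc t - c' * len) = v'"
      using that(3) ne unfolding e(1) in_timed_path_iff by (auto simp: nth_delayed)
    have "t < Suc c' * len" using * len by (simp add: delayed_def)
    \<comment> \<open>If copy \<open>c'\<close> began after \<open>t\<close>, both truncated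
      differences would be 0, forcing \<open>v = v'\<close>.\<close>
    moreover have "c' * len \<le> t"
      using * neq by (cases "c' * len \<le> t") auto
    ultimately have "t div len = c'"
      by (intro div_nat_eqI) (simp_all add: mult.commute)
    then have "c' = c" by (simp add: c_def)
    then show ?thesis using * t by (simp add: Suc_diff_le)
  qed
  have "finite {P \<in> all_paths n R. e \<in> set P}" using finite_all_paths[OF is_routing_R] by simp
  then have "load n R e = (\<Sum>c'<q. \<Sum>x\<leftarrow>fs.
      if timed_path (delayed (c' * len) (fst x)) \<in> {P \<in> all_paths n R. e \<in> set P} then weight x else 0)"
    unfolding load_def by (rule sum_flow_R)
  also have "\<dots> \<le> (\<Sum>c'<q. if c' = c then
      \<Sum>x\<leftarrow>fs. if fst x ! u = v \<and> fst x ! Suc u = v' then weight x else 0 else 0)"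
  proof (rule sum_mono)
    fix c' assume c': "c' \<in> {..<q}"
    show "(\<Sum>x\<leftarrow>fs. if timed_path (delayed (c' * len) (fst x)) \<in> {P \<in> all_paths n R. e \<in> set P}
        then weight x else 0) \<le>
      (if c' = c then \<Sum>x\<leftarrow>fs. if fst x ! u = v \<and> fst x ! Suc u = v' then weight x else 0 else 0)"
    proof (cases "c' = c")
      case True
      then show ?thesis using c' only[of _ c]
        by (auto intro!: sum_list_mono simp del: split_paired_All)
    next
      case False
      then have "timed_path (delayed (c' * len) (fst x)) \<notin> {P \<in> all_paths n R. e \<in> set P}"
        if "x \<in> set fs" for x
        using only[OF that, of c'] c' by auto
      then have "(\<Sum>x\<leftarrow>fs. if timed_path (delayed (c' * len) (fst x)) \<in> {P \<in> all_paths n R. e \<in> set P}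
        then weight x else 0) = 0"
        by (intro sum_list_neutral if_not_P) blast
      then show ?thesis using False by simp
    qed
  qed
  also have "\<dots> \<le> 1" using c capacity[OF u m] by simp
  finally show ?thesis .
qed

lemma sum_paths_R:
  assumes "0 < t"
  shows "(\<Sum>P \<in> paths n R i j t. flow R P) = (\<Sum>c<q. if t = Suc c * len then
    \<Sum>x\<leftarrow>fs. if fst x ! 0 = i \<and> fst x ! len = j then weight x else 0 else 0)"
proof -
  have "(\<Sum>P \<in> paths n R i j t. flow R P) = (\<Sum>c<q. \<Sum>x\<leftarrow>fs.
    if timed_path (delayed (c * len) (fst x)) \<in> paths n R i j t then weight x else 0)"
    by (intro sum_flow_R finite_paths is_matching_R)
  also have "\<dots> = (\<Sum>c<q. \<Sum>x\<leftarrow>fs.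
    if fst x ! 0 = i \<and> fst x ! len = j \<and> t = Suc c * len then weight x else 0)"
    using delayed_in_paths_iff[OF _ _ assms]
    by (intro sum.cong refl arg_cong[where f = sum_list] map_cong) auto
  also have "\<dots> = (\<Sum>c<q. if t = Suc c * len then
    \<Sum>x\<leftarrow>fs. if fst x ! 0 = i \<and> fst x ! len = j then weight x else 0 else 0)"
    by (intro sum.cong) (auto intro!: sum_list_neutral)
  finally show ?thesis .
qed

lemma sum_times:
  "(\<Sum>t = 1..horizon R. \<Sum>c<q. if t = Suc c * len then f t else 0) = (\<Sum>c<q. f (Suc c * len) :: real)"
proof -
  have "1 \<le> Suc c * len \<and> Suc c * len \<le> horizon R" if "c < q" for c
    using that mult_pos_pos[of "Suc c", OF _ len_pos] mult_le_mono1[of "Suc c" q len]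
    unfolding horizon_R by linarith
  then show ?thesis
    by (subst sum.swap) (simp del: mult_Suc)
qed

lemma served:
  assumes "i < n" "j < n"
  shows "(\<Sum>t = 1..horizon R. \<Sum>P \<in> paths n R i j t. flow R P) = of_rat (D i j)"
proof -
  let ?w = "\<Sum>x\<leftarrow>fs. if fst x ! 0 = i \<and> fst x ! len = j then weight x else 0"
  have "(\<Sum>t = 1..horizon R. \<Sum>P \<in> paths n R i j t. flow R P) =
    (\<Sum>t = 1..horizon R. \<Sum>c<q. if t = Suc c * len then ?w else 0)"
    by (intro sum.cong refl sum_paths_R) auto
  also have "\<dots> = real q * ?w" by (subst sum_times) simp
  finally show ?thesis using demand[OF assms] by simp
qed

lemma integral_routing_R: "integral_routing_for n D R"
  unfolding integral_routing_for_def feasible_def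
  using is_routing_R load_R_le served integral_if_matchings[OF is_matching_R] by auto

text \<open>Exactly the demanded amount is sent, and all of it arrives by the horizon.\<close>

lemma total_completion_time_R:
  "total_completion_time n R \<le> makespan R * (\<Sum>i<n. \<Sum>j<n. of_rat (D i j))"
proof -
  have "total_completion_time n R =
    (\<Sum>t = 1..horizon R. \<Sum>i<n. \<Sum>j<n. real t * (\<Sum>P \<in> paths n R i j t. flow R P))"
    by (simp add: total_completion_time_def sum_distrib_left)
  also have "\<dots> \<le> (\<Sum>t = 1..horizon R. \<Sum>i<n. \<Sum>j<n.
      real (horizon R) * (\<Sum>P \<in> paths n R i j t. flow R P))"
    by (intro sum_mono mult_right_mono sum_nonneg flow_R_nonneg) auto
  also have "\<dots> = real (horizon R) *
      (\<Sum>t = 1..horizon R. \<Sum>i<n. \<Sum>j<n. \<Sum>P \<in> paths n R i j t. flow R P)"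
    by (simp only: sum_distrib_left)
  also have "(\<Sum>t = 1..horizon R. \<Sum>i<n. \<Sum>j<n. \<Sum>P \<in> paths n R i j t. flow R P) =
      (\<Sum>i<n. \<Sum>j<n. \<Sum>t = 1..horizon R. \<Sum>P \<in> paths n R i j t. flow R P)"
    by (subst sum.swap, rule sum.cong[OF refl], subst sum.swap, rule refl)
  also have "\<dots> = (\<Sum>i<n. \<Sum>j<n. of_rat (D i j))"
    by (intro sum.cong refl served) auto
  finally show ?thesis by (simp add: makespan_def)
qed

lemma avg_completion_time_R: "avg_completion_time n D R \<le> makespan R"
proof (cases "(\<Sum>i<n. \<Sum>j<n. of_rat (D i j) :: real) = 0")
  \<comment> \<open>For zero total demand the quotient is 0 by the convention for division by
    0.\<close>
  case True
  then show ?thesis by (simp add: avg_completion_time_def makespan_def)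
next
  case False
  moreover have "0 \<le> (\<Sum>i<n. \<Sum>j<n. of_rat (D i j) :: real)"
    by (intro sum_nonneg) (auto simp flip: served intro!: sum_nonneg flow_R_nonneg)
  ultimately show ?thesis
    using total_completion_time_R by (simp add: avg_completion_time_def divide_le_eq)
qed

lemma wf_repeated: "wf_schedule [(q, (ms, fs))]"
  using listed by (fastforce simp: wf_schedule_def)

end

section \<open>Two-phase digit routing\<close>

text \<open>Step \<open>u\<close> encodes the digit value \<open>d = u mod r\<close> and the
  position \<open>k = u div r mod L\<close>; for \<open>u < 2 * L * r\<close> every pair
  \<open>(d, k)\<close> occurs twice.\<close>

definition shift :: "nat \<Rightarrow> nat \<Rightarrow> nat \<Rightarrow> nat \<Rightarrow> nat" where
  "shift n r L u = (u mod r * r ^ (u div r mod L)) mod n"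

text \<open>Displacement of word \<open>x\<close> in step \<open>u\<close>, not reduced modulo
  \<open>n\<close>, so that the displacements of a full pass add up to the word itself.\<close>

definition move :: "nat \<Rightarrow> nat \<Rightarrow> nat \<Rightarrow> nat \<Rightarrow> nat" where
  "move r L x u =
     (if x div r ^ (u div r mod L) mod r = u mod r then u mod r * r ^ (u div r mod L) else 0)"

definition offset :: "nat \<Rightarrow> nat \<Rightarrow> nat \<Rightarrow> nat \<Rightarrow> nat \<Rightarrow> nat" where
  "offset r L w w' u = (\<Sum>s<u. move r L (if s div r < L then w else w') s)"

text \<open>
  If \<open>N\<close> is a multiple of \<open>n\<close>, then \<open>w\<close> and its partner add up to \<open>j - i\<close> modulo \<open>n\<close>, and for fixed
  \<open>i\<close> and \<open>j\<close> both are uniformly distributed over \<open>{..<N}\<close> if \<open>w\<close> is.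
\<close>

definition partner :: "nat \<Rightarrow> nat \<Rightarrow> nat \<Rightarrow> nat \<Rightarrow> nat" where
  "partner N i j w = (j + 2 * N - i - w) mod N"

text \<open>Rotation by 0 would consist of loops, which a matching excludes; it is replaced by the
  empty matching.\<close>

definition rotation :: "nat \<Rightarrow> nat \<Rightarrow> (nat \<times> nat) list" where
  "rotation n c = (if c = 0 then [] else map (\<lambda>v. (v, (v + c) mod n)) [0..<n])"

definition route :: "nat \<Rightarrow> nat \<Rightarrow> nat \<Rightarrow> nat \<Rightarrow> nat \<Rightarrow> nat \<Rightarrow> nat \<Rightarrow> nat list" where
  "route n r L N i j w =
     map (\<lambda>u. (i + offset r L w (partner N i j w) u) mod n) [0..<Suc (2 * L * r)]"

definition num :: "rat \<Rightarrow> nat" where "num x = nat (fst (quotient_of x))"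
definition den :: "rat \<Rightarrow> nat" where "den x = nat (snd (quotient_of x))"

definition digit_matchings :: "nat \<Rightarrow> nat \<Rightarrow> nat \<Rightarrow> (nat \<times> nat) list list" where
  "digit_matchings n r L = map (\<lambda>u. rotation n (shift n r L u)) [0..<2 * L * r]"

text \<open>Each of the \<open>N\<close> words in each of the \<open>q\<close> copies carries the
  same share of \<open>D i j\<close>. Multiplying the denominator keeps the weight an exact
  fraction.\<close>

definition digit_paths ::
    "nat \<Rightarrow> nat \<Rightarrow> nat \<Rightarrow> nat \<Rightarrow> nat \<Rightarrow> (nat \<Rightarrow> nat \<Rightarrow> rat) \<Rightarrow> (nat list \<times> nat \<times> nat) list" where
  "digit_paths n r L N q D =
     concat (map (\<lambda>i. concat (map (\<lambda>j. map (\<lambda>w.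
       (route n r L N i j w, num (D i j), den (D i j) * N * q)) [0..<N]) [0..<n])) [0..<n])"

lemma den_pos: "0 < den x"
  by (simp add: den_def quotient_of_denom_pos')

lemma of_rat_num_den:
  assumes "0 \<le> x"
  shows "of_rat x = real (num x) / real (den x)"
proof -
  obtain p q where pq: "quotient_of x = (p, q)" by fastforce
  then have q: "0 < q" by (rule quotient_of_denom_pos)
  have x: "x = of_int p / of_int q" using quotient_of_div[OF pq] .
  then have "0 \<le> p" using assms q by (simp add: zero_le_divide_iff)
  moreover have "(of_rat x :: real) = of_int p / of_int q" using x by (simp add: of_rat_divide)
  ultimately show ?thesis using q by (simp add: num_def den_def pq)
qed

lemma sum_list_concat_map:
  "(\<Sum>x\<leftarrow>concat (map g [0..<n]). f x) = (\<Sum>i<n. \<Sum>x\<leftarrow>g i. f x :: real)"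
  by (induction n) auto

lemma sum_digit_paths:
  "(\<Sum>x\<leftarrow>digit_paths n r L N q D. f x) =
     (\<Sum>i<n. \<Sum>j<n. \<Sum>w<N. f (route n r L N i j w, num (D i j), den (D i j) * N * q) :: real)"
  by (simp add: digit_paths_def sum_list_concat_map comp_def interv_sum_list_conv_sum_set_nat
      atLeast0LessThan)

lemma add_mod_inject:
  fixes n :: nat
  assumes "(v + c) mod n = (v' + c) mod n" "v < n" "v' < n"
  shows "v = v'"
proof -
  have "v mod n = v' mod n" using assms(1) by (simp add: nat_mod_eq_iff)
  then show ?thesis using assms by simp
qed

lemma in_rotation_iff:
  "(v, v') \<in> set (rotation n c) \<longleftrightarrow> c \<noteq> 0 \<and> v < n \<and> v' = (v + c) mod n"
  by (auto simp: rotation_def)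

lemma is_matching_rotation:
  assumes "c < n"
  shows "is_matching n (set (rotation n c))"
proof -
  have "v \<noteq> (v + c) mod n" if "v < n" "c \<noteq> 0" for v
    using add_mod_inject[of 0 v n c] that assms by (auto simp: add.commute)
  then show ?thesis
    using assms by (auto simp: is_matching_def in_rotation_iff inj_on_def intro: add_mod_inject)
qed

lemma offset_Suc: "offset r L w w' (Suc u) = offset r L w w' u + move r L (if u div r < L then w else w') u"
  by (simp add: offset_def)

lemma sum_digits:
  fixes r :: nat
  shows "(\<Sum>k<L. (x div r ^ k mod r) * r ^ k) = x mod r ^ L"
proof (induction L)
  case (Suc L)
  have "x mod r ^ Suc L = r ^ L * (x div r ^ L mod r) + x mod r ^ L"
    by (simp add: mod_mult2_eq mult.commute[of r])
  then show ?case using Suc by (simp add: algebra_simps)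
qed simp

text \<open>Among the \<open>r\<close> steps of one digit position exactly one matches the digit of
  \<open>x\<close> and contributes its place value; the total is the base-\<open>r\<close>
  expansion.\<close>

lemma sum_moves:
  assumes "0 < r" "x < r ^ L"
  shows "(\<Sum>u<L * r. move r L x u) = x"
proof -
  have "(\<Sum>u<L * r. move r L x u) = (\<Sum>k<L. \<Sum>u = k * r..<k * r + r. move r L x u)"
    by (rule sum.nat_group[symmetric])
  also have "\<dots> = (\<Sum>k<L. (x div r ^ k mod r) * r ^ k)"
  proof (rule sum.cong[OF refl])
    fix k assume k: "k \<in> {..<L}"
    have "(\<Sum>u = k * r..<k * r + r. move r L x u) = (\<Sum>d<r. move r L x (k * r + d))"
      using sum.shift_bounds_nat_ivl[of "move r L x" 0 "k * r" r]
      by (simp add: atLeast0LessThan add.commute)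
    also have "\<dots> = (\<Sum>d<r. if x div r ^ k mod r = d then d * r ^ k else 0)"
      using k assms(1) by (intro sum.cong) (auto simp: move_def)
    also have "\<dots> = (x div r ^ k mod r) * r ^ k"
      using assms(1) by simp
    finally show "(\<Sum>u = k * r..<k * r + r. move r L x u) = (x div r ^ k mod r) * r ^ k" .
  qed
  also have "\<dots> = x" using assms(2) by (simp add: sum_digits)
  finally show ?thesis .
qed

lemma offset_first:
  assumes "0 < r" "u \<le> L * r"
  shows "offset r L w w' u = (\<Sum>s<u. move r L w s)"
  using assms by (auto simp: offset_def div_less_iff_less_mult intro!: sum.cong)

lemma offset_second:
  assumes "0 < r" "L * r \<le> u"
  shows "offset r L w w' (u + m) = offset r L w w' u + (\<Sum>s = u..<u + m. move r L w' s)"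
proof (induction m)
  case (Suc m)
  have "\<not> (u + m) div r < L" using assms by (simp add: div_less_iff_less_mult)
  then show ?case using Suc by (simp add: offset_Suc)
qed simp

lemma offset_total:
  assumes "0 < r" "0 < L" "w < r ^ L" "w' < r ^ L"
  shows "offset r L w w' (2 * L * r) = w + w'"
proof -
  \<comment> \<open>The position is taken modulo \<open>L\<close>, so the second half repeats the
    steps of the first.\<close>
  have "move r L w' (s + L * r) = move r L w' s" for s
    using assms by (simp add: move_def)
  then have "(\<Sum>s = L * r..<L * r + L * r. move r L w' s) = (\<Sum>s<L * r. move r L w' s)"
    using sum.shift_bounds_nat_ivl[of "move r L w'" 0 "L * r" "L * r"]
    by (simp add: atLeast0LessThan)
  then show ?thesis
    using offset_second[of r L "L * r" w w' "L * r"] offset_first[of r "L * r" L w w'] assms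
    by (simp add: sum_moves mult_2 add_mult_distrib)
qed

text \<open>With digit \<open>k\<close> fixed, a number below \<open>r ^ L\<close> is determined by
  its \<open>k\<close> lower and its \<open>L - Suc k\<close> upper digits.\<close>

lemma card_digit_le:
  assumes "0 < r" "k < L" "N \<le> r ^ L"
  shows "card {x \<in> {..<N}. x div r ^ k mod r = d} \<le> r ^ (L - 1)"
proof -
  let ?A = "{x \<in> {..<N}. x div r ^ k mod r = d}"
  let ?f = "\<lambda>x. (x mod r ^ k, x div r ^ Suc k)"
  have "inj_on ?f ?A"
  proof (rule inj_onI)
    fix x y assume xy: "x \<in> ?A" "y \<in> ?A" "?f x = ?f y"
    have decomp: "z = z div r ^ Suc k * r ^ Suc k + (r ^ k * (z div r ^ k mod r) + z mod r ^ k)" for z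
      using mod_mult2_eq[of z "r ^ k" r] div_mult_mod_eq[of z "r ^ k * r"]
      by (simp add: mult.commute[of r])
    show "x = y" using decomp[of x] decomp[of y] xy by simp
  qed
  moreover have "?f ` ?A \<subseteq> {..<r ^ k} \<times> {..<r ^ (L - Suc k)}"
  proof -
    have "r ^ L = r ^ (L - Suc k) * r ^ Suc k"
      by (metis Suc_leI assms(2) le_add_diff_inverse2 power_add)
    then have "x div r ^ Suc k < r ^ (L - Suc k)" if "x < N" for x
      using that assms(1,3) by (simp add: div_less_iff_less_mult del: power_Suc)
    then show ?thesis using assms(1) by (auto simp del: power_Suc)
  qed
  ultimately have "card ?A \<le> card ({..<r ^ k} \<times> {..<r ^ (L - Suc k)})"
    by (intro card_inj_on_le) auto
  also have "\<dots> = r ^ (L - 1)" using assms(2) by (simp flip: power_add)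
  finally show ?thesis .
qed

lemma sum_single_le:
  fixes f :: "nat \<Rightarrow> real"
  assumes "\<And>i. i < n \<Longrightarrow> f i \<le> b" "0 \<le> b" "\<And>i i'. i < n \<Longrightarrow> i' < n \<Longrightarrow> P i \<Longrightarrow> P i' \<Longrightarrow> i = i'"
  shows "(\<Sum>i<n. if P i then f i else 0) \<le> b"
proof (cases "\<exists>i<n. P i")
  case True
  then obtain i where i: "i < n" "P i" by blast
  then have "(\<Sum>i'<n. if P i' then f i' else 0) = (\<Sum>i'<n. if i' = i then f i' else 0)"
    using assms(3) by (intro sum.cong) auto
  then show ?thesis using i assms(1) by simp
next
  case False
  then have "(\<Sum>i<n. if P i then f i else 0) = 0" by (intro sum.neutral) auto
  then show ?thesis using assms(2) by simp
qed

text \<open>\<open>w\<close> is reflected to a constant minus \<open>w\<close> modulo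
  \<open>N\<close>; the summand \<open>2 * N\<close> keeps the truncated subtractions exact because
  \<open>i\<close> and \<open>w\<close> are below \<open>N\<close>. Equal images would make a
  nonzero difference below \<open>N\<close> vanish modulo \<open>N\<close>.\<close>

lemma partner_inj:
  assumes "i < N" "w < N" "w' < N" "partner N i j w = partner N i j w'"
  shows "w = w'"
proof -
  have "\<exists>d<N. (a + d) mod N = a mod N \<and> d \<noteq> 0" if "x < y" "y < N" "a = j + 2 * N - i - y"
    "(j + 2 * N - i - x) mod N = a mod N" for x y a :: nat
    using that assms(1) by (intro exI[of _ "y - x"]) auto
  moreover have "d = 0" if "d < N" "(a + d) mod N = a mod N" for a d :: nat
    using add_mod_inject[of d a N 0] that by (simp add: add.commute)
  ultimately show ?thesis
    using assms unfolding partner_def by (metis linorder_neqE_nat)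
qed

lemma sum_swap3:
  "(\<Sum>i\<in>A. \<Sum>j\<in>B. \<Sum>x\<in>C. f i j x) = (\<Sum>x\<in>C. \<Sum>i\<in>A. \<Sum>j\<in>B. f i j x)"
proof -
  have "(\<Sum>j\<in>B. \<Sum>x\<in>C. f i j x) = (\<Sum>x\<in>C. \<Sum>j\<in>B. f i j x)" for i
    by (rule sum.swap)
  then show ?thesis by (simp add: sum.swap[of _ C A])
qed

lemma sum_guarded:
  "(\<Sum>i\<in>A. \<Sum>j\<in>B. if P then (if Q i then g i j else 0) else 0) =
     (if P then (\<Sum>i\<in>A. if Q i then \<Sum>j\<in>B. g i j else 0) else (0::real))"
proof -
  have "(\<Sum>j\<in>B. if Q i then g i j else 0) = (if Q i then \<Sum>j\<in>B. g i j else 0)" for i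
    by simp
  then show ?thesis by simp
qed

text \<open>At most \<open>r ^ (L - 1)\<close> words use a given edge, and a word carries the share
  \<open>1 / (N * q)\<close> of its demand. \<open>row\<close> and \<open>col\<close> say that a
  whole row or column spread in this way fits into capacity 1.\<close>

locale digit_routing =
  fixes n r L N q :: nat and D :: "nat \<Rightarrow> nat \<Rightarrow> rat"
  assumes r: "0 < r" and L: "0 < L" and q: "0 < q" and n: "0 < n"
    and N: "n dvd N" "0 < N" "N \<le> r ^ L"
    and nonneg: "\<And>i j. i < n \<Longrightarrow> j < n \<Longrightarrow> 0 \<le> D i j"
    and row: "\<And>i. i < n \<Longrightarrow> (\<Sum>j<n. real_of_rat (D i j)) * real r ^ (L - 1) \<le> real N * real q"
    and col: "\<And>j. j < n \<Longrightarrow> (\<Sum>i<n. real_of_rat (D i j)) * real r ^ (L - 1) \<le> real N * real q"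
begin

abbreviation "ms \<equiv> digit_matchings n r L"
abbreviation "fs \<equiv> digit_paths n r L N q D"

lemma length_ms: "length ms = 2 * L * r"
  by (simp add: digit_matchings_def)

lemma nth_ms: "u < 2 * L * r \<Longrightarrow> ms ! u = rotation n (shift n r L u)"
  by (simp add: digit_matchings_def)

lemma shift_lt: "shift n r L u < n"
  using n by (simp add: shift_def)

lemma weight_eq:
  assumes "i < n" "j < n"
  shows "weight (vs, num (D i j), den (D i j) * N * q) = of_rat (D i j) / (real N * real q)"
  using of_rat_num_den[OF nonneg[OF assms]] by (simp add: weight_def mult.assoc)

lemma nth_route:
  "u \<le> 2 * L * r \<Longrightarrow>
   route n r L N i j w ! u = (i + offset r L w (partner N i j w) u) mod n"
  by (simp add: route_def less_Suc_eq_le del: upt_Suc)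

lemma route_step:
  assumes "u < 2 * L * r"
  shows "route n r L N i j w ! Suc u =
    (route n r L N i j w ! u + move r L (if u div r < L then w else partner N i j w) u) mod n"
  using assms by (simp add: nth_route offset_Suc mod_add_left_eq add.assoc)

lemma move_mod: "move r L x u = 0 \<or> move r L x u mod n = shift n r L u"
  by (auto simp: move_def shift_def)

lemma partner_lt: "partner N i j w < N"
  using N by (simp add: partner_def)

lemma n_le_N: "n \<le> N"
  using N by (simp add: dvd_imp_le)

lemma route_end:
  assumes "i < n" "j < n" "w < N"
  shows "route n r L N i j w ! (2 * L * r) = j"
proof -
  have "offset r L w (partner N i j w) (2 * L * r) = w + partner N i j w"
    using assms partner_lt[of i j w] N r L by (intro offset_total) auto
  moreover have "(i + (w + partner N i j w)) mod n = j"
  proof -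
    have "(i + (w + partner N i j w)) mod N = (i + w + (j + 2 * N - i - w)) mod N"
      unfolding partner_def by (metis add.assoc mod_add_right_eq)
    also have "\<dots> = (j + 2 * N) mod N"
      using assms n_le_N by (intro arg_cong[where f = "\<lambda>x. x mod N"]) simp
    \<comment> \<open>Here \<open>n dvd N\<close> turns the congruence modulo \<open>N\<close> into
      one modulo \<open>n\<close>.\<close>
    finally have "(i + (w + partner N i j w)) mod N mod n = (j + 2 * N) mod N mod n" by simp
    then show ?thesis using assms N(1) by (simp add: mod_mod_cancel)
  qed
  ultimately show ?thesis by (simp add: nth_route)
qed

lemma route_start: "i < n \<Longrightarrow> route n r L N i j w ! 0 = i"
  by (simp add: nth_route offset_def)

text \<open>If the digit differed from \<open>u mod r\<close>, the displacement would be 0, while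
  the edges of a rotation join different nodes.\<close>

lemma used_word:
  assumes "u < 2 * L * r" "(v, v') \<in> set (ms ! u)"
    "route n r L N i j w ! u = v" "route n r L N i j w ! Suc u = v'"
  shows "(if u div r < L then w else partner N i j w) div r ^ (u div r mod L) mod r = u mod r"
proof (rule ccontr)
  assume "\<not> ?thesis"
  then have "move r L (if u div r < L then w else partner N i j w) u = 0"
    by (simp add: move_def)
  then have "v' = v mod n" using assms(3,4) route_step[OF assms(1)] by simp
  moreover have "v \<noteq> v'" "v < n"
    using assms(1,2) is_matching_rotation[OF shift_lt[of u]]
    by (auto simp: nth_ms is_matching_def)
  ultimately show False by simp
qed

text \<open>The load that each of the \<open>r ^ (L - 1)\<close> words on an edge may
  contribute.\<close>

definition \<beta> :: real where "\<beta> = 1 / real r ^ (L - 1)"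

lemma sum_words_le:
  assumes "k < L" "\<And>x. x < N \<Longrightarrow> f x \<le> \<beta>"
  shows "(\<Sum>x<N. if x div r ^ k mod r = d then f x else 0) \<le> 1"
proof -
  have "(\<Sum>x<N. if x div r ^ k mod r = d then f x else 0) \<le>
      (\<Sum>x<N. if x div r ^ k mod r = d then \<beta> else 0)"
    using assms(2) by (intro sum_mono) auto
  also have "\<dots> = real (card {x \<in> {..<N}. x div r ^ k mod r = d}) * \<beta>"
    by (simp add: sum.inter_filter[symmetric])
  also have "\<dots> \<le> real (r ^ (L - 1)) * \<beta>"
    using card_digit_le[OF r assms(1) N(3)]
    by (intro mult_right_mono) (auto simp: \<beta>_def simp del: of_nat_power)
  also have "\<dots> = 1" using r by (simp add: \<beta>_def)
  finally show ?thesis .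
qed

lemma beta_row:
  assumes "i < n"
  shows "(\<Sum>j<n. of_rat (D i j) / (real N * real q)) \<le> \<beta>"
  using row[OF assms] r N(2) q by (simp add: \<beta>_def field_simps flip: sum_divide_distrib)

lemma beta_col:
  assumes "j < n"
  shows "(\<Sum>i<n. of_rat (D i j) / (real N * real q)) \<le> \<beta>"
  using col[OF assms] r N(2) q by (simp add: \<beta>_def field_simps flip: sum_divide_distrib)

text \<open>After fixing the word that decides the current step, one end of the demand pair is
  determined by the tail \<open>v\<close>, and the other end is summed out. What remains is a row
  sum in the first half and a column sum in the second, counted over words with a prescribed
  digit.\<close>

lemma capacity_ms:
  assumes u: "u < 2 * L * r" and v: "(v, v') \<in> set (ms ! u)"
  shows "(\<Sum>x\<leftarrow>fs. if fst x ! u = v \<and> fst x ! Suc u = v' then weight x else 0) \<le> 1"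
proof -
  define k where "k = u div r mod L"
  define d where "d = u mod r"
  define g where "g i j = of_rat (D i j) / (real N * real q)" for i j
  have k: "k < L" using L by (simp add: k_def)
  have g: "0 \<le> g i j" if "i < n" "j < n" for i j
    using nonneg[OF that] by (simp add: g_def)
  have "(\<Sum>x\<leftarrow>fs. if fst x ! u = v \<and> fst x ! Suc u = v' then weight x else 0) =
    (\<Sum>i<n. \<Sum>j<n. \<Sum>w<N. if route n r L N i j w ! u = v \<and> route n r L N i j w ! Suc u = v'
       then g i j else 0)" (is "?S = ?T")
    unfolding sum_digit_paths by (intro sum.cong) (auto simp: weight_eq g_def)
  also have "?T \<le> 1"
  proof (cases "u div r < L")
    case True
    \<comment> \<open>Displacement so far; it does not involve \<open>j\<close>, so \<open>v\<close>
      and \<open>w\<close> determine \<open>i\<close>.\<close>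
    define h where "h w = (\<Sum>s<u. move r L w s)" for w
    have "u \<le> L * r" using True r by (simp add: div_less_iff_less_mult)
    then have pos: "route n r L N i j w ! u = (i + h w) mod n" for i j w
      using u r by (simp add: nth_route offset_first h_def)
    have "?T \<le> (\<Sum>i<n. \<Sum>j<n. \<Sum>w<N. if w div r ^ k mod r = d then
        (if (i + h w) mod n = v then g i j else 0) else 0)"
    proof (intro sum_mono)
      fix i j w assume "i \<in> {..<n}" "j \<in> {..<n}"
      then show "(if route n r L N i j w ! u = v \<and> route n r L N i j w ! Suc u = v' then g i j else 0)
        \<le> (if w div r ^ k mod r = d then (if (i + h w) mod n = v then g i j else 0) else 0)"
        using used_word[OF u v, of i j w] True g[of i j] by (auto simp: k_def d_def pos)
    qed
    also have "\<dots> = (\<Sum>w<N. if w div r ^ k mod r = d then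
        (\<Sum>i<n. if (i + h w) mod n = v then \<Sum>j<n. g i j else 0) else 0)"
      by (subst sum_swap3) (intro sum.cong refl sum_guarded)
    also have "\<dots> \<le> 1"
    proof (rule sum_words_le[OF k], rule sum_single_le)
      show "(\<Sum>j<n. g i j) \<le> \<beta>" if "i < n" for i
        using beta_row[OF that] by (simp add: g_def)
      show "i = i'" if "i < n" "i' < n" "(i + h w) mod n = v" "(i' + h w) mod n = v" for i i' w
        using add_mod_inject[of i "h w" n i'] that by simp
    qed (simp add: \<beta>_def)
    finally show ?thesis .
  next
    case False
    \<comment> \<open>Displacement still to come; it depends on the partner \<open>x\<close> only,
      so \<open>v\<close> and \<open>x\<close> determine \<open>j\<close>.\<close>
    define h where "h x = (\<Sum>s = u..<2 * L * r. move r L x s)" for x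
    have "L * r \<le> u" using False r by (simp add: div_less_iff_less_mult)
    from offset_second[OF r this, of _ _ "2 * L * r - u"]
    have off: "offset r L w w' (2 * L * r) = offset r L w w' u + h w'" for w w'
      using u by (simp add: h_def)
    have pos: "(route n r L N i j w ! u + h (partner N i j w)) mod n = j"
      if "i < n" "j < n" "w < N" for i j w
      using route_end[OF that] u by (simp add: nth_route off mod_add_left_eq add.assoc)
    have "?T \<le> (\<Sum>i<n. \<Sum>j<n. \<Sum>x<N. if x div r ^ k mod r = d then
        (if (v + h x) mod n = j then g i j else 0) else 0)"
    proof (rule sum_mono, rule sum_mono)
      fix i j assume ij: "i \<in> {..<n}" "j \<in> {..<n}"
      let ?f = "\<lambda>x. if x div r ^ k mod r = d then (if (v + h x) mod n = j then g i j else 0) else 0"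
      have "(\<Sum>w<N. if route n r L N i j w ! u = v \<and> route n r L N i j w ! Suc u = v'
          then g i j else 0) \<le> (\<Sum>w<N. ?f (partner N i j w))"
      proof (intro sum_mono)
        fix w assume "w \<in> {..<N}"
        then show "(if route n r L N i j w ! u = v \<and> route n r L N i j w ! Suc u = v'
          then g i j else 0) \<le> ?f (partner N i j w)"
          using used_word[OF u v, of i j w] False g[of i j] ij pos[of i j w]
          by (auto simp: k_def d_def)
      qed
      \<comment> \<open>Injectivity allows summing over the partner instead of \<open>w\<close>,
        which makes the second half symmetric to the first.\<close>
      moreover have "inj_on (partner N i j) {..<N}"
        using ij n_le_N partner_inj[of i N _ _ j] by (intro inj_onI) auto
      then have "(\<Sum>w<N. ?f (partner N i j w)) = (\<Sum>x \<in> partner N i j ` {..<N}. ?f x)"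
        by (subst sum.reindex) simp_all
      moreover have "\<dots> \<le> (\<Sum>x<N. ?f x)"
        using partner_lt g ij by (intro sum_mono2) auto
      ultimately show "(\<Sum>w<N. if route n r L N i j w ! u = v \<and> route n r L N i j w ! Suc u = v'
          then g i j else 0) \<le> (\<Sum>x<N. ?f x)"
        by linarith
    qed
    also have "\<dots> = (\<Sum>x<N. if x div r ^ k mod r = d then
        (\<Sum>j<n. if (v + h x) mod n = j then \<Sum>i<n. g i j else 0) else 0)"
      by (subst sum_swap3, rule sum.cong[OF refl], subst sum.swap) (rule sum_guarded)
    also have "\<dots> \<le> 1"
    proof (rule sum_words_le[OF k], rule sum_single_le)
      show "(\<Sum>i<n. g i j) \<le> \<beta>" if "j < n" for j
        using beta_col[OF that] by (simp add: g_def)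
    qed (simp_all add: \<beta>_def)
    finally show ?thesis .
  qed
  finally show ?thesis .
qed

sublocale repeated_block n q D ms fs
proof
  show "ms \<noteq> []" using length_ms r L by (metis length_greater_0_conv mult_pos_pos zero_less_numeral)
  show "is_matching n (set (ms ! u))" if "u < length ms" for u
    using that is_matching_rotation[OF shift_lt] by (simp add: length_ms nth_ms)
  show "length vs = Suc (length ms) \<and> 0 < d \<and> set vs \<subseteq> {..<n} \<and>
      (\<forall>u<length ms. vs ! u = vs ! Suc u \<or> (vs ! u, vs ! Suc u) \<in> set (ms ! u))"
    if "(vs, a, d) \<in> set fs" for vs a d
  proof -
    from that obtain i j w where *: "i < n" "j < n" "w < N" "vs = route n r L N i j w"
      "d = den (D i j) * N * q"
      by (auto simp: digit_paths_def)
    have lt: "vs ! u < n" if "u \<le> 2 * L * r" for u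
      using that n by (simp add: * nth_route)
    have "vs ! u = vs ! Suc u \<or> (vs ! u, vs ! Suc u) \<in> set (rotation n (shift n r L u))"
      if u: "u < 2 * L * r" for u
    proof -
      let ?m = "move r L (if u div r < L then w else partner N i j w) u"
      have step: "vs ! Suc u = (vs ! u + ?m mod n) mod n"
        using route_step[OF u] by (simp add: * mod_add_right_eq)
      show ?thesis
      \<comment> \<open>A nonzero displacement can vanish modulo \<open>n\<close>; the route then
        stays where it is, in accordance with the empty rotation.\<close>
      proof (cases "?m mod n = 0")
        case True
        then show ?thesis using step lt[of u] u by simp
      next
        case False
        then have "?m mod n = shift n r L u" using move_mod[of _ u] by force
        then show ?thesis using False step lt[of u] u by (simp add: in_rotation_iff)
      qed
    qed
    moreover have "length vs = Suc (2 * L * r)" by (simp add: * route_def)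
    moreover have "set vs \<subseteq> {..<n}" using n by (auto simp: * route_def)
    ultimately show ?thesis using * den_pos N q by (simp add: length_ms nth_ms)
  qed
  show "(\<Sum>x\<leftarrow>fs. if fst x ! u = v \<and> fst x ! Suc u = v' then weight x else 0) \<le> 1"
    if "u < length ms" "(v, v') \<in> set (ms ! u)" for u v v'
    using capacity_ms that by (simp add: length_ms)
  show "real q * (\<Sum>x\<leftarrow>fs. if fst x ! 0 = i \<and> fst x ! length ms = j then weight x else 0) =
      of_rat (D i j)" if ij: "i < n" "j < n" for i j
  proof -
    have "(\<Sum>x\<leftarrow>fs. if fst x ! 0 = i \<and> fst x ! length ms = j then weight x else 0) =
      (\<Sum>i'<n. \<Sum>j'<n. \<Sum>w<N. if i' = i \<and> j' = j then of_rat (D i j) / (real N * real q) else 0)"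
      unfolding sum_digit_paths length_ms
      by (intro sum.cong refl) (auto simp: weight_eq route_start route_end)
    also have "\<dots> = (\<Sum>i'<n. \<Sum>j'<n. if i' = i \<and> j' = j then of_rat (D i j) / real q else 0)"
      using N(2) by (intro sum.cong refl) simp
    also have "\<dots> = (\<Sum>i'<n. if i' = i then of_rat (D i j) / real q else 0)"
      using ij by (intro sum.cong refl) simp
    also have "\<dots> = of_rat (D i j) / real q"
      using ij by simp
    finally show ?thesis using q by simp
  qed
qed

lemma horizon_digit: "horizon R = q * (2 * L * r)"
  by (simp add: horizon_R length_ms)

end

section \<open>The lower bound\<close>

text \<open>Nodes that can be reached from \<open>i\<close> by time \<open>t\<close> with at most
  \<open>h\<close> physical arcs.\<close>

primrec reach :: "routing \<Rightarrow> nat \<Rightarrow> nat \<Rightarrow> nat \<Rightarrow> nat set" where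
  "reach R i 0 h = {i}"
| "reach R i (Suc t) h =
     reach R i t h \<union> (case h of 0 \<Rightarrow> {} | Suc h' \<Rightarrow> matching R t `` reach R i t h')"

lemma reach_mono_hops: "h \<le> h' \<Longrightarrow> reach R i t h \<subseteq> reach R i t h'"
proof (induction t arbitrary: h h')
  case (Suc t)
  show ?case
  proof (cases h)
    case 0
    then show ?thesis using Suc.IH[OF Suc.prems] by auto
  next
    case (Suc g)
    then obtain g' where g': "h' = Suc g'" "g \<le> g'" using Suc.prems by (cases h') auto
    show ?thesis
      using Suc.IH[OF Suc.prems] Suc.IH[OF g'(2)] by (auto simp: Suc g')
  qed
qed simp

lemma reach_mono_time: "t \<le> t' \<Longrightarrow> reach R i t h \<subseteq> reach R i t' h"
  by (induction t' rule: dec_induct) auto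

lemma card_Image_matching:
  assumes "is_matching n M" "finite A"
  shows "finite (M `` A)" "card (M `` A) \<le> card A"
proof -
  let ?M = "{p \<in> M. fst p \<in> A}"
  have inj: "inj_on fst ?M" using assms(1) by (auto simp: is_matching_def intro: inj_on_subset)
  have fin: "finite ?M"
    by (rule inj_on_finite[OF inj _ assms(2)]) auto
  have eq: "M `` A = snd ` ?M" by force
  show "finite (M `` A)" using fin by (simp add: eq)
  have "card (M `` A) \<le> card ?M" using fin by (simp add: eq card_image_le)
  also have "\<dots> \<le> card A" using inj assms(2) by (intro card_inj_on_le) auto
  finally show "card (M `` A) \<le> card A" .
qed

text \<open>
  The number of choices of at most \<open>h\<close> out of \<open>t\<close> steps, bounded by its generating function: the
  parameter is \<open>x = 1 / B\<close> for \<open>2 < B \<le> n\<close> and \<open>x = 1\<close> for \<open>B \<le> 2\<close>.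
\<close>

lemma card_reach:
  assumes "\<And>s. s < t \<Longrightarrow> is_matching n (matching R s)" "0 < x" "x \<le> 1"
  shows "finite (reach R i t h) \<and> real (card (reach R i t h)) \<le> (1 / x) ^ h * (1 + x) ^ t"
  using assms(1)
proof (induction t arbitrary: h)
  case 0
  then show ?case using assms(2,3) by (simp add: one_le_power)
next
  case (Suc t)
  show ?case
  proof (cases h)
    case 0
    have "(1 + x) ^ t \<le> (1 + x) ^ Suc t" using assms(2) by (intro power_increasing) auto
    then show ?thesis using Suc.IH[of 0] Suc.prems 0 by force
  next
    case (Suc g)
    note IH = Suc.IH[of h] Suc.IH[of g]
    have m: "is_matching n (matching R t)" using Suc.prems by simp
    have "card (reach R i (Suc t) h) \<le> card (reach R i t h) + card (matching R t `` reach R i t g)"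
      by (simp add: Suc card_Un_le)
    also have "\<dots> \<le> card (reach R i t h) + card (reach R i t g)"
      using card_Image_matching(2)[OF m] IH Suc.prems by auto
    finally have "real (card (reach R i (Suc t) h)) \<le> (1 / x) ^ h * (1 + x) ^ t + (1 / x) ^ g * (1 + x) ^ t"
      using IH Suc.prems by fastforce
    \<comment> \<open>One hop fewer is worth a factor \<open>x\<close>, so the two terms combine to
      a factor \<open>1 + x\<close>.\<close>
    also have "\<dots> = (1 / x) ^ h * (1 + x) ^ Suc t"
      using assms(2) by (simp add: Suc field_simps)
    finally show ?thesis
      using IH Suc.prems card_Image_matching(1)[OF m] by (auto simp: Suc)
  qed
qed

section \<open>Hops and end points of paths in an arbitrary routing\<close>

definition hops :: "nat list \<Rightarrow> nat \<Rightarrow> nat" where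
  "hops vs t = card {k. k < t \<and> vs ! k \<noteq> vs ! Suc k}"

lemma hops_Suc: "hops vs (Suc t) = hops vs t + (if vs ! t = vs ! Suc t then 0 else 1)"
proof -
  have "{k. k < Suc t \<and> vs ! k \<noteq> vs ! Suc k} =
    (if vs ! t = vs ! Suc t then {k. k < t \<and> vs ! k \<noteq> vs ! Suc k}
     else insert t {k. k < t \<and> vs ! k \<noteq> vs ! Suc k})"
    by (auto simp: less_Suc_eq)
  then show ?thesis by (simp add: hops_def)
qed

lemma walk_reach:
  assumes "walk n R t vs" "s \<le> t"
  shows "vs ! s \<in> reach R (vs ! 0) s (hops vs s)"
  using assms(2)
proof (induction s)
  case (Suc s)
  then have "vs ! s = vs ! Suc s \<or> (vs ! s, vs ! Suc s) \<in> matching R s"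
    using assms(1) by (auto simp: walk_def)
  then show ?case using Suc by (auto simp: hops_Suc)
qed simp

text \<open>Meaningful for nonempty arc lists only; every member of \<open>all_paths\<close> has at
  least one arc.\<close>

definition ends :: "arc list \<Rightarrow> nat \<times> nat" where
  "ends P = (fst (fst (hd P)), fst (snd (last P)))"

lemma ends_timed_path:
  assumes "length vs = Suc t" "0 < t"
  shows "ends (timed_path vs) = (vs ! 0, vs ! t)"
proof -
  have "timed_path vs \<noteq> []" using assms by (auto simp flip: length_0_conv)
  then show ?thesis
    using assms by (simp add: ends_def hd_conv_nth last_conv_nth)
qed

locale routing =
  fixes n :: nat and R :: routing
  assumes is_routing: "is_routing n R"
begin

lemma matching: "t < horizon R \<Longrightarrow> is_matching n (matching R t)"
  using is_routing by (simp add: is_routing_def)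

lemma in_paths:
  assumes "P \<in> paths n R i j t" "0 < t"
  shows "\<exists>vs. walk n R t vs \<and> P = timed_path vs \<and> ends P = (i, j) \<and> length P = t"
proof -
  have "\<And>t. t < horizon R \<Longrightarrow> matching R t \<subseteq> {..<n} \<times> {..<n}"
    using matching by (auto simp: is_matching_def)
  from path_nodes[OF this assms(1)] obtain vs where
    "walk n R t vs" "P = timed_path vs" "vs ! 0 = i" "vs ! t = j" by blast
  moreover from this have "length vs = Suc t" by (simp add: walk_def)
  ultimately show ?thesis
    using ends_timed_path[of vs t] assms(2) by (intro exI[of _ vs]) simp
qed

lemma in_all_paths:
  assumes "P \<in> all_paths n R"
  shows "P \<in> paths n R (fst (ends P)) (snd (ends P)) (length P)"
    "fst (ends P) < n" "snd (ends P) < n" "1 \<le> length P" "length P \<le> horizon R"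
    "\<exists>vs. walk n R (length P) vs \<and> P = timed_path vs \<and> ends P = (vs ! 0, vs ! length P)"
proof -
  from assms obtain i j t where *: "i < n" "j < n" "1 \<le> t" "t \<le> horizon R" "P \<in> paths n R i j t"
    by (auto simp: all_paths_def)
  with in_paths[of P i j t] obtain vs where vs: "walk n R t vs" "P = timed_path vs"
    "ends P = (i, j)" "length P = t"
    by (metis less_le_trans zero_less_one)
  have "ends P = (vs ! 0, vs ! t)"
    using vs(1,2) *(3) ends_timed_path[of vs t] by (simp add: walk_def)
  then show "\<exists>vs. walk n R (length P) vs \<and> P = timed_path vs \<and> ends P = (vs ! 0, vs ! length P)"
    unfolding vs(4) using vs(1,2) by blast
  show "P \<in> paths n R (fst (ends P)) (snd (ends P)) (length P)"
    "fst (ends P) < n" "snd (ends P) < n" "1 \<le> length P" "length P \<le> horizon R"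
    using * vs(3,4) by simp_all
qed

text \<open>The arrival time of a path is its length, so the sets for different \<open>t\<close> are
  disjoint and the double sum becomes one sum over paths grouped by end points.\<close>

lemma sum_paths:
  fixes g :: "arc list \<Rightarrow> real"
  assumes "i < n" "j < n"
  shows "(\<Sum>t = 1..horizon R. \<Sum>P \<in> paths n R i j t. g P) =
    (\<Sum>P \<in> {P \<in> all_paths n R. ends P = (i, j)}. g P)"
proof -
  have "{P \<in> all_paths n R. ends P = (i, j)} = (\<Union>t\<in>{1..horizon R}. paths n R i j t)"
  proof (intro equalityI subsetI)
    fix P assume "P \<in> {P \<in> all_paths n R. ends P = (i, j)}"
    then show "P \<in> (\<Union>t\<in>{1..horizon R}. paths n R i j t)"
      using in_all_paths(1,4,5)[of P] by force
  next
    fix P assume "P \<in> (\<Union>t\<in>{1..horizon R}. paths n R i j t)"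
    then obtain t where t: "t \<in> {1..horizon R}" "P \<in> paths n R i j t" by blast
    then have "P \<in> all_paths n R" using assms unfolding all_paths_def by blast
    moreover have "ends P = (i, j)" using in_paths[OF t(2)] t(1) by auto
    ultimately show "P \<in> {P \<in> all_paths n R. ends P = (i, j)}" by simp
  qed
  moreover have "paths n R i j s \<inter> paths n R i j t = {}" if "1 \<le> s" "1 \<le> t" "s \<noteq> t" for s t
    using in_paths[of _ i j s] in_paths[of _ i j t] that by fastforce
  ultimately show ?thesis
    using finite_paths[OF matching] by (simp add: sum.UNION_disjoint)
qed

lemma total_completion_time:
  "total_completion_time n R = (\<Sum>P \<in> all_paths n R. real (length P) * flow R P)"
proof -
  have "total_completion_time n R =
      (\<Sum>i<n. \<Sum>j<n. \<Sum>t = 1..horizon R. \<Sum>P \<in> paths n R i j t. real t * flow R P)"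
    unfolding total_completion_time_def
    by (subst sum.swap, rule sum.cong[OF refl], subst sum.swap, rule refl)
  also have "\<dots> = (\<Sum>i<n. \<Sum>j<n. \<Sum>t = 1..horizon R. \<Sum>P \<in> paths n R i j t. real (length P) * flow R P)"
  proof (intro sum.cong refl)
    fix i j t P assume "t \<in> {1..horizon R}" "P \<in> paths n R i j t"
    then show "real t * flow R P = real (length P) * flow R P" using in_paths[of P i j t] by auto
  qed
  also have "\<dots> = (\<Sum>i<n. \<Sum>j<n. \<Sum>P \<in> {P \<in> all_paths n R. ends P = (i, j)}.
      real (length P) * flow R P)"
    by (intro sum.cong refl sum_paths) auto
  also have "\<dots> = (\<Sum>x \<in> {..<n} \<times> {..<n}. \<Sum>P \<in> {P \<in> all_paths n R. ends P = x}.
      real (length P) * flow R P)"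
    by (simp add: sum.cartesian_product case_prod_beta)
  also have "\<dots> = (\<Sum>P \<in> all_paths n R. real (length P) * flow R P)"
  proof (rule sum.group)
    show "finite (all_paths n R)" using is_routing by (rule finite_all_paths)
    show "ends ` all_paths n R \<subseteq> {..<n} \<times> {..<n}"
      using in_all_paths(2,3) by (intro image_subsetI) (simp add: mem_Times_iff)
  qed simp
  finally show ?thesis .
qed

lemma flow_nonneg: "0 \<le> flow R P"
  using is_routing unfolding is_routing_def by (metis order_refl)

end

text \<open>By \<open>near\<close>, at least a quarter of the pairs are far apart; their demand is
  at least \<open>n * B / 4\<close>. A path between such a pair that arrives by \<open>T\<close>
  uses at least \<open>h + 1\<close> of the at most \<open>n * T\<close> units of capacity, so by
  \<open>long\<close> such paths carry at most \<open>n * B / 8\<close>. Flow of at least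
  \<open>n * B / 8\<close> is therefore late, which is the source of the factor
  \<open>1 / 8\<close>.\<close>

lemma lower_bound:
  fixes T B :: real
  assumes n: "0 < n" and B: "0 < B" and D: "\<And>i j. i < n \<Longrightarrow> j < n \<Longrightarrow> of_rat (D i j) = B / real n"
    and R: "integral_routing_for n D R" and T: "0 \<le> T"
    and near: "\<And>i t. i < n \<Longrightarrow> real t \<le> T \<Longrightarrow> t \<le> horizon R \<Longrightarrow>
      real (card (reach R i t h)) \<le> 3 / 4 * real n"
    and long: "8 * T \<le> (real h + 1) * B"
  shows "T \<le> makespan R" "T / 8 \<le> avg_completion_time n D R"
proof -
  interpret routing n R
    using R by (simp add: routing_def integral_routing_for_def)
  \<comment> \<open>The last integral layer up to \<open>T\<close>, capped by the horizon because
    matchings are only controlled before it.\<close>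
  define \<tau> where "\<tau> = min (nat \<lfloor>T\<rfloor>) (horizon R)"
  have \<tau>: "real \<tau> \<le> T" "\<tau> \<le> horizon R" using T by (auto simp: \<tau>_def min_def) linarith+
  have le_\<tau>: "t \<le> \<tau>" if "real t \<le> T" "t \<le> horizon R" for t
    using that by (auto simp: \<tau>_def le_nat_floor)
  let ?N = "\<lambda>i. reach R i \<tau> h"
  define far where "far = (SIGMA i:{..<n}. {..<n} - ?N i)"
  define A where "A = {P \<in> all_paths n R. ends P \<in> far}"
  define A1 where "A1 = {P \<in> A. real (length P) \<le> T}"
  define E where "E = {((i, t), (j, Suc t)) | i j t. t < \<tau> \<and> (i, j) \<in> matching R t}"
  have finA: "finite A" using finite_all_paths[OF is_routing] by (simp add: A_def)
  have A1: "A1 \<subseteq> A" by (auto simp: A1_def)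
  have fin_far: "finite far" by (simp add: far_def)

  have "real n / 4 \<le> real (card ({..<n} - ?N i))" if "i < n" for i
  proof -
    \<comment> \<open>Only finiteness is taken from \<open>card_reach\<close>, hence the simplest
      parameter 1.\<close>
    have fin: "finite (?N i)"
      using card_reach[of \<tau> n R 1 i h] matching \<tau>(2) by auto
    have "n - card (?N i) \<le> card ({..<n} - ?N i)"
      using diff_card_le_card_Diff[OF fin, of "{..<n}"] by simp
    moreover have "real (card (?N i)) \<le> 3 / 4 * real n" using near[OF that \<tau>] .
    ultimately show ?thesis by linarith
  qed
  then have "(\<Sum>i<n. real n / 4) \<le> (\<Sum>i<n. real (card ({..<n} - ?N i)))"
    by (intro sum_mono) auto
  then have card_far: "real n * real n / 4 \<le> real (card far)"
    by (simp add: far_def)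

  have "real n * B / 4 \<le> real (card far) * (B / real n)"
    using mult_right_mono[OF card_far, of "B / real n"] B n by simp
  also have "\<dots> = (\<Sum>x\<in>far. B / real n)" by simp
  also have "\<dots> \<le> (\<Sum>x\<in>far. \<Sum>P \<in> {P \<in> A. ends P = x}. flow R P)"
  proof (rule sum_mono)
    fix x assume x: "x \<in> far"
    then obtain i j where ij: "x = (i, j)" "i < n" "j < n" by (auto simp: far_def)
    have "{P \<in> A. ends P = x} = {P \<in> all_paths n R. ends P = (i, j)}"
      using x ij by (auto simp: A_def)
    then have "(\<Sum>P \<in> {P \<in> A. ends P = x}. flow R P) =
        (\<Sum>t = 1..horizon R. \<Sum>P \<in> paths n R i j t. flow R P)"
      using sum_paths[OF ij(2,3), of "flow R"] by simp
    moreover have "of_rat (D i j) \<le> (\<Sum>t = 1..horizon R. \<Sum>P \<in> paths n R i j t. flow R P)"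
      using R ij(2,3) unfolding integral_routing_for_def feasible_def by blast
    ultimately show "B / real n \<le> (\<Sum>P \<in> {P \<in> A. ends P = x}. flow R P)"
      using D[OF ij(2,3)] by simp
  qed
  also have "\<dots> = (\<Sum>P\<in>A. flow R P)"
    using finA fin_far by (intro sum.group) (auto simp: A_def)
  finally have flow_A: "real n * B / 4 \<le> (\<Sum>P\<in>A. flow R P)" .

  have card_matching: "finite (matching R t) \<and> card (matching R t) \<le> n" if "t < \<tau>" for t
  proof -
    have m: "inj_on fst (matching R t)" "fst ` matching R t \<subseteq> {..<n}"
      using matching[of t] that \<tau>(2) by (auto simp: is_matching_def)
    then show ?thesis
      using inj_on_finite[OF m] card_inj_on_le[OF m] by simp
  qed
  have E_eq: "E = (\<lambda>(t, i, j). ((i, t), (j, Suc t))) ` (SIGMA t:{..<\<tau>}. matching R t)"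
    by (force simp: E_def)
  have finE: "finite E" using card_matching by (auto simp: E_eq)
  have "card E \<le> card (SIGMA t:{..<\<tau>}. matching R t)"
    unfolding E_eq using card_matching by (intro card_image_le) auto
  also have "\<dots> = (\<Sum>t<\<tau>. card (matching R t))" using card_matching by simp
  also have "\<dots> \<le> (\<Sum>t<\<tau>. n)" using card_matching by (intro sum_mono) auto
  finally have "real (card E) \<le> real (\<tau> * n)" by (simp only: of_nat_le_iff) simp
  also have "\<dots> \<le> T * real n" using \<tau>(1) by (simp add: mult_right_mono)
  finally have cardE: "real (card E) \<le> T * real n" .

  have many: "h + 1 \<le> card {e \<in> E. e \<in> set P}" if "P \<in> A1" for P
  proof -
    have P: "P \<in> all_paths n R" "ends P \<in> far" "real (length P) \<le> T"
      using that by (auto simp: A1_def A_def)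
    from in_all_paths[OF P(1)] obtain vs where vs: "walk n R (length P) vs" "P = timed_path vs"
      "ends P = (vs ! 0, vs ! length P)" and len: "length P \<le> horizon R"
      by blast
    let ?K = "{k. k < length P \<and> vs ! k \<noteq> vs ! Suc k}"
    have "\<not> hops vs (length P) \<le> h"
    proof
      assume *: "hops vs (length P) \<le> h"
      have "vs ! length P \<in> ?N (vs ! 0)"
        using walk_reach[OF vs(1) order_refl] reach_mono_hops[OF *]
          reach_mono_time[OF le_\<tau>[OF P(3) len]] by blast
      then show False using P(2) vs(3) by (simp add: far_def)
    qed
    then have "h + 1 \<le> card ?K" by (simp add: hops_def)
    also have "\<dots> \<le> card {e \<in> E. e \<in> set P}"
    proof (rule card_inj_on_le)
      show "inj_on (\<lambda>k. ((vs ! k, k), (vs ! Suc k, Suc k))) ?K" by (auto simp: inj_on_def)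
      have "((vs ! k, k), (vs ! Suc k, Suc k)) \<in> {e \<in> E. e \<in> set P}"
        if "k < length P" "vs ! k \<noteq> vs ! Suc k" for k
      proof -
        have "(vs ! k, vs ! Suc k) \<in> matching R k" "Suc k < length vs"
          using vs(1) that by (auto simp: walk_def)
        moreover have "k < \<tau>" using le_\<tau>[OF P(3) len] that(1) by simp
        ultimately show ?thesis by (auto simp: E_def vs(2) in_timed_path_iff)
      qed
      then show "(\<lambda>k. ((vs ! k, k), (vs ! Suc k, Suc k))) ` ?K \<subseteq> {e \<in> E. e \<in> set P}" by blast
      show "finite {e \<in> E. e \<in> set P}" using finE by simp
    qed
    finally show ?thesis .
  qed
  \<comment> \<open>Double counting of incidences between early paths and edges: each path has at
    least \<open>h + 1\<close> of them, and each edge carries at most 1.\<close>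
  have "(real h + 1) * (\<Sum>P\<in>A1. flow R P) = (\<Sum>P\<in>A1. real (h + 1) * flow R P)"
    by (simp add: sum_distrib_left add.commute)
  also have "\<dots> \<le> (\<Sum>P\<in>A1. real (card {e \<in> E. e \<in> set P}) * flow R P)"
    using many flow_nonneg by (intro sum_mono mult_right_mono) (simp_all only: of_nat_le_iff)
  also have "\<dots> = (\<Sum>P\<in>A1. \<Sum>e\<in>E. if e \<in> set P then flow R P else 0)"
    using finE by (intro sum.cong) (auto simp: sum.inter_filter[symmetric])
  also have "\<dots> = (\<Sum>e\<in>E. \<Sum>P\<in>A1. if e \<in> set P then flow R P else 0)"
    by (rule sum.swap)
  also have "\<dots> \<le> (\<Sum>e\<in>E. 1)"
  proof (rule sum_mono)
    fix e assume "e \<in> E"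
    then have "e \<in> physical_arcs R" using \<tau>(2) by (auto simp: E_def physical_arcs_def)
    then have "load n R e \<le> 1" using R by (simp add: integral_routing_for_def feasible_def)
    moreover have "(\<Sum>P\<in>A1. if e \<in> set P then flow R P else 0) \<le> load n R e"
      using finA A1 finite_subset[OF A1 finA] finite_all_paths[OF is_routing] flow_nonneg
      unfolding load_def sum.inter_filter[symmetric, OF finite_subset[OF A1 finA]]
      by (intro sum_mono2) (auto simp: A_def)
    ultimately show "(\<Sum>P\<in>A1. if e \<in> set P then flow R P else 0) \<le> 1" by simp
  qed
  also have "\<dots> \<le> T * real n" using cardE by simp
  also have "\<dots> \<le> (real h + 1) * (real n * B / 8)"
    using mult_right_mono[OF long, of "real n"] by (simp add: algebra_simps)
  finally have "(\<Sum>P\<in>A1. flow R P) \<le> real n * B / 8"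
    by (rule mult_left_le_imp_le) simp
  moreover have "(\<Sum>P\<in>A. flow R P) = (\<Sum>P\<in>A - A1. flow R P) + (\<Sum>P\<in>A1. flow R P)"
    using finA A1 by (rule sum.subset_diff[rotated])
  ultimately have late: "real n * B / 8 \<le> (\<Sum>P\<in>A - A1. flow R P)" using flow_A by linarith
  have late_len: "T < real (length P)" if "P \<in> A - A1" for P
    using that by (auto simp: A1_def)

  \<comment> \<open>Late flow is positive, so a path longer than \<open>T\<close> exists, and the
    horizon is at least its length.\<close>
  have "A - A1 \<noteq> {}"
  proof
    assume "A - A1 = {}"
    then have "(\<Sum>P\<in>A - A1. flow R P) = 0" by (simp only: sum.empty)
    moreover have "0 < real n * B / 8" using n B by simp
    ultimately show False using late by linarith
  qed
  then obtain P where P: "P \<in> A - A1" by blast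
  then have "length P \<le> horizon R" using in_all_paths(5) by (auto simp: A_def)
  then show "T \<le> makespan R" using late_len[OF P] by (simp add: makespan_def)

  have "T * (real n * B / 8) \<le> T * (\<Sum>P\<in>A - A1. flow R P)"
    using late T by (rule mult_left_mono)
  also have "\<dots> \<le> (\<Sum>P\<in>A - A1. real (length P) * flow R P)"
    unfolding sum_distrib_left using late_len flow_nonneg
    by (intro sum_mono mult_right_mono) (auto intro: less_imp_le)
  also have "\<dots> \<le> total_completion_time n R"
    unfolding total_completion_time using finite_all_paths[OF is_routing] flow_nonneg
    by (intro sum_mono2) (auto simp: A_def)
  finally have "T / 8 * (real n * B) \<le> total_completion_time n R" by simp
  moreover have "(\<Sum>i<n. \<Sum>j<n. of_rat (D i j) :: real) = real n * B"
    using n by (simp add: D)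
  ultimately show "T / 8 \<le> avg_completion_time n D R"
    using n B by (simp add: avg_completion_time_def le_divide_eq)
qed

section \<open>Time and hop bounds for the three regimes\<close>

lemma ln2_ge: "1 / 2 \<le> ln (2 :: real)"
  using ln_le_minus_one[of "1 / 2"] by (simp add: ln_div)

lemma ln_ge_half: "2 \<le> x \<Longrightarrow> 1 / 2 \<le> ln (x :: real)"
  using ln2_ge by (rule order_trans) simp

text \<open>The square root of \<open>n\<close> is at most \<open>3 / 4 * n\<close> as soon as
  \<open>n \<ge> 16 / 9\<close>; the fraction 3/4 is generous enough to include
  \<open>n = 2\<close>.\<close>

lemma exp_half_ln_le:
  assumes "2 \<le> n" "y \<le> ln (real n) / 2"
  shows "exp y \<le> 3 / 4 * real n"
proof -
  have "exp y \<le> exp (ln (real n) / 2)" using assms(2) by simp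
  also have "\<dots> = sqrt (real n)"
    using assms(1) by (simp add: ln_sqrt[symmetric])
  also have "\<dots> \<le> 3 / 4 * real n"
  proof (rule real_le_lsqrt)
    have "real n * 16 \<le> real n * (9 * real n)" using assms(1) by (intro mult_left_mono) auto
    then show "real n \<le> (3 / 4 * real n)\<^sup>2" by (simp add: power2_eq_square)
  qed (use assms in auto)
  finally show ?thesis .
qed

text \<open>Each regime supplies \<open>T\<close> and \<open>h\<close> for
  \<open>lower_bound\<close>. The constant is \<open>256 = 32 * 8\<close>: the loss in
  \<open>T\<close> against the rate, times the loss from makespan to average.\<close>

theorem rate_lower_bound:
  assumes n: "2 \<le> n" and B: "0 < B" and D: "\<And>i j. i < n \<Longrightarrow> j < n \<Longrightarrow> of_rat (D i j) = B / real n"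
    and R: "integral_routing_for n D R"
  shows "rate n B / 256 \<le> makespan R" "rate n B / 256 \<le> avg_completion_time n D R"
proof -
  have M: "is_matching n (matching R s)" if "s < horizon R" for s
    using R that by (simp add: integral_routing_for_def is_routing_def)
  have lnn: "0 < ln (real n)" using n by simp
  have "\<exists>T h. 0 \<le> T \<and> rate n B / 32 \<le> T \<and> 8 * T \<le> (real h + 1) * B \<and>
    (\<forall>i t. i < n \<longrightarrow> real t \<le> T \<longrightarrow> t \<le> horizon R \<longrightarrow> real (card (reach R i t h)) \<le> 3 / 4 * real n)"
  proof -
    consider "B \<le> 2" | "2 < B" "B \<le> real n" | "2 < B" "real n < B" by linarith
    then show ?thesis
    proof cases
      case 1
      define T where "T = ln (real n) / 4"
      \<comment> \<open>With \<open>x = 1\<close> at most \<open>2 ^ t\<close> nodes are reachable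
        for every \<open>h\<close>, so \<open>h\<close> can be as large as the capacity condition
        requires.\<close>
      define h where "h = nat \<lceil>8 * T / B\<rceil>"
      have "8 * T / B \<le> real h" unfolding h_def by linarith
      then have "8 * T / B * B \<le> (real h + 1) * B" using B by (intro mult_right_mono) auto
      then have "8 * T \<le> (real h + 1) * B" using B by simp
      moreover have "real (card (reach R i t h)) \<le> 3 / 4 * real n"
        if "real t \<le> T" "t \<le> horizon R" for i t
      proof -
        have "real (card (reach R i t h)) \<le> 2 ^ t"
          using card_reach[of t n R 1 i h] M that by auto
        also have "\<dots> = exp (real t * ln 2)"
          by (simp add: exp_of_nat_mult)
        also have "real t * ln 2 \<le> T * 1"
          using that ln_le_minus_one[of 2] by (intro mult_mono) (auto simp: T_def lnn less_imp_le)
        then have "exp (real t * ln 2) \<le> 3 / 4 * real n"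
          using lnn by (intro exp_half_ln_le[OF n]) (simp add: T_def)
        finally show ?thesis .
      qed
      ultimately show ?thesis
        using 1 lnn by (intro exI[of _ T] exI[of _ h]) (auto simp: rate_def T_def)
    next
      case 2
      \<comment> \<open>The logarithm of \<open>n\<close> to base \<open>B\<close>. With
        \<open>x = 1 / B\<close> the exponent is at most \<open>h * ln B + t / B\<close>; the
        choices of \<open>h\<close> and \<open>T\<close> make this at most
        \<open>ln n / 4 + l / 32\<close>, and \<open>l \<le> 2 * ln n\<close> leaves room below
        \<open>ln n / 2\<close>.\<close>
      define l where "l = ln (real n) / ln B"
      define T where "T = B * l / 32"
      define h where "h = nat \<lfloor>l / 4\<rfloor>"
      have lnB: "1 / 2 \<le> ln B" using 2 by (intro ln_ge_half) simp
      then have l: "0 \<le> l" "l \<le> 2 * ln (real n)"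
        using lnn by (auto simp: l_def field_simps)
      have "l / 4 \<le> real h + 1" unfolding h_def by linarith
      then have "8 * T \<le> (real h + 1) * B"
        using mult_right_mono[of "l / 4" "real h + 1" B] B by (simp add: T_def algebra_simps)
      moreover have "real (card (reach R i t h)) \<le> 3 / 4 * real n"
        if t: "real t \<le> T" "t \<le> horizon R" for i t
      proof -
        have "real (card (reach R i t h)) \<le> B ^ h * (1 + 1 / B) ^ t"
          using card_reach[of t n R "1 / B" i h] M t 2 by auto
        also have "\<dots> \<le> exp (ln B) ^ h * exp (1 / B) ^ t"
          using 2 exp_ge_add_one_self[of "1 / B"] by (intro mult_mono power_mono) auto
        also have "\<dots> = exp (real h * ln B + real t * (1 / B))"
          by (simp only: exp_of_nat_mult exp_add)
        also have "\<dots> \<le> 3 / 4 * real n"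
        proof (rule exp_half_ln_le[OF n])
          have "real h \<le> l / 4" using l(1) unfolding h_def by (intro of_nat_floor) simp
          then have "real h * ln B \<le> l / 4 * ln B" using lnB by (intro mult_right_mono) auto
          also have "\<dots> = ln (real n) / 4" using lnB by (simp add: l_def)
          finally have "real h * ln B \<le> ln (real n) / 4" .
          moreover have "real t * (1 / B) \<le> T * (1 / B)" using t B by (intro mult_right_mono) auto
          moreover have "T * (1 / B) = l / 32" using B by (simp add: T_def)
          ultimately show "real h * ln B + real t * (1 / B) \<le> ln (real n) / 2"
            using lnn l(2) by linarith
        qed
        finally show ?thesis .
      qed
      ultimately show ?thesis
        using 2 l by (intro exI[of _ T] exI[of _ h]) (auto simp: rate_def T_def l_def)
    next
      case 3
      \<comment> \<open>For \<open>B > n\<close> one hop per unit of flow is enough: without hops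
        only the source itself is reachable.\<close>
      have "real (card (reach R i t 0)) \<le> 3 / 4 * real n" for i t
      proof -
        have "reach R i t 0 = {i}" by (induction t) auto
        then show ?thesis using n by simp
      qed
      then show ?thesis
        using 3 by (intro exI[of _ "B / 8"] exI[of _ 0]) (auto simp: rate_def)
    qed
  qed
  then obtain T h where T: "0 \<le> T" "rate n B / 32 \<le> T" "8 * T \<le> (real h + 1) * B"
    "\<And>i t. i < n \<Longrightarrow> real t \<le> T \<Longrightarrow> t \<le> horizon R \<Longrightarrow>
      real (card (reach R i t h)) \<le> 3 / 4 * real n"
    by blast
  have "0 < n" using n by simp
  note lb = lower_bound[OF this B D R T(1,4,3)]
  show "rate n B / 256 \<le> makespan R" "rate n B / 256 \<le> avg_completion_time n D R"
    using lb T(1,2) by auto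
qed

section \<open>A scoped language compiled to random access programs\<close>

definition upd :: "store \<Rightarrow> nat \<Rightarrow> nat \<Rightarrow> store" where
  "upd s x v = s(x := (s x)(0 := v))"

lemma upd_same [simp]: "upd s x v x 0 = v"
  by (simp add: upd_def)

lemma upd_other [simp]: "y \<noteq> x \<Longrightarrow> upd s x v y = s y"
  by (simp add: upd_def)

section \<open>Scoped expressions, their size and their cost\<close>

abbreviation Var :: "nat \<Rightarrow> expr" where
  "Var x \<equiv> Read x (Const 0)"

text \<open>Array 0 is the input and may be indexed freely; any other array serves as one scalar
  variable, kept in its cell 0.\<close>

primrec scoped :: "nat set \<Rightarrow> expr \<Rightarrow> bool" where
  "scoped X (Const c) = True"
| "scoped X (Read a e) = (if a = 0 then scoped X e else a \<in> X \<and> e = Const 0)"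
| "scoped X (Add e f) = (scoped X e \<and> scoped X f)"
| "scoped X (Sub e f) = (scoped X e \<and> scoped X f)"
| "scoped X (Mul e f) = (scoped X e \<and> scoped X f)"
| "scoped X (Div e f) = (scoped X e \<and> scoped X f)"

text \<open>Compiled code leaves garbage in variables that are out of scope, so the machine store
  and the semantic store are compared on the input and the scope only.\<close>

definition agree :: "nat set \<Rightarrow> store \<Rightarrow> store \<Rightarrow> bool" where
  "agree X s s' \<longleftrightarrow> s 0 = s' 0 \<and> (\<forall>x\<in>X. s x 0 = s' x 0)"

lemma eval_agree: "scoped X e \<Longrightarrow> agree X s s' \<Longrightarrow> eval_expr s e = eval_expr s' e"
  by (induction e) (auto simp: agree_def split: if_splits)

lemma scoped_mono: "scoped X e \<Longrightarrow> X \<subseteq> Y \<Longrightarrow> scoped Y e"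
  by (induction e) (auto split: if_splits)

definition small :: "nat \<Rightarrow> nat set \<Rightarrow> store \<Rightarrow> bool" where
  "small g X s \<longleftrightarrow> (\<forall>k. s 0 k \<le> 2 ^ g) \<and> (\<forall>x\<in>X. s x 0 \<le> 2 ^ g)"

lemma small_agree: "agree X s s' \<Longrightarrow> small g X s' \<Longrightarrow> small g X s"
  by (auto simp: agree_def small_def)

text \<open>Values stay below \<open>2 ^ (deg e * g)\<close> if all readable cells are at most
  \<open>2 ^ g\<close>. A constant uses \<open>c \<le> 2 ^ c\<close>; an addition at most doubles,
  which one more factor \<open>2 ^ g\<close> absorbs.\<close>

primrec deg :: "expr \<Rightarrow> nat" where
  "deg (Const c) = c"
| "deg (Read a e) = 1"
| "deg (Add e f) = Suc (max (deg e) (deg f))"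
| "deg (Sub e f) = deg e"
| "deg (Mul e f) = deg e + deg f"
| "deg (Div e f) = deg e"

lemma eval_le:
  assumes "small g X s" "0 < g"
  shows "scoped X e \<Longrightarrow> eval_expr s e \<le> 2 ^ (deg e * g)"
proof (induction e)
  case (Const c)
  have "c \<le> 2 ^ c" by (simp add: less_imp_le)
  also have "\<dots> \<le> 2 ^ (c * g)" using assms(2) by (intro power_increasing) auto
  finally show ?case by simp
next
  case (Read a e)
  then show ?case using assms(1) by (auto simp: small_def split: if_splits)
next
  case (Add e f)
  let ?m = "max (deg e) (deg f)"
  have "eval_expr s e \<le> 2 ^ (?m * g)" "eval_expr s f \<le> 2 ^ (?m * g)"
    using Add by (auto intro: order_trans power_increasing)
  then have "eval_expr s (Add e f) \<le> 2 ^ Suc (?m * g)" by simp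
  also have "\<dots> \<le> 2 ^ (deg (Add e f) * g)"
    using assms(2) by (intro power_increasing) auto
  finally show ?case .
next
  case (Mul e f)
  then show ?case by (auto simp: power_add add_mult_distrib intro: mult_mono)
next
  case (Sub e f)
  then show ?case by (auto intro: order_trans[OF diff_le_self])
next
  case (Div e f)
  then show ?case by (auto intro: order_trans[OF div_le_dividend])
qed

lemma bits_le: "v \<le> 2 ^ m \<Longrightarrow> bits v \<le> m + 2"
proof -
  assume "v \<le> 2 ^ m"
  then have "v < 2 ^ (m + 1)"
    by (rule le_less_trans) simp
  then have "floorlog 2 v \<le> m + 1"
    by (intro floorlog_leI) auto
  then show ?thesis by (simp add: bits_def)
qed

text \<open>Cost in units of \<open>g + 1\<close>: every node adds \<open>deg + 2\<close>, the bound
  on the bits of its result given by \<open>bits_le_coeff\<close>.\<close>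

primrec cost_coeff :: "expr \<Rightarrow> nat" where
  "cost_coeff (Const c) = c + 2"
| "cost_coeff (Read a e) = cost_coeff e + 3"
| "cost_coeff (Add e f) = cost_coeff e + cost_coeff f + deg (Add e f) + 2"
| "cost_coeff (Sub e f) = cost_coeff e + cost_coeff f + deg (Sub e f) + 2"
| "cost_coeff (Mul e f) = cost_coeff e + cost_coeff f + deg (Mul e f) + 2"
| "cost_coeff (Div e f) = cost_coeff e + cost_coeff f + deg (Div e f) + 2"

lemma bits_le_coeff:
  assumes "v \<le> 2 ^ (d * g)" shows "bits v \<le> (d + 2) * (g + 1)"
  using bits_le[OF assms] by (simp add: algebra_simps)

lemma cost_le:
  assumes "small g X s" "0 < g"
  shows "scoped X e \<Longrightarrow> cost s e \<le> cost_coeff e * (g + 1)"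
proof (induction e)
  case (Const c)
  have "bits c \<le> c + 2" by (rule bits_le) (simp add: less_imp_le)
  also have "\<dots> \<le> (c + 2) * (g + 1)" by simp
  finally show ?case by simp
next
  case (Read a e)
  have "cost s e \<le> cost_coeff e * (g + 1)"
  proof (cases "a = 0")
    case True
    then show ?thesis using Read by simp
  next
    case False
    then have "e = Const 0" using Read.prems by simp
    then show ?thesis using bits_le[of 0 0] by simp
  qed
  then show ?case
    using bits_le_coeff[OF eval_le[OF assms Read.prems]] by (simp add: algebra_simps)
next
  case (Add e f)
  then show ?case using bits_le_coeff[OF eval_le[OF assms Add.prems]]
    by (simp add: add_mult_distrib add_mult_distrib2 del: max_Suc_Suc)
next
  case (Sub e f)
  then show ?case using bits_le_coeff[OF eval_le[OF assms Sub.prems]]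
    by (simp add: add_mult_distrib add_mult_distrib2)
next
  case (Mul e f)
  then show ?case using bits_le_coeff[OF eval_le[OF assms Mul.prems]]
    by (simp add: add_mult_distrib add_mult_distrib2)
next
  case (Div e f)
  then show ?case using bits_le_coeff[OF eval_le[OF assms Div.prems]]
    by (simp add: add_mult_distrib add_mult_distrib2)
qed

text \<open>
  Binders never reuse a variable that is in scope, so a compiled term leaves the variables in
  scope unchanged although it runs on a global store.
\<close>

datatype comp =
    Expr expr
  | LetC nat comp comp
  | Fold nat expr nat expr comp

text \<open>Terms yield one number, emitters append to the output. A \<open>For\<close> loop carries
  no state between rounds besides the output; accumulators occur in \<open>Fold\<close>
  only.\<close>

datatype emitter =
    Emit expr
  | Sq emitter emitter
  | For nat expr emitter
  | LetE nat comp emitter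

primrec iter :: "(nat \<Rightarrow> nat \<Rightarrow> nat) \<Rightarrow> nat \<Rightarrow> nat \<Rightarrow> nat" where
  "iter f a 0 = a"
| "iter f a (Suc k) = f k (iter f a k)"

primrec cval :: "comp \<Rightarrow> store \<Rightarrow> nat" where
  "cval (Expr e) s = eval_expr s e"
| "cval (LetC x c d) s = cval d (upd s x (cval c s))"
| "cval (Fold x a i e c) s =
     iter (\<lambda>k v. cval c (upd (upd s x v) i k)) (eval_expr s a) (eval_expr s e)"

primrec out :: "emitter \<Rightarrow> store \<Rightarrow> nat list" where
  "out (Emit e) s = [eval_expr s e]"
| "out (Sq p q) s = out p s @ out q s"
| "out (For i e p) s = concat (map (\<lambda>k. out p (upd s i k)) [0..<eval_expr s e])"
| "out (LetE x c p) s = out p (upd s x (cval c s))"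

text \<open>Binders are at least 2, which protects the input array 0 and the output array 1.\<close>

primrec cwf :: "nat set \<Rightarrow> comp \<Rightarrow> bool" where
  "cwf X (Expr e) = scoped X e"
| "cwf X (LetC x c d) = (2 \<le> x \<and> x \<notin> X \<and> cwf X c \<and> cwf (insert x X) d)"
| "cwf X (Fold x a i e c) =
     (2 \<le> x \<and> 2 \<le> i \<and> x \<noteq> i \<and> x \<notin> X \<and> i \<notin> X \<and> scoped X a \<and> scoped X e \<and>
      cwf (insert i (insert x X)) c)"

primrec ewf :: "nat set \<Rightarrow> emitter \<Rightarrow> bool" where
  "ewf X (Emit e) = scoped X e"
| "ewf X (Sq p q) = (ewf X p \<and> ewf X q)"
| "ewf X (For i e p) = (2 \<le> i \<and> i \<notin> X \<and> scoped X e \<and> ewf (insert i X) p)"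
| "ewf X (LetE x c p) = (2 \<le> x \<and> x \<notin> X \<and> cwf X c \<and> ewf (insert x X) p)"

text \<open>Semantic side conditions for the time bound: stored values have at most about
  \<open>g\<close> bits and loops at most \<open>Z\<close> rounds.\<close>

primrec cok :: "nat \<Rightarrow> nat \<Rightarrow> comp \<Rightarrow> store \<Rightarrow> bool" where
  "cok g Z (Expr e) s = (eval_expr s e \<le> 2 ^ g)"
| "cok g Z (LetC x c d) s = (cok g Z c s \<and> cok g Z d (upd s x (cval c s)))"
| "cok g Z (Fold x a i e c) s = (eval_expr s a \<le> 2 ^ g \<and> eval_expr s e \<le> Z \<and>
     (\<forall>k < eval_expr s e. cok g Z c
        (upd (upd s x (iter (\<lambda>k v. cval c (upd (upd s x v) i k)) (eval_expr s a) k)) i k)))"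

primrec eok :: "nat \<Rightarrow> nat \<Rightarrow> emitter \<Rightarrow> store \<Rightarrow> bool" where
  "eok g Z (Emit e) s = True"
| "eok g Z (Sq p q) s = (eok g Z p s \<and> eok g Z q s)"
| "eok g Z (For i e p) s =
     (eval_expr s e \<le> Z \<and> (\<forall>k < eval_expr s e. eok g Z p (upd s i k)))"
| "eok g Z (LetE x c p) s = (cok g Z c s \<and> eok g Z p (upd s x (cval c s)))"

definition incr :: "nat \<Rightarrow> prog" where
  "incr i = Write i (Const 0) (Add (Var i) (Const 1))"

text \<open>Truncated subtraction makes the guard nonzero exactly while the counter is below
  \<open>e\<close>. As \<open>e\<close> is evaluated anew in every round, the body has to preserve
  its value.\<close>

definition loop :: "nat \<Rightarrow> expr \<Rightarrow> prog \<Rightarrow> prog" where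
  "loop i e p = Seq (Write i (Const 0) (Const 0)) (While (Sub e (Var i)) (Seq p (incr i)))"

text \<open>The target \<open>y\<close> may be in scope (a fold body is compiled into its own
  accumulator), so a \<open>y\<close> in scope is written by the last instruction only.\<close>

primrec compile_comp :: "nat \<Rightarrow> comp \<Rightarrow> prog" where
  "compile_comp y (Expr e) = Write y (Const 0) e"
| "compile_comp y (LetC x c d) = Seq (compile_comp x c) (compile_comp y d)"
| "compile_comp y (Fold x a i e c) =
     Seq (Write x (Const 0) a)
       (Seq (loop i e (compile_comp x c)) (Write y (Const 0) (Var x)))"

text \<open>Cell 0 of the output array serves as output pointer.\<close>

primrec compile :: "emitter \<Rightarrow> prog" where
  "compile (Emit e) = Seq (Write 1 (Add (Var 1) (Const 1)) e) (incr 1)"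
| "compile (Sq p q) = Seq (compile p) (compile q)"
| "compile (For i e p) = loop i e (compile p)"
| "compile (LetE x c p) = Seq (compile_comp x c) (compile p)"

text \<open>In units of \<open>g + 1\<close>: 4 for resetting the counter, and at most
  \<open>Z\<close> rounds plus the failing test, each charged with body, test and increment.\<close>

definition loop_time :: "nat \<Rightarrow> nat \<Rightarrow> expr \<Rightarrow> nat \<Rightarrow> nat" where
  "loop_time Z i e T =
     4 + (Z + 1) * (T + cost_coeff (Sub e (Var i)) + cost_coeff (Add (Var i) (Const 1)) + 2)"

primrec comp_time :: "nat \<Rightarrow> comp \<Rightarrow> nat" where
  "comp_time Z (Expr e) = cost_coeff e + 2"
| "comp_time Z (LetC x c d) = comp_time Z c + comp_time Z d"
| "comp_time Z (Fold x a i e c) =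
     cost_coeff a + 2 + loop_time Z i e (comp_time Z c) + cost_coeff (Var x) + 2"

primrec emit_time :: "nat \<Rightarrow> emitter \<Rightarrow> nat" where
  "emit_time Z (Emit e) = 2 * cost_coeff (Add (Var 1) (Const 1)) + cost_coeff e + 2"
| "emit_time Z (Sq p q) = emit_time Z p + emit_time Z q"
| "emit_time Z (For i e p) = loop_time Z i e (emit_time Z p)"
| "emit_time Z (LetE x c p) = comp_time Z c + emit_time Z p"

section \<open>Correctness and cost of compiled code\<close>

lemma agree_mono: "agree X s \<sigma> \<Longrightarrow> Y \<subseteq> X \<Longrightarrow> agree Y s \<sigma>"
  by (auto simp: agree_def)

lemma agree_updI:
  "agree (insert x X - {x}) s \<sigma> \<Longrightarrow> x \<notin> X \<Longrightarrow> 2 \<le> x \<Longrightarrow> s x 0 = v \<Longrightarrow>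
   agree (insert x X) s (upd \<sigma> x v)"
  by (auto simp: agree_def upd_def)

lemma agree_upd_right: "agree X s (upd \<sigma> x v) \<Longrightarrow> x \<notin> X \<Longrightarrow> 2 \<le> x \<Longrightarrow> agree X s \<sigma>"
  by (auto simp: agree_def upd_def)

lemma small_upd: "small g X s \<Longrightarrow> 2 \<le> x \<Longrightarrow> v \<le> 2 ^ g \<Longrightarrow> small g (insert x X) (upd s x v)"
  by (auto simp: small_def upd_def)

lemma runs_assign:
  assumes "small g X s" "0 < g" "scoped X e"
  shows "\<exists>t. runs (Write y (Const 0) e) s t (upd s y (eval_expr s e)) \<and>
    t \<le> (cost_coeff e + 2) * (g + 1)"
proof (intro exI conjI)
  show "runs (Write y (Const 0) e) s (cost s (Const 0) + cost s e) (upd s y (eval_expr s e))"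
    using runs_Write[of y "Const 0" e s] by (simp add: upd_def)
  show "cost s (Const 0) + cost s e \<le> (cost_coeff e + 2) * (g + 1)"
    using cost_le[OF assms] cost_le[OF assms(1,2), of "Const 0"] by (simp add: algebra_simps)
qed

text \<open>Invariant rule for counted loops. \<open>I k\<close> holds after \<open>k\<close>
  rounds; it must be insensitive to the counter, which is changed outside the body, and the body
  must hand the counter back unchanged.\<close>

lemma runs_loop:
  fixes I :: "nat \<Rightarrow> store \<Rightarrow> bool"
  assumes g: "0 < g" and Z: "N \<le> Z" "Z \<le> 2 ^ g" and X: "i \<notin> X" "scoped X e"
    and I: "\<And>k s. I k s \<Longrightarrow> small g X s \<and> eval_expr s e = N"
    and upd: "\<And>k s v. I k s \<Longrightarrow> I k (upd s i v)"
    and body: "\<And>k s. k < N \<Longrightarrow> I k s \<Longrightarrow> s i 0 = k \<Longrightarrow>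
      \<exists>t s'. runs p s t s' \<and> t \<le> T * (g + 1) \<and> s' i 0 = k \<and> I (Suc k) s'"
    and init: "I 0 s"
  shows "\<exists>t s'. runs (loop i e p) s t s' \<and> t \<le> loop_time Z i e T * (g + 1) \<and> I N s'"
proof -
  define A where "A = T + cost_coeff (Sub e (Var i)) + cost_coeff (Add (Var i) (Const 1)) + 2"
  have small_i: "small g (insert i X) s" if "I k s" "s i 0 \<le> N" for k s
    using I[OF that(1)] that(2) Z by (auto simp: small_def)
  have scoped_i: "scoped (insert i X) (Sub e (Var i))"
    using X by (auto intro: scoped_mono)
  have test: "cost s (Sub e (Var i)) \<le> cost_coeff (Sub e (Var i)) * (g + 1)"
    if "I k s" "s i 0 \<le> N" for k s
    by (rule cost_le[OF small_i[OF that] g scoped_i])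
  \<comment> \<open>Stated for a start at round \<open>k\<close>, so that the induction runs from
    the last test backwards.\<close>
  have while: "\<exists>t s'. runs (While (Sub e (Var i)) (Seq p (incr i))) s t s' \<and>
      t \<le> (N - k + 1) * A * (g + 1) \<and> I N s'"
    if "k \<le> N" "I k s" "s i 0 = k" for k s
    using that
  proof (induction k arbitrary: s rule: inc_induct)
    case base
    have "eval_expr s (Sub e (Var i)) = 0" using base I by simp
    then have "runs (While (Sub e (Var i)) (Seq p (incr i))) s (cost s (Sub e (Var i))) s"
      by (rule runs_While_false)
    moreover have "cost s (Sub e (Var i)) \<le> A * (g + 1)"
      using test[of N s] base by (simp add: A_def algebra_simps)
    ultimately show ?case using base by auto
  next
    case (step k)
    obtain t s' where t: "runs p s t s'" "t \<le> T * (g + 1)" "s' i 0 = k" "I (Suc k) s'"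
      using body step.hyps step.prems by blast
    have "small g (insert i X) s'"
      using t step.hyps by (intro small_i[of "Suc k"]) auto
    moreover have "scoped (insert i X) (Add (Var i) (Const 1))" by simp
    ultimately obtain u where
      u: "runs (incr i) s' u (upd s' i (eval_expr s' (Add (Var i) (Const 1))))"
         "u \<le> (cost_coeff (Add (Var i) (Const 1)) + 2) * (g + 1)"
      using runs_assign[OF _ g] unfolding incr_def by blast
    have u: "runs (incr i) s' u (upd s' i (Suc k))"
         "u \<le> (cost_coeff (Add (Var i) (Const 1)) + 2) * (g + 1)"
      using t(3) u by simp_all
    obtain v s'' where v: "runs (While (Sub e (Var i)) (Seq p (incr i))) (upd s' i (Suc k)) v s''"
      "v \<le> (N - Suc k + 1) * A * (g + 1)" "I N s''"
      using step.IH[of "upd s' i (Suc k)"] upd[OF t(4)] by auto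
    have "eval_expr s (Sub e (Var i)) \<noteq> 0" using step I by simp
    from runs_While_true[OF this runs_Seq[OF t(1) u(1)] v(1)]
    have "runs (While (Sub e (Var i)) (Seq p (incr i))) s
      (cost s (Sub e (Var i)) + (t + u) + v) s''" .
    moreover have "cost s (Sub e (Var i)) + (t + u) \<le> A * (g + 1)"
      using test[of k s] step t(2) u(2) by (simp add: A_def algebra_simps)
    then have "cost s (Sub e (Var i)) + (t + u) + v \<le> A * (g + 1) + (N - Suc k + 1) * A * (g + 1)"
      using v(2) by linarith
    moreover have "A * (g + 1) + (N - Suc k + 1) * A * (g + 1) = (N - k + 1) * A * (g + 1)"
      using step.hyps by (simp add: algebra_simps flip: Suc_diff_Suc)
    ultimately show ?case using v(3) by metis
  qed
  from runs_assign[OF _ g, of X s "Const 0" i] I[OF init] obtain t where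
    t: "runs (Write i (Const 0) (Const 0)) s t (upd s i 0)" "t \<le> 4 * (g + 1)"
    by auto
  from while[of 0 "upd s i 0"] upd[OF init] obtain u s' where
    u: "runs (While (Sub e (Var i)) (Seq p (incr i))) (upd s i 0) u s'"
      "u \<le> (N + 1) * A * (g + 1)" "I N s'"
    by auto
  have "(N + 1) * A * (g + 1) \<le> (Z + 1) * A * (g + 1)"
    using Z by (intro mult_right_mono) auto
  then have "t + u \<le> loop_time Z i e T * (g + 1)"
    using t(2) u(2) unfolding loop_time_def A_def[symmetric] add_mult_distrib by linarith
  then show ?thesis
    using runs_Seq[OF t(1) u(1)] u(3) unfolding loop_def by blast
qed

lemma cval_le:
  assumes "Z \<le> 2 ^ g"
  shows "cok g Z c s \<Longrightarrow> cval c s \<le> 2 ^ g"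
proof (induction c arbitrary: s)
  case (Fold x a i e c)
  show ?case
  proof (cases "eval_expr s e")
    case 0
    then show ?thesis using Fold.prems by simp
  next
    case (Suc k)
    then have "cok g Z c (upd (upd s x
        (iter (\<lambda>k v. cval c (upd (upd s x v) i k)) (eval_expr s a) k)) i k)"
      using Fold.prems by simp
    from Fold.IH[OF this] show ?thesis using Suc by simp
  qed
qed auto

lemma iter_le:
  assumes "Z \<le> 2 ^ g" "cok g Z (Fold x a i e c) s" "k \<le> eval_expr s e"
  shows "iter (\<lambda>k v. cval c (upd (upd s x v) i k)) (eval_expr s a) k \<le> 2 ^ g"
  using assms by (cases k) (auto intro!: cval_le[OF assms(1)])

text \<open>A simulation: the machine store \<open>s\<close> follows the semantic store
  \<open>\<sigma>\<close>. Inner binders are fresh, so their left-over values lie outside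
  \<open>X\<close>, and agreement can fail at \<open>y\<close> only.\<close>

lemma runs_compile_comp:
  assumes g: "0 < g" and Z: "Z \<le> 2 ^ g"
  shows "cwf X c \<Longrightarrow> agree X s \<sigma> \<Longrightarrow> small g X \<sigma> \<Longrightarrow> cok g Z c \<sigma> \<Longrightarrow> 2 \<le> y \<Longrightarrow>
    \<exists>t s'. runs (compile_comp y c) s t s' \<and> t \<le> comp_time Z c * (g + 1) \<and>
      s' 1 = s 1 \<and> agree (X - {y}) s' \<sigma> \<and> s' y 0 = cval c \<sigma>"
proof (induction c arbitrary: X s \<sigma> y)
  case (Expr e)
  have sc: "scoped X e" using Expr by simp
  have "small g X s" using Expr small_agree by blast
  from runs_assign[OF this g sc, of y] obtain t where
    "runs (Write y (Const 0) e) s t (upd s y (eval_expr s e))" "t \<le> (cost_coeff e + 2) * (g + 1)"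
    by blast
  moreover have "eval_expr s e = eval_expr \<sigma> e" using eval_agree Expr.prems(2) sc by blast
  moreover have "agree (X - {y}) (upd s y v) \<sigma>" for v
    using Expr by (auto simp: agree_def upd_def)
  moreover have "upd s y v 1 = s 1" for v using Expr.prems(5) by (auto simp: upd_def)
  ultimately show ?case
    by (intro exI[of _ t] exI[of _ "upd s y (eval_expr s e)"]) (simp del: One_nat_def)
next
  case (LetC x c d)
  obtain t s' where t: "runs (compile_comp x c) s t s'" "t \<le> comp_time Z c * (g + 1)"
    "s' 1 = s 1" "agree (X - {x}) s' \<sigma>" "s' x 0 = cval c \<sigma>"
    using LetC.IH(1)[of X s \<sigma> x] LetC.prems by auto
  have ag: "agree (insert x X) s' (upd \<sigma> x (cval c \<sigma>))"
    using t LetC.prems by (intro agree_updI) auto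
  have sm: "small g (insert x X) (upd \<sigma> x (cval c \<sigma>))"
    using LetC.prems cval_le[OF Z] by (intro small_upd) auto
  obtain u s'' where u: "runs (compile_comp y d) s' u s''" "u \<le> comp_time Z d * (g + 1)"
    "s'' 1 = s' 1" "agree (insert x X - {y}) s'' (upd \<sigma> x (cval c \<sigma>))"
    "s'' y 0 = cval d (upd \<sigma> x (cval c \<sigma>))"
    using LetC.IH(2)[OF _ ag sm _ LetC.prems(5)] LetC.prems by auto
  have "agree (X - {y}) s'' \<sigma>"
    using u(4) LetC.prems(1) by (auto intro: agree_upd_right agree_mono)
  then show ?case
    using runs_Seq[OF t(1) u(1)] t(2,3) u(2,3,5)
    by (intro exI[of _ "t + u"] exI[of _ s'']) (auto simp: add_mult_distrib)
next
  case (Fold x a i e c)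
  define N where "N = eval_expr \<sigma> e"
  define v where "v = iter (\<lambda>k v. cval c (upd (upd \<sigma> x v) i k)) (eval_expr \<sigma> a)"
  \<comment> \<open>The accumulator holds the \<open>k\<close>-th iterate, while scope and output
    are as before the loop.\<close>
  define I where "I k s' \<longleftrightarrow> s' 1 = s 1 \<and> agree X s' \<sigma> \<and> s' x 0 = v k" for k s'
  have wf: "2 \<le> x" "2 \<le> i" "x \<noteq> i" "x \<notin> X" "i \<notin> X" "scoped X a" "scoped X e"
    "cwf (insert i (insert x X)) c"
    using Fold.prems(1) by auto
  have v_le: "v k \<le> 2 ^ g" if "k \<le> N" for k
    unfolding v_def using iter_le[OF Z Fold.prems(4)] that N_def by blast
  have NZ: "N \<le> Z" using Fold.prems(4) by (simp add: N_def)
  have "small g X s" using Fold small_agree by blast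
  from runs_assign[OF this g wf(6), of x] obtain t where
    t: "runs (Write x (Const 0) a) s t (upd s x (eval_expr s a))" "t \<le> (cost_coeff a + 2) * (g + 1)"
    by blast
  have I0: "I 0 (upd s x (eval_expr s a))"
    using eval_agree[OF wf(6) Fold.prems(2)] Fold.prems(2) wf
    by (auto simp: I_def v_def agree_def upd_def)
  have "\<exists>t s'. runs (loop i e (compile_comp x c)) (upd s x (eval_expr s a)) t s' \<and>
    t \<le> loop_time Z i e (comp_time Z c) * (g + 1) \<and> I N s'"
  proof (rule runs_loop[OF g NZ Z wf(5,7), of I, OF _ _ _ I0])
    show "small g X s' \<and> eval_expr s' e = N" if "I k s'" for k s'
      using that Fold.prems(3) small_agree eval_agree[OF wf(7)] unfolding I_def N_def by blast
    show "I k (upd s' i w)" if "I k s'" for k s' w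
      using that wf by (auto simp: I_def agree_def upd_def)
    fix k s' assume k: "k < N" and Ik: "I k s'" and ik: "s' i 0 = k"
    have ag: "agree (insert i (insert x X)) s' (upd (upd \<sigma> x (v k)) i k)"
      using Ik ik wf by (auto simp: I_def agree_def upd_def)
    have sm: "small g (insert i (insert x X)) (upd (upd \<sigma> x (v k)) i k)"
      using wf v_le[of k] k NZ Z Fold.prems(3) by (intro small_upd) auto
    have ok: "cok g Z c (upd (upd \<sigma> x (v k)) i k)"
      using Fold.prems(4) k by (auto simp: N_def v_def)
    obtain t s'' where t: "runs (compile_comp x c) s' t s''" "t \<le> comp_time Z c * (g + 1)"
      "s'' 1 = s' 1" "agree (insert i (insert x X) - {x}) s'' (upd (upd \<sigma> x (v k)) i k)"
      "s'' x 0 = cval c (upd (upd \<sigma> x (v k)) i k)"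
      using Fold.IH[OF wf(8) ag sm ok wf(1)] by blast
    have "agree X s'' \<sigma>"
      using agree_mono[OF t(4), of X] wf by (blast intro: agree_upd_right)
    then have "I (Suc k) s''" using t(3,5) Ik by (simp add: I_def v_def)
    moreover have "s'' i 0 = k" using t(4) wf by (auto simp: agree_def)
    ultimately show "\<exists>t s''. runs (compile_comp x c) s' t s'' \<and> t \<le> comp_time Z c * (g + 1) \<and>
      s'' i 0 = k \<and> I (Suc k) s''"
      using t(1,2) by blast
  qed
  then obtain u s' where u: "runs (loop i e (compile_comp x c)) (upd s x (eval_expr s a)) u s'"
    "u \<le> loop_time Z i e (comp_time Z c) * (g + 1)" "I N s'"
    by blast
  have "small g (insert x X) s'"
    using u(3) v_le[of N] Fold.prems(3) by (auto simp: I_def small_def agree_def)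
  moreover have "scoped (insert x X) (Var x)" by simp
  ultimately obtain w where
    "runs (Write y (Const 0) (Var x)) s' w (upd s' y (eval_expr s' (Var x)))"
    and w2: "w \<le> (cost_coeff (Var x) + 2) * (g + 1)"
    using runs_assign[OF _ g] by blast
  then have w: "runs (Write y (Const 0) (Var x)) s' w (upd s' y (v N))"
    using u(3) by (simp add: I_def)
  have "runs (compile_comp y (Fold x a i e c)) s (t + (u + w)) (upd s' y (v N))"
    using runs_Seq[OF t(1) runs_Seq[OF u(1) w]] by simp
  moreover have "t + (u + w) \<le> comp_time Z (Fold x a i e c) * (g + 1)"
    using t(2) u(2) w2 unfolding comp_time.simps add_mult_distrib by linarith
  moreover have "agree (X - {y}) (upd s' y (v N)) \<sigma>" "upd s' y (v N) 1 = s 1"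
    "upd s' y (v N) y 0 = cval (Fold x a i e c) \<sigma>"
    using u(3) Fold.prems(5) by (auto simp: I_def agree_def upd_def v_def N_def)
  ultimately show ?case by blast
qed

lemma output_is_snoc:
  assumes "output_is s ys"
  shows "output_is (upd (s(1 := (s 1)(Suc (length ys) := v))) 1 (Suc (length ys))) (ys @ [v])"
  using assms by (auto simp: output_is_def upd_def nth_append nth_Cons' split: if_splits)

text \<open>The simulation with an output prefix \<open>ys\<close>. \<open>Emit\<close> reads the
  output pointer as a scalar, so the length bound keeps the cost of addressing under
  control.\<close>

lemma runs_compile:
  assumes g: "0 < g" and Z: "Z \<le> 2 ^ g"
  shows "ewf X p \<Longrightarrow> agree X s \<sigma> \<Longrightarrow> small g X \<sigma> \<Longrightarrow> eok g Z p \<sigma> \<Longrightarrow> output_is s ys \<Longrightarrow> 1 \<notin> X \<Longrightarrow>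
    length ys + length (out p \<sigma>) \<le> 2 ^ g \<Longrightarrow>
    \<exists>t s'. runs (compile p) s t s' \<and> t \<le> emit_time Z p * (g + 1) \<and>
      agree X s' \<sigma> \<and> output_is s' (ys @ out p \<sigma>)"
proof (induction p arbitrary: X s \<sigma> ys)
  case (Emit e)
  have len: "s 1 0 = length ys" using Emit.prems(5) by (auto simp: output_is_def)
  define s1 where "s1 = s(1 := (s 1)(Suc (length ys) := eval_expr \<sigma> e))"
  have sm: "small g X s" using Emit small_agree by blast
  have sm1: "small g {1} s" using sm len Emit.prems(7) by (auto simp: small_def)
  have ev: "eval_expr s e = eval_expr \<sigma> e" using eval_agree Emit.prems by auto
  have "runs (Write 1 (Add (Var 1) (Const 1)) e) s (cost s (Add (Var 1) (Const 1)) + cost s e) s1"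
    using runs_Write[of 1 "Add (Var 1) (Const 1)" e s] len ev by (simp add: s1_def)
  moreover have "cost s (Add (Var 1) (Const 1)) \<le> cost_coeff (Add (Var 1) (Const 1)) * (g + 1)"
    by (rule cost_le[OF sm1 g]) simp
  moreover have "cost s e \<le> cost_coeff e * (g + 1)"
    using cost_le[OF sm g] Emit.prems(1) by simp
  moreover have "small g {1} s1"
    using sm1 by (auto simp: small_def s1_def)
  from runs_assign[OF this g, of "Add (Var 1) (Const 1)" 1] obtain t where
    "runs (incr 1) s1 t (upd s1 1 (Suc (length ys)))"
    "t \<le> (cost_coeff (Add (Var 1) (Const 1)) + 2) * (g + 1)"
    using len by (auto simp: incr_def s1_def)
  moreover have "agree X (upd s1 1 v) \<sigma>" for v
    using Emit.prems by (auto simp: agree_def upd_def s1_def)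
  moreover have "output_is (upd s1 1 (Suc (length ys))) (ys @ [eval_expr \<sigma> e])"
    using output_is_snoc[OF Emit.prems(5)] by (simp add: s1_def)
  ultimately have "runs (compile (Emit e)) s (cost s (Add (Var 1) (Const 1)) + cost s e + t)
      (upd s1 1 (Suc (length ys)))"
    "cost s (Add (Var 1) (Const 1)) + cost s e + t \<le> emit_time Z (Emit e) * (g + 1)"
    "agree X (upd s1 1 (Suc (length ys))) \<sigma>"
    "output_is (upd s1 1 (Suc (length ys))) (ys @ out (Emit e) \<sigma>)"
    by (auto intro: runs_Seq simp: add_mult_distrib simp del: One_nat_def cost.simps cost_coeff.simps)
  then show ?case by blast
next
  case (Sq p q)
  obtain t s' where t: "runs (compile p) s t s'" "t \<le> emit_time Z p * (g + 1)"
    "agree X s' \<sigma>" "output_is s' (ys @ out p \<sigma>)"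
    using Sq.IH(1)[of X s \<sigma> ys] Sq.prems by auto
  obtain u s'' where u: "runs (compile q) s' u s''" "u \<le> emit_time Z q * (g + 1)"
    "agree X s'' \<sigma>" "output_is s'' ((ys @ out p \<sigma>) @ out q \<sigma>)"
    using Sq.IH(2)[of X s' \<sigma> "ys @ out p \<sigma>"] Sq.prems t by auto
  show ?case
    using runs_Seq[OF t(1) u(1)] t(2) u(2-)
    by (intro exI[of _ "t + u"] exI[of _ s'']) (auto simp: add_mult_distrib)
next
  case (For i e p)
  define N where "N = eval_expr \<sigma> e"
  define os where "os k = concat (map (\<lambda>k. out p (upd \<sigma> i k)) [0..<k])" for k
  define I where "I k s' \<longleftrightarrow> agree X s' \<sigma> \<and> output_is s' (ys @ os k)" for k s'
  have wf: "2 \<le> i" "i \<notin> X" "scoped X e" "ewf (insert i X) p"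
    using For.prems(1) by auto
  have NZ: "N \<le> Z" using For.prems(4) by (simp add: N_def)
  have mono: "length (os k) \<le> length (os N)" if "k \<le> N" for k
  proof -
    have "os N = os k @ concat (map (\<lambda>k. out p (upd \<sigma> i k)) [k..<N])"
      using that unfolding os_def by (metis concat_append le0 map_append upt_add_eq_append le_add_diff_inverse)
    then show ?thesis by simp
  qed
  have osN: "os N = out (For i e p) \<sigma>" by (simp add: os_def N_def)
  have I0: "I 0 s" using For.prems by (auto simp: I_def os_def)
  have "\<exists>t s'. runs (loop i e (compile p)) s t s' \<and>
    t \<le> loop_time Z i e (emit_time Z p) * (g + 1) \<and> I N s'"
  proof (rule runs_loop[OF g NZ Z wf(2,3), of I, OF _ _ _ I0])
    show "small g X s' \<and> eval_expr s' e = N" if "I k s'" for k s'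
      using that For.prems(3) small_agree eval_agree[OF wf(3)] unfolding I_def N_def by blast
    show "I k (upd s' i w)" if "I k s'" for k s' w
      using that wf by (auto simp: I_def agree_def upd_def output_is_def)
    fix k s' assume k: "k < N" and Ik: "I k s'" and ik: "s' i 0 = k"
    have ag: "agree (insert i X) s' (upd \<sigma> i k)"
      using Ik ik wf by (auto simp: I_def agree_def upd_def)
    have sm: "small g (insert i X) (upd \<sigma> i k)"
      using wf k NZ Z For.prems(3) by (intro small_upd) auto
    have ok: "eok g Z p (upd \<sigma> i k)"
      using For.prems(4) k by (auto simp: N_def)
    have os_Suc: "os (Suc k) = os k @ out p (upd \<sigma> i k)" by (simp add: os_def)
    have "length (ys @ os k) + length (out p (upd \<sigma> i k)) \<le> 2 ^ g"
      using mono[of "Suc k"] k os_Suc osN For.prems(7) by simp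
    then obtain t s'' where t: "runs (compile p) s' t s''" "t \<le> emit_time Z p * (g + 1)"
      "agree (insert i X) s'' (upd \<sigma> i k)" "output_is s'' ((ys @ os k) @ out p (upd \<sigma> i k))"
      using For.IH[OF wf(4) ag sm ok, of "ys @ os k"] Ik For.prems(6) wf unfolding I_def by auto
    have "agree X s'' \<sigma>"
      using agree_mono[OF t(3), of X] wf by (blast intro: agree_upd_right)
    then have "I (Suc k) s''" using t(4) os_Suc by (simp add: I_def)
    moreover have "s'' i 0 = k" using t(3) wf by (auto simp: agree_def)
    ultimately show "\<exists>t s''. runs (compile p) s' t s'' \<and> t \<le> emit_time Z p * (g + 1) \<and>
      s'' i 0 = k \<and> I (Suc k) s''"
      using t(1,2) by blast
  qed
  then show ?case unfolding I_def osN by auto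
next
  case (LetE x c p)
  obtain t s' where t: "runs (compile_comp x c) s t s'" "t \<le> comp_time Z c * (g + 1)"
    "s' 1 = s 1" "agree (X - {x}) s' \<sigma>" "s' x 0 = cval c \<sigma>"
    using runs_compile_comp[OF g Z, of X c s \<sigma> x] LetE.prems by auto
  have ag: "agree (insert x X) s' (upd \<sigma> x (cval c \<sigma>))"
    using t LetE.prems by (intro agree_updI) auto
  have sm: "small g (insert x X) (upd \<sigma> x (cval c \<sigma>))"
    using LetE.prems cval_le[OF Z] by (intro small_upd) auto
  have os: "output_is s' ys" using LetE.prems(5) t(3) by (simp add: output_is_def)
  obtain u s'' where u: "runs (compile p) s' u s''" "u \<le> emit_time Z p * (g + 1)"
    "agree (insert x X) s'' (upd \<sigma> x (cval c \<sigma>))"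
    "output_is s'' (ys @ out p (upd \<sigma> x (cval c \<sigma>)))"
    using LetE.IH[OF _ ag sm _ os] LetE.prems by auto
  have "agree X s'' \<sigma>"
    using u(3) LetE.prems(1) by (auto intro: agree_upd_right agree_mono)
  then show ?case
    using runs_Seq[OF t(1) u(1)] t(2) u(2,4)
    by (intro exI[of _ "t + u"] exI[of _ s'']) (auto simp: add_mult_distrib)
qed

section \<open>Polynomial running time of emitters\<close>

text \<open>Each level of loop nesting raises the exponent by one.\<close>

lemma loop_time_poly:
  assumes "\<exists>K d. \<forall>Z. T Z \<le> K * (Z + 1) ^ d"
  shows "\<exists>K d. \<forall>Z. loop_time Z i e (T Z) \<le> K * (Z + 1) ^ d"
proof -
  obtain K d where K: "T Z \<le> K * (Z + 1) ^ d" for Z using assms by blast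
  define C where "C = cost_coeff (Sub e (Var i)) + cost_coeff (Add (Var i) (Const 1)) + 2"
  have "loop_time Z i e (T Z) \<le> (K + C + 4) * (Z + 1) ^ Suc d" for Z
  proof -
    have one: "1 \<le> (Z + 1) ^ d" by simp
    have "T Z + C \<le> (K + C) * (Z + 1) ^ d"
      using K[of Z] mult_le_mono2[OF one, of C] unfolding add_mult_distrib by linarith
    then have "(Z + 1) * (T Z + C) \<le> (Z + 1) * ((K + C) * (Z + 1) ^ d)"
      by (rule mult_le_mono2)
    moreover have "4 \<le> 4 * (Z + 1) ^ Suc d" using one_le_power[of "Z + 1" "Suc d"] by linarith
    ultimately have "4 + (Z + 1) * (T Z + C) \<le> 4 * (Z + 1) ^ Suc d + (Z + 1) * ((K + C) * (Z + 1) ^ d)"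
      by linarith
    also have "\<dots> = (K + C + 4) * (Z + 1) ^ Suc d" by (simp add: algebra_simps)
    finally show ?thesis by (simp only: loop_time_def C_def add.assoc)
  qed
  then show ?thesis by blast
qed

lemma sum_poly:
  assumes "\<exists>K d. \<forall>Z::nat. S Z \<le> K * (Z + 1) ^ d" "\<exists>K d. \<forall>Z. T Z \<le> K * (Z + 1) ^ d"
  shows "\<exists>K d. \<forall>Z. S Z + T Z \<le> (K::nat) * (Z + 1) ^ d"
proof -
  obtain K d L e where K: "S Z \<le> K * (Z + 1) ^ d" and L: "T Z \<le> L * (Z + 1) ^ e" for Z
    using assms by blast
  have "S Z + T Z \<le> (K + L) * (Z + 1) ^ (d + e)" for Z
  proof -
    have "K * (Z + 1) ^ d \<le> K * (Z + 1) ^ (d + e)" "L * (Z + 1) ^ e \<le> L * (Z + 1) ^ (d + e)"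
      by (auto intro!: mult_le_mono2 power_increasing)
    then show ?thesis using K[of Z] L[of Z] unfolding add_mult_distrib by linarith
  qed
  then show ?thesis by blast
qed

lemma const_poly: "\<exists>K d. \<forall>Z::nat. C \<le> (K::nat) * (Z + 1) ^ d"
  by (intro exI[of _ C] exI[of _ 0]) simp

lemma comp_time_poly: "\<exists>K d. \<forall>Z. comp_time Z c \<le> K * (Z + 1) ^ d"
  by (induction c) (auto simp only: comp_time.simps intro!: sum_poly const_poly loop_time_poly)

lemma emit_time_poly: "\<exists>K d. \<forall>Z. emit_time Z p \<le> K * (Z + 1) ^ d"
  by (induction p)
    (auto simp only: emit_time.simps intro!: sum_poly const_poly loop_time_poly comp_time_poly)

text \<open>Each emission is charged at least one unit; this bounds the output pointer in terms of
  the running time.\<close>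

lemma length_out: "eok g Z p s \<Longrightarrow> length (out p s) \<le> emit_time Z p"
proof (induction p arbitrary: s)
  case (For i e p)
  have "length (out (For i e p) s) = (\<Sum>k<eval_expr s e. length (out p (upd s i k)))"
    by (simp add: length_concat comp_def sum_list_sum_nth atLeast0LessThan)
  also have "\<dots> \<le> (\<Sum>k<eval_expr s e. emit_time Z p)"
    using For by (intro sum_mono) auto
  also have "\<dots> = eval_expr s e * emit_time Z p" by simp
  also have "\<dots> \<le> (Z + 1) * emit_time Z p" using For.prems by (intro mult_right_mono) auto
  also have "\<dots> \<le> emit_time Z (For i e p)"
    unfolding emit_time.simps loop_time_def by (simp only: add.assoc add_mult_distrib2)
  finally show ?case .
next
  case (Sq p q)
  then show ?case using add_mono by fastforce
qed (auto intro: trans_le_add2)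

lemma size_of_ge: "x \<in> set xs \<Longrightarrow> bits x \<le> size_of xs" "length xs < size_of xs"
proof -
  show "bits x \<le> size_of xs" if "x \<in> set xs"
    using that member_le_sum_list[of "bits x" "map bits xs"] by (simp add: size_of_def)
  have "length xs \<le> sum_list (map bits xs)"
    by (induction xs) (auto simp: bits_def)
  moreover have "0 < bits (length xs)" by (simp add: bits_def)
  ultimately show "length xs < size_of xs" unfolding size_of_def by simp
qed

lemma less_two_power_bits: "x < 2 ^ bits x"
  by (metis bits_def floorlog_leD le_SucI le_refl one_less_numeral_iff semiring_norm(76))

lemma initial_store_le: "initial_store xs 0 k \<le> 2 ^ size_of xs"
proof -
  have "initial_store xs 0 k = 0 \<or> initial_store xs 0 k \<in> set (length xs # xs)"
    by (auto simp: initial_store_def nth_Cons' intro!: nth_mem)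
  moreover have "x \<le> 2 ^ size_of xs" if "x \<in> set xs" for x
    using less_two_power_bits[of x] power_increasing[OF size_of_ge(1)[OF that], of "2::nat"]
    by linarith
  moreover have "length xs \<le> 2 ^ size_of xs"
    using size_of_ge(2)[of xs] less_exp[of "size_of xs"] by linarith
  ultimately show ?thesis by auto
qed

lemma computes_in_poly_time_compile:
  assumes wf: "ewf {} p"
    and ok: "\<And>x g. x \<in> I \<Longrightarrow> a * size_of (enc x) \<le> g \<Longrightarrow>
      eok g (a * size_of (enc x) ^ b) p (initial_store (enc x))"
    and out: "\<And>x. x \<in> I \<Longrightarrow> out p (initial_store (enc x)) = enc_out (F x)"
  shows "computes_in_poly_time (compile p) I enc enc_out F"
proof -
  obtain K d where K: "emit_time Z p \<le> K * (Z + 1) ^ d" for Z using emit_time_poly by blast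
  \<comment> \<open>The exponent \<open>b * d\<close> stems from the number of operations and
    \<open>b * d + b + 1\<close> from the word size \<open>g + 1\<close>.\<close>
  define C where "C = K * (a + 1) ^ d * (2 * a + 2 + K * (a + 1) ^ d)"
  have "\<exists>t s. runs (compile p) (initial_store (enc x)) t s \<and> output_is s (enc_out (F x)) \<and>
      t \<le> C * size_of (enc x) ^ (b * d + (b * d + b + 1))" if x: "x \<in> I" for x
  proof -
    define z where "z = size_of (enc x)"
    define Z where "Z = a * z ^ b"
    \<comment> \<open>Since \<open>v \<le> 2 ^ v\<close>, adding the quantities themselves makes
      \<open>2 ^ g\<close> dominate all of them, and \<open>g\<close> is still polynomial in
      \<open>z\<close>.\<close>
    define g where "g = a * z + emit_time Z p + Z + z"
    have z: "1 \<le> z" by (simp add: z_def size_of_def bits_def)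
    have g: "0 < g" "Z \<le> 2 ^ g" "emit_time Z p \<le> 2 ^ g"
      using z less_exp[of g] unfolding g_def by linarith+
    have eok: "eok g Z p (initial_store (enc x))"
      unfolding Z_def z_def by (rule ok[OF x]) (simp add: g_def z_def)
    have sm: "small g {} (initial_store (enc x))"
      using order_trans[OF initial_store_le[of "enc x", folded z_def] power_increasing[of z g "2::nat"]]
      by (auto simp: small_def g_def)
    have "\<exists>t s'. runs (compile p) (initial_store (enc x)) t s' \<and> t \<le> emit_time Z p * (g + 1) \<and>
      agree {} s' (initial_store (enc x)) \<and> output_is s' ([] @ out p (initial_store (enc x)))"
      by (rule runs_compile[OF g(1,2) wf _ sm eok])
        (use length_out[OF eok] g(3) in \<open>auto simp: agree_def output_is_def initial_store_def\<close>)
    then obtain t s where t: "runs (compile p) (initial_store (enc x)) t s"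
      "t \<le> emit_time Z p * (g + 1)" "output_is s (enc_out (F x))"
      using out[OF x] by auto
    have "Z + 1 \<le> (a + 1) * z ^ b" using z by (simp add: Z_def)
    then have "(Z + 1) ^ d \<le> ((a + 1) * z ^ b) ^ d" by (rule power_mono) simp
    then have et: "emit_time Z p \<le> K * (a + 1) ^ d * z ^ (b * d)"
      using order_trans[OF K mult_le_mono2]
      by (simp only: power_mult_distrib power_mult mult.assoc)
    have pw: "z ^ m \<le> z ^ (b * d + b + 1)" if "m \<le> b * d + b + 1" for m
      using z that by (intro power_increasing) auto
    have "g + 1 \<le> a * z ^ (b * d + b + 1) + K * (a + 1) ^ d * z ^ (b * d + b + 1) +
        a * z ^ (b * d + b + 1) + z ^ (b * d + b + 1) + z ^ (b * d + b + 1)"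
      unfolding g_def Z_def
      using et pw[of 1] pw[of b] pw[of "b * d"] pw[of 0]
      by (intro add_mono) (auto simp: Z_def intro: order_trans mult_le_mono2)
    then have "g + 1 \<le> (2 * a + 2 + K * (a + 1) ^ d) * z ^ (b * d + b + 1)"
      by (simp add: algebra_simps)
    from order_trans[OF t(2) mult_le_mono[OF et this]]
    have "t \<le> (K * (a + 1) ^ d * z ^ (b * d)) *
        ((2 * a + 2 + K * (a + 1) ^ d) * z ^ (b * d + b + 1))"
      .
    also have "\<dots> = C * z ^ (b * d + (b * d + b + 1))"
      by (simp only: C_def power_add mult_ac)
    finally have "t \<le> C * z ^ (b * d + (b * d + b + 1))" .
    with t show ?thesis by (auto simp: z_def)
  qed
  then show ?thesis unfolding computes_in_poly_time_def by blast
qed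

section \<open>Choice of the parameters\<close>

text \<open>Integral upper bound for \<open>n * D i j\<close> with error at most 1. Scaling by
  \<open>n\<close> before rounding limits the error of an unscaled line sum to 1 and avoids a common
  denominator.\<close>

definition entry :: "nat \<Rightarrow> (nat \<Rightarrow> nat \<Rightarrow> rat) \<Rightarrow> nat \<Rightarrow> nat \<Rightarrow> nat" where
  "entry n D i j = n * num (D i j) div den (D i j) + 1"

text \<open>\<open>peak n D / n\<close> exceeds the maximum row and column sum by at most 1.\<close>

definition peak_step :: "nat \<Rightarrow> (nat \<Rightarrow> nat \<Rightarrow> rat) \<Rightarrow> nat \<Rightarrow> nat \<Rightarrow> nat" where
  "peak_step n D i m = max (max m (\<Sum>j<n. entry n D i j)) (\<Sum>j<n. entry n D j i)"

text \<open>Expressed by \<open>iter\<close> so that it has the form of the value of a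
  \<open>Fold\<close>.\<close>

definition peak :: "nat \<Rightarrow> (nat \<Rightarrow> nat \<Rightarrow> rat) \<Rightarrow> nat" where
  "peak n D = iter (peak_step n D) 0 n"

text \<open>Larger than the estimate \<open>X / n\<close> of the line sums, unless the cap
  \<open>n\<close> applies.\<close>

definition radix :: "nat \<Rightarrow> nat \<Rightarrow> nat" where
  "radix n X = min n (X div n + 1)"

text \<open>Makes copies times \<open>r\<close> at least \<open>2 * X / n\<close>; the factor 2 pays
  for rounding \<open>r ^ L\<close> down to a multiple of \<open>n\<close>.\<close>

definition copies :: "nat \<Rightarrow> nat \<Rightarrow> nat \<Rightarrow> nat" where
  "copies n X r = 2 * X div (n * r) + 1"

definition digits_step :: "nat \<Rightarrow> nat \<Rightarrow> nat \<Rightarrow> nat \<Rightarrow> nat" where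
  "digits_step n r i l = (if r ^ l < n then l + 1 else l)"

text \<open>For \<open>r \<ge> 2\<close> the least \<open>L\<close> with
  \<open>n \<le> r ^ L\<close>, found by counting up; \<open>n\<close> rounds are enough because
  \<open>n < r ^ n\<close>.\<close>

definition digits :: "nat \<Rightarrow> nat \<Rightarrow> nat" where
  "digits n r = iter (digits_step n r) 0 n"

definition words :: "nat \<Rightarrow> nat \<Rightarrow> nat \<Rightarrow> nat" where
  "words n r L = r ^ L div n * n"

definition algorithm :: "nat \<times> (nat \<Rightarrow> nat \<Rightarrow> rat) \<Rightarrow> schedule" where
  "algorithm = (\<lambda>(n, D).
     let X = peak n D; r = radix n X; q = copies n X r; L = digits n r; N = words n r L
     in [(q, (digit_matchings n r L, digit_paths n r L N q D))])"

lemma iter_peak_ge: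
  "i < k \<Longrightarrow> (\<Sum>j<n. entry n D i j) \<le> iter (peak_step n D) 0 k \<and>
     (\<Sum>j<n. entry n D j i) \<le> iter (peak_step n D) 0 k"
  by (induction k) (auto simp: less_Suc_eq peak_step_def le_max_iff_disj)

lemma iter_peak_le:
  assumes "\<And>i. i < k \<Longrightarrow> (\<Sum>j<n. entry n D i j) \<le> b" "\<And>i. i < k \<Longrightarrow> (\<Sum>j<n. entry n D j i) \<le> b"
  shows "iter (peak_step n D) 0 k \<le> b"
  using assms by (induction k) (auto simp: peak_step_def)

lemma iter_digits_le: "k \<le> n \<Longrightarrow> iter (digits_step n r) 0 k \<le> k"
  by (induction k) (auto simp: digits_step_def)

lemma iter_digits_pow:
  assumes "1 \<le> n" "2 \<le> r"
  shows "r ^ (iter (digits_step n r) 0 k) \<le> n * r"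
    "0 < iter (digits_step n r) 0 k \<Longrightarrow> r ^ (iter (digits_step n r) 0 k - 1) < n"
    "n \<le> r ^ (iter (digits_step n r) 0 k) \<or> iter (digits_step n r) 0 k = k"
proof -
  show "0 < iter (digits_step n r) 0 k \<Longrightarrow> r ^ (iter (digits_step n r) 0 k - 1) < n"
    by (induction k) (auto simp: digits_step_def split: if_splits)
  show "r ^ (iter (digits_step n r) 0 k) \<le> n * r"
    using assms by (induction k) (auto simp: digits_step_def)
  show "n \<le> r ^ (iter (digits_step n r) 0 k) \<or> iter (digits_step n r) 0 k = k"
    by (induction k) (auto simp: digits_step_def)
qed

lemma digits:
  assumes "2 \<le> n" "2 \<le> r"
  shows "0 < digits n r" "n \<le> r ^ digits n r" "r ^ (digits n r - 1) < n" "digits n r \<le> n"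
proof -
  have n: "n < r ^ n" using assms(2) less_exp[of n] power_mono[of 2 r n] by linarith
  show le: "n \<le> r ^ digits n r"
    using iter_digits_pow(3)[of n r n] assms n by (auto simp: digits_def)
  then show pos: "0 < digits n r" using assms by (cases "digits n r") auto
  show "r ^ (digits n r - 1) < n"
    using iter_digits_pow(2)[of n r n] assms pos by (simp add: digits_def)
  show "digits n r \<le> n" by (simp add: digits_def iter_digits_le)
qed

text \<open>The remainder is below \<open>n\<close>, and \<open>n\<close> is at most
  \<open>words n r L\<close>, so rounding loses less than half.\<close>

lemma words:
  assumes "0 < n" "n \<le> r ^ L"
  shows "n dvd words n r L" "0 < words n r L" "words n r L \<le> r ^ L" "r ^ L \<le> 2 * words n r L"
proof -
  have *: "words n r L + r ^ L mod n = r ^ L" by (simp add: words_def)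
  have ge: "1 \<le> r ^ L div n" using assms by (simp add: Suc_leI div_greater_zero_iff)
  then have "n \<le> words n r L" by (simp add: words_def)
  moreover have "r ^ L mod n < n" using assms by simp
  ultimately show "n dvd words n r L" "0 < words n r L" "words n r L \<le> r ^ L"
    "r ^ L \<le> 2 * words n r L"
    using * assms(1) by (simp add: words_def, linarith, linarith, linarith)
qed

lemma real_div_bounds:
  assumes "0 < d"
  shows "real (a div d) \<le> real a / real d" "real a / real d < real (a div d) + 1"
proof -
  have "real (a div d * d) \<le> real a" by (subst of_nat_le_iff) simp
  then show "real (a div d) \<le> real a / real d" using assms by (simp add: le_divide_eq)
  have "a < (a div d + 1) * d" using dividend_less_div_times[OF assms, of a] by simp
  then have "real a < real ((a div d + 1) * d)" by (subst of_nat_less_iff)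
  then show "real a / real d < real (a div d) + 1"
    using assms by (simp add: divide_less_eq algebra_simps)
qed

lemma entry_bounds:
  assumes "0 \<le> D i j"
  shows "real n * of_rat (D i j) \<le> real (entry n D i j)"
    "real (entry n D i j) \<le> real n * of_rat (D i j) + 1"
proof -
  let ?a = "n * num (D i j)" and ?d = "den (D i j)"
  have eq: "real n * of_rat (D i j) = real ?a / real ?d"
    using of_rat_num_den[OF assms] by simp
  show "real n * of_rat (D i j) \<le> real (entry n D i j)"
    "real (entry n D i j) \<le> real n * of_rat (D i j) + 1"
    using real_div_bounds[OF den_pos, of ?a "D i j"] unfolding eq entry_def by linarith+
qed

lemma peak_ge:
  assumes "0 < n" shows "n \<le> peak n D"
proof -
  have "(\<Sum>j<n. 1) \<le> (\<Sum>j<n. entry n D 0 j)" by (intro sum_mono) (simp add: entry_def)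
  also have "\<dots> \<le> peak n D" using iter_peak_ge[of 0 n n D] assms by (simp add: peak_def)
  finally show ?thesis by simp
qed

lemma peak_ge_sums:
  assumes "nonneg_matrix n D" "i < n"
  shows "real n * (\<Sum>j<n. of_rat (D i j)) \<le> real (peak n D)"
    "real n * (\<Sum>j<n. of_rat (D j i)) \<le> real (peak n D)"
proof -
  note ge = iter_peak_ge[OF assms(2), of n D, folded peak_def]
  have "real n * (\<Sum>j<n. of_rat (D i j)) \<le> real (\<Sum>j<n. entry n D i j)"
    unfolding sum_distrib_left of_nat_sum using assms
    by (intro sum_mono entry_bounds) (auto simp: nonneg_matrix_def)
  then show "real n * (\<Sum>j<n. of_rat (D i j)) \<le> real (peak n D)"
    using ge by linarith
  have "real n * (\<Sum>j<n. of_rat (D j i)) \<le> real (\<Sum>j<n. entry n D j i)"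
    unfolding sum_distrib_left of_nat_sum using assms
    by (intro sum_mono entry_bounds) (auto simp: nonneg_matrix_def)
  then show "real n * (\<Sum>j<n. of_rat (D j i)) \<le> real (peak n D)"
    using ge by linarith
qed

lemma peak_le:
  assumes "D \<in> demands n B" "0 < n"
  shows "real (peak n D) \<le> real n * (B + 1)"
proof -
  have *: "real (\<Sum>j<n. entry n D (f j) (g j)) \<le> real n * (B + 1)"
    if "(\<Sum>j<n. of_rat (D (f j) (g j))) \<le> B" "\<And>j. j < n \<Longrightarrow> 0 \<le> D (f j) (g j)" for f g
  proof -
    have "real (\<Sum>j<n. entry n D (f j) (g j)) \<le> (\<Sum>j<n. real n * of_rat (D (f j) (g j)) + 1)"
      unfolding of_nat_sum using that(2) by (intro sum_mono entry_bounds) auto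
    also have "\<dots> = real n * (\<Sum>j<n. of_rat (D (f j) (g j))) + real n"
      by (simp add: sum.distrib sum_distrib_left)
    also have "\<dots> \<le> real n * B + real n" using that(1) by (simp add: mult_left_mono)
    finally show ?thesis by (simp add: algebra_simps)
  qed
  have "peak n D \<le> nat \<lfloor>real n * (B + 1)\<rfloor>"
    unfolding peak_def
  proof (rule iter_peak_le)
    fix i assume "i < n"
    then show "(\<Sum>j<n. entry n D i j) \<le> nat \<lfloor>real n * (B + 1)\<rfloor>"
      using *[of "\<lambda>j. i" "\<lambda>j. j"] assms(1)
      by (intro le_nat_floor) (auto simp: demands_def nonneg_matrix_def)
  next
    fix i assume "i < n"
    then show "(\<Sum>j<n. entry n D j i) \<le> nat \<lfloor>real n * (B + 1)\<rfloor>"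
      using *[of "\<lambda>j. j" "\<lambda>j. i"] assms(1)
      by (intro le_nat_floor) (auto simp: demands_def nonneg_matrix_def)
  qed
  \<comment> \<open>Guarantees that \<open>nat\<close> does not clip the floor.\<close>
  moreover have "0 \<le> B"
  proof -
    have "0 \<le> (\<Sum>j<n. real_of_rat (D 0 j))"
      using assms by (intro sum_nonneg) (auto simp: demands_def nonneg_matrix_def)
    also have "\<dots> \<le> B" using assms by (auto simp: demands_def)
    finally show ?thesis .
  qed
  ultimately show ?thesis by (simp add: le_nat_iff le_floor_iff)
qed

lemma radix:
  assumes "2 \<le> n" "n \<le> X"
  shows "2 \<le> radix n X" "radix n X \<le> n" "real (radix n X) \<le> real X / real n + 1"
    "radix n X = n \<or> real X / real n < real (radix n X)"
proof -
  have "1 \<le> X div n" using assms by (simp add: Suc_leI div_greater_zero_iff)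
  then show "2 \<le> radix n X" "radix n X \<le> n" using assms by (auto simp: radix_def)
  have "0 < n" using assms by simp
  note b = real_div_bounds[OF this, of X]
  show "real (radix n X) \<le> real X / real n + 1" using b by (simp add: radix_def min_def)
  show "radix n X = n \<or> real X / real n < real (radix n X)"
    using b by (auto simp: radix_def min_def)
qed

lemma copies:
  assumes "0 < n" "0 < r"
  shows "2 * (real X / real n) \<le> real (copies n X r) * real r"
    "real (copies n X r) * real r \<le> 2 * (real X / real n) + real r"
proof -
  let ?d = "n * r"
  have "2 * X < (2 * X div ?d + 1) * ?d" using assms by (simp add: dividend_less_div_times)
  then have "2 * real X \<le> real (copies n X r) * (real n * real r)"
    unfolding copies_def by (metis less_imp_le of_nat_le_iff of_nat_mult of_nat_numeral)
  then show "2 * (real X / real n) \<le> real (copies n X r) * real r"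
    using assms by (simp add: field_simps)
  have "2 * X div ?d * ?d \<le> 2 * X" by simp
  then have "real (2 * X div ?d) * (real n * real r) \<le> 2 * real X"
    by (metis of_nat_le_iff of_nat_mult of_nat_numeral)
  then show "real (copies n X r) * real r \<le> 2 * (real X / real n) + real r"
    using assms by (simp add: copies_def field_simps)
qed

lemma digit_routing_algorithm:
  assumes n: "2 \<le> n" and D: "nonneg_matrix n D"
    and X: "X = peak n D" and r: "r = radix n X" and L: "L = digits n r"
  shows "digit_routing n r L (words n r L) (copies n X r) D"
proof -
  have nX: "n \<le> X" using peak_ge n X by simp
  note r2 = radix[OF n nX, folded r]
  note L2 = digits[OF n r2(1), folded L]
  have n0: "0 < n" using n by simp
  have r0: "0 < r" using r2 by simp
  note N = words[OF n0 L2(2)]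
  let ?N = "words n r L" and ?q = "copies n X r"
  \<comment> \<open>\<open>2 * y \<le> q * r\<close> and \<open>r ^ L \<le> 2 * N\<close>: the two
    factors 2 cancel.\<close>
  have *: "y * real r ^ (L - 1) \<le> real ?N * real ?q" if "real n * y \<le> real X" for y
  proof -
    have "y \<le> real X / real n" using that n0 by (simp add: field_simps)
    then have "2 * y \<le> real ?q * real r" using copies(1)[OF n0 r0, of X] by simp
    then have "2 * y * real r ^ (L - 1) \<le> real ?q * real r * real r ^ (L - 1)"
      by (intro mult_right_mono) auto
    also have "\<dots> = real ?q * real (r ^ L)"
      using L2(1) by (simp add: power_eq_if[of _ L])
    also have "\<dots> \<le> real ?q * real (2 * ?N)"
      using N(4) by (intro mult_left_mono) (auto simp del: of_nat_power)
    finally show ?thesis by (simp add: mult.commute)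
  qed
  show ?thesis
    using n0 r0 L2 N D * peak_ge_sums[OF D, folded X]
    by unfold_locales (auto simp: nonneg_matrix_def copies_def)
qed

lemma algorithm_correct:
  assumes n: "2 \<le> n" and D: "nonneg_matrix n D"
  defines "X \<equiv> peak n D"
  defines "r \<equiv> radix n X"
  shows "wf_schedule (algorithm (n, D))"
    "integral_routing_for n D (routing_of (algorithm (n, D)))"
    "avg_completion_time n D (routing_of (algorithm (n, D))) \<le> makespan (routing_of (algorithm (n, D)))"
    "makespan (routing_of (algorithm (n, D))) = real (copies n X r * (2 * digits n r * r))"
proof -
  interpret digit_routing n r "digits n r" "words n r (digits n r)" "copies n X r" D
    using digit_routing_algorithm[OF n D] by (simp add: X_def r_def)
  have eq: "algorithm (n, D) = [(copies n X r, (ms, fs))]"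
    by (simp add: algorithm_def Let_def X_def r_def)
  note R_eq = R_def[folded eq]
  show "wf_schedule (algorithm (n, D))" using wf_repeated by (simp add: eq)
  show "integral_routing_for n D (routing_of (algorithm (n, D)))"
    "avg_completion_time n D (routing_of (algorithm (n, D))) \<le> makespan (routing_of (algorithm (n, D)))"
    "makespan (routing_of (algorithm (n, D))) = real (copies n X r * (2 * digits n r * r))"
    using integral_routing_R avg_completion_time_R horizon_digit
    by (simp_all add: R_eq makespan_def)
qed

section \<open>The rate\<close>

text \<open>The radix \<open>r\<close> follows the actual estimate \<open>y\<close>, which can be
  far below \<open>\<beta>\<close>. Up to the square root of \<open>\<beta>\<close> the numerator
  alone is small enough, with \<open>ln r \<ge> 1 / 2\<close>; beyond it \<open>ln r\<close> is at
  least half of \<open>ln \<beta>\<close>.\<close>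

lemma quotient_ln_le:
  fixes y \<beta> r :: real
  assumes \<beta>: "2 \<le> \<beta>" and y: "0 \<le> y" "y \<le> 2 * \<beta>" and r: "2 \<le> r" "y < r"
  shows "y / ln r \<le> 4 * (\<beta> / ln \<beta>)"
proof (cases "y \<le> sqrt \<beta>")
  case True
  have le: "y / ln r \<le> sqrt \<beta> / (1 / 2)"
    using True y \<beta> ln_ge_half[OF r(1)] by (intro frac_le) auto
  have "ln \<beta> \<le> 2 * sqrt \<beta>"
    using ln_le_minus_one[of "sqrt \<beta>"] \<beta> by (simp add: ln_sqrt)
  then have "sqrt \<beta> * ln \<beta> \<le> sqrt \<beta> * (2 * sqrt \<beta>)"
    using \<beta> by (intro mult_left_mono) auto
  moreover have "sqrt \<beta> * (2 * sqrt \<beta>) = 2 * \<beta>" using \<beta> by simp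
  ultimately have "sqrt \<beta> * ln \<beta> \<le> 2 * \<beta>" by linarith
  then have "2 * sqrt \<beta> \<le> 4 * (\<beta> / ln \<beta>)"
    using ln_ge_half[OF \<beta>] by (simp add: field_simps)
  with le show ?thesis by simp
next
  case False
  then have "sqrt \<beta> < r" using r by simp
  then have "ln (sqrt \<beta>) \<le> ln r" using \<beta> r by simp
  then have "ln \<beta> / 2 \<le> ln r" using \<beta> by (simp add: ln_sqrt)
  then have "y / ln r \<le> (2 * \<beta>) / (ln \<beta> / 2)"
    using y \<beta> ln_ge_half[OF \<beta>] by (intro frac_le) auto
  then show ?thesis by simp
qed

text \<open>\<open>y * ln n / ln r\<close> is the makespan up to constants, with \<open>y\<close>
  the estimate known to the algorithm and \<open>B\<close> any valid bound. The middle regime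
  compares with \<open>\<beta> = B\<close>, the last one with \<open>\<beta> = n\<close>.\<close>

lemma rate_upper:
  fixes y B :: real and r n :: nat
  assumes n: "2 \<le> n" and B: "0 < B" and y: "0 \<le> y" "y \<le> B + 1"
    and r: "2 \<le> r" "r \<le> n" "r = n \<or> y < real r"
  shows "y * ln (real n) / ln (real r) \<le> 6 * rate n B"
proof -
  have lnn: "1 / 2 \<le> ln (real n)" using ln_ge_half[of "real n"] n by simp
  have lnr: "1 / 2 \<le> ln (real r)" using ln_ge_half[of "real r"] r by simp
  have main: "y * ln (real n) / ln (real r) \<le> 4 * (\<beta> * ln (real n) / ln \<beta>)"
    if "2 \<le> \<beta>" "\<beta> \<le> real n" "y \<le> 2 * \<beta>" for \<beta>
  proof (cases "r = n")
    case True
    have "ln \<beta> \<le> ln (real n)" using that by simp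
    then have "\<beta> * 1 \<le> \<beta> * (ln (real n) / ln \<beta>)"
      using ln_ge_half[OF that(1)] that by (intro mult_left_mono) auto
    then show ?thesis using True lnn that by simp
  next
    case False
    then have "y / ln (real r) \<le> 4 * (\<beta> / ln \<beta>)"
      using r that y by (intro quotient_ln_le) auto
    from mult_right_mono[OF this, of "ln (real n)"] lnn show ?thesis by simp
  qed
  consider "B \<le> 2" | "2 < B" "B \<le> real n" | "2 < B" "real n < B" by linarith
  then show ?thesis
  proof cases
    case 1
    \<comment> \<open>\<open>y \<le> B + 1 \<le> 3\<close> is the origin of the factor 6.\<close>
    then have "y / ln (real r) \<le> 3 / (1 / 2)" using y lnr by (intro frac_le) auto
    from mult_right_mono[OF this, of "ln (real n)"] lnn 1 show ?thesis by (simp add: rate_def)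
  next
    case 2
    have "0 \<le> B * ln (real n) / ln B" using 2 lnn ln_ge_half[of B] by simp
    moreover have "rate n B = B * ln (real n) / ln B" using 2 by (simp add: rate_def)
    moreover have "y * ln (real n) / ln (real r) \<le> 4 * (B * ln (real n) / ln B)"
      using 2 y by (intro main) auto
    ultimately show ?thesis by linarith
  next
    case 3
    show ?thesis
    proof (cases "r = n")
      case True
      then show ?thesis using 3 y lnn by (simp add: rate_def)
    next
      case False
      \<comment> \<open>A radix below \<open>n\<close> means \<open>y < r\<close>, so the estimate
        is below \<open>n\<close> although \<open>B\<close> is not.\<close>
      then have "y * ln (real n) / ln (real r) \<le> 4 * (real n * ln (real n) / ln (real n))"
        using r n y by (intro main) auto
      then show ?thesis using 3 lnn by (simp add: rate_def)
    qed
  qed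
qed

text \<open>Allows \<open>B\<close> to be replaced by a nearby rational \<open>p\<close>. The two
  may fall into different regimes, hence the case distinction.\<close>

lemma rate_half_le:
  assumes n: "2 \<le> n" and p: "B / 2 \<le> p" "p \<le> B" "0 < B"
  shows "rate n B \<le> 8 * rate n p"
proof -
  have lnn: "1 / 2 \<le> ln (real n)" using ln_ge_half[of "real n"] n by simp
  consider "B \<le> 2" | "2 < B" "p \<le> 2" "B \<le> real n" | "2 < B" "p \<le> 2" "real n < B"
    | "2 < p" "B \<le> real n" | "2 < p" "p \<le> real n" "real n < B" | "2 < p" "real n < p"
    by linarith
  then show ?thesis
  proof cases
    case 2
    \<comment> \<open>\<open>B \<le> 2 * p \<le> 4\<close> and \<open>ln B \<ge> 1 / 2\<close> give
      the constant 8.\<close>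
    then have "B / ln B \<le> 4 / (1 / 2)" using p ln_ge_half[of B] by (intro frac_le) auto
    from mult_right_mono[OF this, of "ln (real n)"] 2 lnn show ?thesis by (simp add: rate_def)
  next
    case 4
    have "ln p \<le> ln B" using 4 p by simp
    then have "B / ln B \<le> (2 * p) / ln p" using 4 p ln_ge_half[of p] by (intro frac_le) auto
    then have "B / ln B \<le> 8 * (p / ln p)" using 4 ln_ge_half[of p] by (simp add: field_simps)
    from mult_right_mono[OF this, of "ln (real n)"] 4 lnn p show ?thesis by (simp add: rate_def)
  next
    case 5
    have "ln p \<le> ln (real n)" using 5 by simp
    then have "p * 1 \<le> p * (ln (real n) / ln p)"
      using ln_ge_half[of p] 5 by (intro mult_left_mono) auto
    then show ?thesis using 5 p by (simp add: rate_def)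
  qed (use p lnn in \<open>auto simp: rate_def\<close>)
qed

text \<open>The makespan is \<open>2 * q * L * r\<close>. With \<open>q * r \<le> 4 * y\<close> and
  \<open>L\<close> at most twice the base-\<open>r\<close> logarithm of \<open>n\<close> the factor
  is 16, and \<open>rate_upper\<close> turns it into \<open>96 = 16 * 6\<close>.\<close>

lemma makespan_algorithm:
  assumes n: "2 \<le> n" and B: "0 < B" and D: "D \<in> demands n B"
  shows "makespan (routing_of (algorithm (n, D))) \<le> 96 * rate n B"
proof -
  define X where "X = peak n D"
  define r where "r = radix n X"
  define L where "L = digits n r"
  define y where "y = real X / real n"
  have nonneg: "nonneg_matrix n D" using D by (simp add: demands_def)
  have nX: "n \<le> X" using peak_ge n by (simp add: X_def)
  note r2 = radix[OF n nX, folded r_def y_def]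
  note L2 = digits[OF n r2(1), folded L_def]
  have lnr: "1 / 2 \<le> ln (real r)" using r2(1) ln_ge_half[of "real r"] by simp
  have lnrn: "ln (real r) \<le> ln (real n)" using r2 by simp
  have y: "1 \<le> y" "y \<le> B + 1"
    using nX n peak_le[OF D] by (auto simp: y_def X_def field_simps)
  \<comment> \<open>\<open>2 * y + r \<le> 3 * y + 1\<close>, and \<open>y \<ge> 1\<close>.\<close>
  have "real (copies n X r) * real r \<le> 4 * y"
    using copies(2)[of n r X] n r2 y unfolding y_def[symmetric] by auto
  moreover have "real L \<le> 2 * (ln (real n) / ln (real r))"
  proof -
    have "real (r ^ (L - 1)) < real n" using L2(3) by (simp only: of_nat_less_iff)
    then have "ln (real r ^ (L - 1)) \<le> ln (real n)" using r2(1) by simp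
    then have "real (L - 1) * ln (real r) \<le> ln (real n)" using r2(1) by (simp add: ln_realpow)
    then have "real (L - 1) \<le> ln (real n) / ln (real r)" using lnr by (simp add: le_divide_eq)
    moreover have "1 \<le> ln (real n) / ln (real r)" using lnr lnrn by (simp add: le_divide_eq)
    ultimately show ?thesis using L2(1) by simp
  qed
  ultimately have "(real (copies n X r) * real r) * real L \<le> 4 * y * (2 * (ln (real n) / ln (real r)))"
    by (rule mult_mono) (use y in auto)
  then have "2 * ((real (copies n X r) * real r) * real L) \<le> 16 * (y * ln (real n) / ln (real r))"
    by simp
  also have "\<dots> \<le> 16 * (6 * rate n B)"
    using r2 y by (intro mult_left_mono rate_upper n B) auto
  finally show ?thesis
    using algorithm_correct(4)[OF n nonneg] by (simp add: X_def r_def L_def algebra_simps)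
qed

section \<open>The program\<close>

text \<open>Bundles value and side condition, so that one set of rules decomposes a term along its
  syntax.\<close>

definition computes :: "nat \<Rightarrow> nat \<Rightarrow> comp \<Rightarrow> store \<Rightarrow> nat \<Rightarrow> bool" where
  "computes g Z c s v \<longleftrightarrow> cok g Z c s \<and> cval c s = v"

definition emits :: "nat \<Rightarrow> nat \<Rightarrow> emitter \<Rightarrow> store \<Rightarrow> nat list \<Rightarrow> bool" where
  "emits g Z p s ys \<longleftrightarrow> eok g Z p s \<and> out p s = ys"

lemma computes_Expr: "eval_expr s e = v \<Longrightarrow> v \<le> 2 ^ g \<Longrightarrow> computes g Z (Expr e) s v"
  by (simp add: computes_def)

lemma computes_LetC:
  "computes g Z c s u \<Longrightarrow> computes g Z d (upd s x u) v \<Longrightarrow> computes g Z (LetC x c d) s v"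
  by (simp add: computes_def)

lemma computes_Fold:
  assumes "eval_expr s e = m" "m \<le> Z" "eval_expr s a = f 0" "f 0 \<le> 2 ^ g"
    and step: "\<And>k. k < m \<Longrightarrow> computes g Z c (upd (upd s x (f k)) i k) (f (Suc k))"
  shows "computes g Z (Fold x a i e c) s (f m)"
proof -
  have "iter (\<lambda>k v. cval c (upd (upd s x v) i k)) (f 0) k = f k" if "k \<le> m" for k
    using that by (induction k) (use step in \<open>auto simp: computes_def\<close>)
  then show ?thesis using assms by (auto simp: computes_def)
qed

lemma emits_Emit: "eval_expr s e = v \<Longrightarrow> emits g Z (Emit e) s [v]"
  by (simp add: emits_def)

lemma emits_Sq: "emits g Z p s xs \<Longrightarrow> emits g Z q s ys \<Longrightarrow> emits g Z (Sq p q) s (xs @ ys)"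
  by (simp add: emits_def)

lemma emits_For:
  assumes "eval_expr s e = m" "m \<le> Z" "\<And>k. k < m \<Longrightarrow> emits g Z p (upd s i k) (f k)"
  shows "emits g Z (For i e p) s (concat (map f [0..<m]))"
  using assms by (auto simp: emits_def intro!: arg_cong[where f = concat])

lemma emits_LetE:
  "computes g Z c s v \<Longrightarrow> emits g Z p (upd s x v) ys \<Longrightarrow> emits g Z (LetE x c p) s ys"
  by (simp add: computes_def emits_def)

definition Mod :: "expr \<Rightarrow> expr \<Rightarrow> expr" where
  "Mod e f = Sub e (Mul (Div e f) f)"

text \<open>With truncated subtraction, \<open>1 - (1 - x)\<close> is 0 for \<open>x = 0\<close> and
  1 otherwise.\<close>

definition Less :: "expr \<Rightarrow> expr \<Rightarrow> expr" where
  "Less e f = Sub (Const 1) (Sub (Const 1) (Sub f e))"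

definition Equal :: "expr \<Rightarrow> expr \<Rightarrow> expr" where
  "Equal e f = Sub (Const 1) (Add (Sub e f) (Sub f e))"

lemma eval_Mod [simp]: "eval_expr s (Mod e f) = eval_expr s e mod eval_expr s f"
  by (simp add: Mod_def minus_div_mult_eq_mod)

lemma eval_Less [simp]: "eval_expr s (Less e f) = of_bool (eval_expr s e < eval_expr s f)"
  by (simp add: Less_def)

lemma eval_Equal [simp]: "eval_expr s (Equal e f) = of_bool (eval_expr s e = eval_expr s f)"
  by (auto simp: Equal_def)

lemma scoped_derived [simp]:
  "scoped X (Mod e f) \<longleftrightarrow> scoped X e \<and> scoped X f"
  "scoped X (Less e f) \<longleftrightarrow> scoped X e \<and> scoped X f"
  "scoped X (Equal e f) \<longleftrightarrow> scoped X e \<and> scoped X f"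
  by (auto simp: Mod_def Less_def Equal_def)

text \<open>
  Variables 2 to 8 hold \<open>n\<close>, the peak, the radix, the number of copies, the number of digits, the
  number of words and the block length.
\<close>

definition num_at :: "expr \<Rightarrow> expr \<Rightarrow> expr" where
  "num_at e f = Read 0 (Add (Const 2) (Mul (Const 2) (Add (Mul e (Var 2)) f)))"

definition den_at :: "expr \<Rightarrow> expr \<Rightarrow> expr" where
  "den_at e f = Read 0 (Add (Const 3) (Mul (Const 2) (Add (Mul e (Var 2)) f)))"

definition entry_at :: "expr \<Rightarrow> expr \<Rightarrow> expr" where
  "entry_at e f = Add (Div (Mul (Var 2) (num_at e f)) (den_at e f)) (Const 1)"

definition pow_comp :: "nat \<Rightarrow> nat \<Rightarrow> expr \<Rightarrow> comp" where
  "pow_comp x i e = Fold x (Const 1) i e (Expr (Mul (Var x) (Var 4)))"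

definition sum_comp :: "expr \<Rightarrow> comp" where
  "sum_comp e = Fold 23 (Const 0) 24 (Var 2) (Expr (Add (Var 23) e))"

text \<open>Maxima are written as \<open>a + (b - a)\<close> with truncated subtraction.\<close>

definition peak_comp :: comp where
  "peak_comp = Fold 20 (Const 0) 21 (Var 2)
     (LetC 22 (sum_comp (entry_at (Var 21) (Var 24)))
     (LetC 25 (sum_comp (entry_at (Var 24) (Var 21)))
     (LetC 26 (Expr (Add (Var 20) (Sub (Var 22) (Var 20))))
       (Expr (Add (Var 26) (Sub (Var 25) (Var 26)))))))"

text \<open>\<open>a - (a - b)\<close> with truncated subtraction is the minimum.\<close>

definition radix_comp :: comp where
  "radix_comp = LetC 20 (Expr (Add (Div (Var 3) (Var 2)) (Const 1)))
     (Expr (Sub (Var 20) (Sub (Var 20) (Var 2))))"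

definition copies_comp :: comp where
  "copies_comp = Expr (Add (Div (Mul (Const 2) (Var 3)) (Mul (Var 2) (Var 4))) (Const 1))"

definition digits_comp :: comp where
  "digits_comp = Fold 20 (Const 0) 21 (Var 2)
     (LetC 22 (pow_comp 23 24 (Var 20)) (Expr (Add (Var 20) (Less (Var 22) (Var 2)))))"

definition words_comp :: comp where
  "words_comp = LetC 20 (pow_comp 21 22 (Var 6)) (Expr (Mul (Div (Var 20) (Var 2)) (Var 2)))"

definition shift_comp :: comp where
  "shift_comp = LetC 20 (pow_comp 21 22 (Mod (Div (Var 9) (Var 4)) (Var 6)))
     (Expr (Mod (Mul (Mod (Var 9) (Var 4)) (Var 20)) (Var 2)))"

text \<open>Terms have no branching, so conditions become factors 0 or 1: variable 17 marks the
  first half and selects the word or its partner into 19, and \<open>Equal\<close> suppresses the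
  displacement if the digit does not match.\<close>

definition offset_comp :: comp where
  "offset_comp = Fold 15 (Const 0) 16 (Var 14)
     (LetC 17 (Expr (Less (Div (Var 16) (Var 4)) (Var 6)))
     (LetC 18 (pow_comp 21 22 (Mod (Div (Var 16) (Var 4)) (Var 6)))
     (LetC 19 (Expr (Add (Mul (Var 12) (Var 17)) (Mul (Var 13) (Sub (Const 1) (Var 17)))))
       (Expr (Add (Var 15) (Mul (Equal (Mod (Div (Var 19) (Var 18)) (Var 4)) (Mod (Var 16) (Var 4)))
         (Mul (Mod (Var 16) (Var 4)) (Var 18))))))))"

text \<open>Variable 11 is \<open>n\<close> or, for shift 0, 0; it serves both as the emitted length
  and as the number of pairs.\<close>

definition emit_matchings :: emitter where
  "emit_matchings = For 9 (Var 8) (LetE 10 shift_comp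
     (LetE 11 (Expr (Mul (Var 2) (Less (Const 0) (Var 10))))
       (Sq (Emit (Var 11))
         (For 12 (Var 11) (Sq (Emit (Var 12)) (Emit (Mod (Add (Var 12) (Var 10)) (Var 2))))))))"

text \<open>The offset is recomputed from 0 for every node, as \<open>For\<close> keeps no
  accumulator.\<close>

definition emit_paths :: emitter where
  "emit_paths = For 10 (Var 2) (For 11 (Var 2) (For 12 (Var 7)
     (LetE 13 (Expr (Mod (Sub (Sub (Add (Var 11) (Mul (Const 2) (Var 7))) (Var 10)) (Var 12)) (Var 7)))
       (Sq (Emit (Add (Var 8) (Const 1)))
       (Sq (For 14 (Add (Var 8) (Const 1))
             (LetE 20 offset_comp (Emit (Mod (Add (Var 10) (Var 20)) (Var 2)))))
       (Sq (Emit (num_at (Var 10) (Var 11)))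
         (Emit (Mul (Mul (den_at (Var 10) (Var 11)) (Var 7)) (Var 5)))))))))"

definition emit_block :: emitter where
  "emit_block = Sq (Emit (Const 1)) (Sq (Emit (Var 5)) (Sq (Emit (Var 8)) (Sq emit_matchings
     (Sq (Emit (Mul (Mul (Var 2) (Var 2)) (Var 7))) emit_paths))))"

definition main_emitter :: emitter where
  "main_emitter = LetE 2 (Expr (Read 0 (Const 1))) (LetE 3 peak_comp (LetE 4 radix_comp
     (LetE 5 copies_comp (LetE 6 digits_comp (LetE 7 words_comp
     (LetE 8 (Expr (Mul (Mul (Const 2) (Var 6)) (Var 4))) emit_block))))))"

lemmas comp_defs = num_at_def den_at_def entry_at_def pow_comp_def sum_comp_def peak_comp_def
  radix_comp_def copies_comp_def digits_comp_def words_comp_def shift_comp_def offset_comp_def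
  emit_matchings_def emit_paths_def emit_block_def main_emitter_def

lemma ewf_main: "ewf {} main_emitter"
  by (simp add: comp_defs)

text \<open>Cell 0 holds the length and cell 1 holds \<open>n\<close>, so the entries start in cell
  2, numerator and denominator side by side.\<close>

definition input :: "nat \<Rightarrow> (nat \<Rightarrow> nat \<Rightarrow> rat) \<Rightarrow> store \<Rightarrow> bool" where
  "input n D s \<longleftrightarrow> s 0 1 = n \<and> (\<forall>i<n. \<forall>j<n.
     s 0 (2 + 2 * (i * n + j)) = num (D i j) \<and> s 0 (3 + 2 * (i * n + j)) = den (D i j))"

lemma input_upd [simp]: "0 < x \<Longrightarrow> input n D (upd s x v) = input n D s"
  by (simp add: input_def)

lemma eval_num_at:
  assumes "input n D s" "s 2 0 = n" "eval_expr s e < n" "eval_expr s f < n"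
  shows "eval_expr s (num_at e f) = num (D (eval_expr s e) (eval_expr s f))"
  using assms by (simp add: num_at_def input_def)

lemma eval_den_at:
  assumes "input n D s" "s 2 0 = n" "eval_expr s e < n" "eval_expr s f < n"
  shows "eval_expr s (den_at e f) = den (D (eval_expr s e) (eval_expr s f))"
  using assms by (simp add: den_at_def input_def)

lemma eval_entry_at:
  assumes "input n D s" "s 2 0 = n" "eval_expr s e < n" "eval_expr s f < n"
  shows "eval_expr s (entry_at e f) = entry n D (eval_expr s e) (eval_expr s f)"
  using assms eval_num_at[OF assms] eval_den_at[OF assms] by (simp add: entry_at_def entry_def)

lemma computes_pow:
  assumes "eval_expr s e = m" "m \<le> Z" "s 4 0 = r" "0 < r" "r ^ m \<le> 2 ^ g" "x \<noteq> i" "x \<noteq> 4" "i \<noteq> 4"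
  shows "computes g Z (pow_comp x i e) s (r ^ m)"
  unfolding pow_comp_def
proof (rule computes_Fold[where f = "\<lambda>k. r ^ k"])
  fix k assume "k < m"
  then have "r ^ Suc k \<le> r ^ m" using assms(4) by (intro power_increasing) auto
  also note assms(5)
  finally show "computes g Z (Expr (Mul (Var x) (Var 4))) (upd (upd s x (r ^ k)) i k) (r ^ Suc k)"
    using assms by (intro computes_Expr) auto
qed (use assms in auto)

text \<open>\<open>z\<close> stands for the input size. All stored values are to stay below
  \<open>2 ^ (8 * z)\<close> and all loop lengths below \<open>8 * z ^ 2\<close>.\<close>

locale bounded_run =
  fixes n g Z z :: nat and D :: "nat \<Rightarrow> nat \<Rightarrow> rat"
  assumes n: "2 \<le> n" "n \<le> z" and g: "8 * z \<le> g" and Z: "8 * z ^ 2 \<le> Z"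
    and nonneg: "nonneg_matrix n D"
    and num_le: "\<And>i j. i < n \<Longrightarrow> j < n \<Longrightarrow> num (D i j) \<le> 2 ^ z"
begin

definition "X = peak n D"
definition "r = radix n X"
definition "q = copies n X r"
definition "L = digits n r"
definition "N = words n r L"
definition "U = 2 * L * r"

lemma le_g:
  fixes v :: nat
  assumes "v \<le> 2 ^ (8 * z)"
  shows "v \<le> 2 ^ g"
  using assms power_increasing[OF g, of "2::nat"] by linarith

lemma n_pow: "n ^ k \<le> 2 ^ (k * z)"
proof -
  have "n \<le> 2 ^ z" using n(2) less_exp[of z] by linarith
  then have "n ^ k \<le> (2 ^ z) ^ k" by (rule power_mono) simp
  then show ?thesis by (simp add: mult.commute flip: power_mult)
qed

text \<open>A common bound for the quantities polynomial in \<open>n\<close>; the largest is an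
  offset, at most \<open>2 * n ^ 5\<close>. It accounts for the exponent
  \<open>8 * z = 2 * z + 6 * z\<close>.\<close>

lemma poly_le:
  assumes "v \<le> 4 * n ^ 6"
  shows "v \<le> 2 ^ g"
proof (rule le_g)
  have "(2::nat) ^ 2 \<le> 2 ^ (2 * z)" using n by (intro power_increasing) auto
  then have "4 * n ^ 6 \<le> 2 ^ (2 * z) * 2 ^ (6 * z)" using n_pow[of 6] by (intro mult_le_mono) auto
  also have "\<dots> = 2 ^ (8 * z)" by (simp flip: power_add)
  finally show "v \<le> 2 ^ (8 * z)" using assms by simp
qed

lemma n_pow_mono: "k \<le> 6 \<Longrightarrow> n ^ k \<le> n ^ 6"
  using n by (intro power_increasing) auto

lemma Z_ge: "v \<le> 3 * n ^ 2 \<Longrightarrow> v \<le> Z"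
proof -
  have "n ^ 2 \<le> z ^ 2" using n by (intro power_mono) auto
  then show "v \<le> 3 * n ^ 2 \<Longrightarrow> v \<le> Z" using Z by linarith
qed

lemma n_le: "n \<le> Z" "n \<le> n ^ 2"
  using n by (auto intro!: Z_ge simp: power2_eq_square)

lemma entry_le: "i < n \<Longrightarrow> j < n \<Longrightarrow> entry n D i j \<le> 2 ^ (2 * z)"
proof -
  assume ij: "i < n" "j < n"
  have "entry n D i j \<le> n * num (D i j) + 1" by (simp add: entry_def)
  also have "\<dots> \<le> z * 2 ^ z + 2 ^ z"
    using n num_le[OF ij] by (intro add_mono mult_le_mono) auto
  also have "\<dots> = (z + 1) * 2 ^ z" by simp
  also have "\<dots> \<le> 2 ^ z * 2 ^ z" using less_exp[of z] by (intro mult_le_mono1) linarith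
  finally show ?thesis by (simp add: mult_2 power_add)
qed

lemma sum_entry_le:
  assumes "\<And>j. j < n \<Longrightarrow> f j < n" "\<And>j. j < n \<Longrightarrow> h j < n" "k \<le> n"
  shows "(\<Sum>j<k. entry n D (f j) (h j)) \<le> 2 ^ (3 * z)"
proof -
  have "(\<Sum>j<k. entry n D (f j) (h j)) \<le> (\<Sum>j<k. 2 ^ (2 * z))"
    using assms by (intro sum_mono entry_le) auto
  also have "\<dots> = k * 2 ^ (2 * z)" by simp
  also have "\<dots> \<le> 2 ^ z * 2 ^ (2 * z)"
    using assms(3) n(2) less_exp[of z] by (intro mult_le_mono1) linarith
  also have "\<dots> = 2 ^ (3 * z)" by (simp flip: power_add)
  finally show ?thesis .
qed

lemma peak_bound: "k \<le> n \<Longrightarrow> iter (peak_step n D) 0 k \<le> 2 ^ (3 * z)"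
  by (intro iter_peak_le sum_entry_le) auto

lemma two_pow_g: "k \<le> 8 \<Longrightarrow> 2 ^ (k * z) \<le> (2::nat) ^ g"
  using order_trans[OF mult_le_mono1 g] by (intro power_increasing) auto

lemma X: "n \<le> X" "X \<le> 2 ^ (3 * z)"
  using peak_ge[of n D] peak_bound[of n] n by (auto simp: X_def peak_def)

lemma r: "2 \<le> r" "r \<le> n"
  using radix[OF n(1) X(1)] by (auto simp: r_def)

lemma L: "0 < L" "n \<le> r ^ L" "r ^ (L - 1) < n" "L \<le> n"
  using digits[OF n(1) r(1)] by (auto simp: L_def)

text \<open>One digit fewer falls short of \<open>n\<close>, so \<open>r ^ L\<close> is at most
  \<open>n * r\<close>; this keeps the number of words polynomial.\<close>

lemma pow_L: "k \<le> L \<Longrightarrow> r ^ k \<le> n ^ 2"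
proof -
  assume "k \<le> L"
  then have "r ^ k \<le> r ^ L" using r by (intro power_increasing) auto
  also have "\<dots> = r ^ (L - 1) * r" using L(1) by (simp add: power_eq_if[of _ L])
  also have "\<dots> \<le> n * n" using L(3) r(2) by (intro mult_le_mono) auto
  finally show ?thesis by (simp add: power2_eq_square)
qed

lemma N: "0 < N" "N \<le> n ^ 2"
  using words(2,3)[OF _ L(2)] n pow_L[of L] unfolding N_def by fastforce+

lemma U: "U \<le> 2 * n ^ 2"
  using mult_le_mono[OF L(4) r(2)] by (simp add: U_def power2_eq_square)

text \<open>Only the bit length is bounded, as the number of copies can be exponential; it never
  serves as a loop bound.\<close>

lemma q: "0 < q" "q \<le> 2 ^ g"
proof -
  show "0 < q" by (simp add: q_def copies_def)
  have "q \<le> 2 * X + 1" by (simp add: q_def copies_def)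
  also have "\<dots> \<le> 4 * 2 ^ (3 * z)" using X(2) one_le_power[of "2::nat" "3 * z"] by linarith
  also have "\<dots> \<le> 2 ^ (2 * z) * 2 ^ (3 * z)"
    using n power_increasing[of 2 "2 * z" "2::nat"] by (intro mult_le_mono) auto
  also have "\<dots> = 2 ^ (5 * z)" by (simp flip: power_add)
  also have "\<dots> \<le> 2 ^ g" by (rule two_pow_g) simp
  finally show "q \<le> 2 ^ g" .
qed

lemma n_le_g: "n \<le> 2 ^ g" and pow_le_g: "k \<le> L \<Longrightarrow> r ^ k \<le> 2 ^ g"
proof -
  have "n ^ 2 \<le> 4 * n ^ 6" using n_pow_mono[of 2] by simp
  then show "n \<le> 2 ^ g" "k \<le> L \<Longrightarrow> r ^ k \<le> 2 ^ g"
    using n_le(2) pow_L[of k] by (auto intro!: poly_le)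
qed

lemma computes_sum:
  assumes s: "input n D s" "s 2 0 = n"
    and e: "\<And>k v. k < n \<Longrightarrow> eval_expr (upd (upd s 23 v) 24 k) e = entry n D (f k) (h k)"
    and lt: "\<And>k. k < n \<Longrightarrow> f k < n" "\<And>k. k < n \<Longrightarrow> h k < n"
  shows "computes g Z (sum_comp e) s (\<Sum>j<n. entry n D (f j) (h j))"
  unfolding sum_comp_def
proof (rule computes_Fold[where f = "\<lambda>k. \<Sum>j<k. entry n D (f j) (h j)"])
  fix k assume "k < n"
  then show "computes g Z (Expr (Add (Var 23) e))
      (upd (upd s 23 (\<Sum>j<k. entry n D (f j) (h j))) 24 k) (\<Sum>j<Suc k. entry n D (f j) (h j))"
    using e[of k] order_trans[OF sum_entry_le[of f h "Suc k"] two_pow_g[of 3]] lt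
    by (intro computes_Expr) auto
qed (use s n_le in auto)

lemma computes_peak:
  assumes s: "input n D s" "s 2 0 = n"
  shows "computes g Z peak_comp s X"
  unfolding peak_comp_def X_def peak_def
proof (rule computes_Fold[where f = "iter (peak_step n D) 0"])
  fix k assume k: "k < n"
  define m where "m = iter (peak_step n D) 0 k"
  have bounds: "m \<le> 2 ^ g" "iter (peak_step n D) 0 (Suc k) \<le> 2 ^ g"
    using order_trans[OF peak_bound[of k] two_pow_g[of 3]]
      order_trans[OF peak_bound[of "Suc k"] two_pow_g[of 3]] k by (simp_all add: m_def)
  let ?a = "\<Sum>j<n. entry n D k j" and ?b = "\<Sum>j<n. entry n D j k"
  let ?s = "upd (upd s 20 m) 21 k"
  have step: "iter (peak_step n D) 0 (Suc k) = max (max m ?a) ?b"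
    by (simp add: m_def peak_step_def)
  have max: "a + (b - a) = max a b" for a b :: nat by (simp add: max_def)
  have "computes g Z (sum_comp (entry_at (Var 21) (Var 24))) ?s ?a"
    using s k by (intro computes_sum) (auto simp: eval_entry_at)
  moreover have "computes g Z (sum_comp (entry_at (Var 24) (Var 21))) (upd ?s 22 ?a) ?b"
    using s k by (intro computes_sum) (auto simp: eval_entry_at)
  moreover have "max m ?a \<le> 2 ^ g" "max (max m ?a) ?b \<le> 2 ^ g"
    using bounds(2) unfolding step by auto
  ultimately show "computes g Z
     (LetC 22 (sum_comp (entry_at (Var 21) (Var 24)))
     (LetC 25 (sum_comp (entry_at (Var 24) (Var 21)))
     (LetC 26 (Expr (Add (Var 20) (Sub (Var 22) (Var 20))))
       (Expr (Add (Var 26) (Sub (Var 25) (Var 26)))))))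
     (upd (upd s 20 (iter (peak_step n D) 0 k)) 21 k) (iter (peak_step n D) 0 (Suc k))"
    unfolding step m_def[symmetric]
    by (intro computes_LetC[where u = ?a] computes_LetC[where u = ?b]
        computes_LetC[where u = "max m ?a"] computes_Expr) (simp_all add: max)
qed (use s n_le in auto)

lemma computes_radix:
  assumes "s 2 0 = n" "s 3 0 = X"
  shows "computes g Z radix_comp s r"
  unfolding radix_comp_def
proof (rule computes_LetC[OF computes_Expr[OF refl] computes_Expr])
  have "X div n + 1 \<le> X + 1" by simp
  also have "\<dots> \<le> 2 ^ z * 2 ^ (3 * z)"
  proof -
    have "(2::nat) * 2 ^ (3 * z) \<le> 2 ^ z * 2 ^ (3 * z)"
      using n power_increasing[of 1 z "2::nat"] by (intro mult_le_mono1) auto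
    then show ?thesis using X(2) one_le_power[of "2::nat" "3 * z"] by linarith
  qed
  also have "\<dots> = 2 ^ (4 * z)" by (simp flip: power_add)
  also have "\<dots> \<le> 2 ^ g" by (rule two_pow_g) simp
  finally show "eval_expr s (Add (Div (Var 3) (Var 2)) (Const 1)) \<le> 2 ^ g" using assms by simp
  show "r \<le> 2 ^ g" using r n_le_g by simp
qed (use assms in \<open>auto simp: r_def radix_def\<close>)

lemma computes_copies:
  assumes "s 2 0 = n" "s 3 0 = X" "s 4 0 = r"
  shows "computes g Z copies_comp s q"
  unfolding copies_comp_def using assms q by (intro computes_Expr) (auto simp: q_def copies_def)

lemma computes_digits:
  assumes "s 2 0 = n" "s 4 0 = r"
  shows "computes g Z digits_comp s L"
  unfolding digits_comp_def L_def digits_def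
proof (rule computes_Fold[where f = "iter (digits_step n r) 0"])
  fix k assume k: "k < n"
  define l where "l = iter (digits_step n r) 0 k"
  have l: "l \<le> n" using iter_digits_le[of k n r] k by (simp add: l_def)
  have "r ^ l \<le> n * r" using iter_digits_pow(1)[of n r k] n r by (simp add: l_def)
  also have "\<dots> \<le> n * n" using r by simp
  also have "\<dots> \<le> 4 * n ^ 6" using n_pow_mono[of 2] by (simp add: power2_eq_square)
  finally have "r ^ l \<le> 2 ^ g" by (rule poly_le)
  then have "computes g Z (pow_comp 23 24 (Var 20)) (upd (upd s 20 l) 21 k) (r ^ l)"
    using l n_le r assms by (intro computes_pow) auto
  moreover have "digits_step n r k l \<le> 2 ^ g"
    using iter_digits_le[of "Suc k" n r] k n_le_g by (simp add: l_def)
  ultimately show "computes g Z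
     (LetC 22 (pow_comp 23 24 (Var 20)) (Expr (Add (Var 20) (Less (Var 22) (Var 2)))))
     (upd (upd s 20 (iter (digits_step n r) 0 k)) 21 k) (iter (digits_step n r) 0 (Suc k))"
    unfolding iter.simps l_def[symmetric] using assms
    by (intro computes_LetC[where u = "r ^ l"] computes_Expr) (simp_all add: digits_step_def)
qed (use assms n_le in auto)

lemma computes_words:
  assumes "s 2 0 = n" "s 4 0 = r" "s 6 0 = L"
  shows "computes g Z words_comp s N"
proof -
  have "N \<le> r ^ L" by (simp add: N_def words_def)
  then have "N \<le> 2 ^ g" using pow_le_g[of L] by simp
  moreover have "computes g Z (pow_comp 21 22 (Var 6)) s (r ^ L)"
    using assms r L n_le pow_le_g[of L] by (intro computes_pow) auto
  ultimately show ?thesis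
    unfolding words_comp_def using assms
    by (intro computes_LetC[where u = "r ^ L"] computes_Expr) (simp_all add: N_def words_def)
qed

lemma computes_shift:
  assumes "s 2 0 = n" "s 4 0 = r" "s 6 0 = L" "s 9 0 = u"
  shows "computes g Z shift_comp s (shift n r L u)"
proof -
  have k: "u div r mod L < L" using L by simp
  have "shift n r L u < n" using n by (simp add: shift_def)
  moreover have "computes g Z (pow_comp 21 22 (Mod (Div (Var 9) (Var 4)) (Var 6))) s
      (r ^ (u div r mod L))"
    using assms r L n_le pow_le_g k by (intro computes_pow) auto
  ultimately show ?thesis
    unfolding shift_comp_def using assms n_le_g
    by (intro computes_LetC computes_Expr) (auto simp: shift_def)
qed

lemma offset_le:
  assumes "u \<le> U"
  shows "offset r L w w' u \<le> 2 ^ g"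
proof (rule poly_le)
  have "move r L x k \<le> n * n ^ 2" for x k
  proof -
    have "k mod r \<le> n" using r by (meson le_trans less_imp_le mod_less_divisor pos2 less_le_trans)
    moreover have "r ^ (k div r mod L) \<le> n ^ 2" using L(1) by (intro pow_L) (simp add: less_imp_le)
    ultimately show ?thesis by (auto simp: move_def intro: mult_le_mono)
  qed
  then have "offset r L w w' u \<le> (\<Sum>k<u. n * n ^ 2)" unfolding offset_def by (intro sum_mono)
  also have "\<dots> \<le> (2 * n ^ 2) * (n * n ^ 2)" using assms U by simp
  also have "\<dots> = 2 * n ^ 5" by (simp add: eval_nat_numeral algebra_simps)
  also have "\<dots> \<le> 4 * n ^ 6" using n_pow_mono[of 5] by simp
  finally show "offset r L w w' u \<le> 4 * n ^ 6" .
qed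

lemma computes_offset:
  assumes s: "s 4 0 = r" "s 6 0 = L" "s 12 0 = w" "s 13 0 = w'" "s 14 0 = u"
    and u: "u \<le> U" and w: "w < N" "w' < N"
  shows "computes g Z offset_comp s (offset r L w w' u)"
  unfolding offset_comp_def
proof (rule computes_Fold[where f = "offset r L w w'"])
  fix k assume k: "k < u"
  define b where "b = (of_bool (k div r < L) :: nat)"
  define x where "x = (if k div r < L then w else w')"
  let ?s = "upd (upd s 15 (offset r L w w' k)) 16 k"
  have kL: "k div r mod L < L" using L by simp
  have one: "(1::nat) \<le> 2 ^ g" by simp
  have le: "offset r L w w' (Suc k) \<le> 2 ^ g" using offset_le[of "Suc k"] k u by simp
  have step: "offset r L w w' (Suc k) = offset r L w w' k + move r L x k"
    by (simp add: offset_Suc x_def)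
  have "x \<le> n ^ 2" using w N(2) by (auto simp: x_def)
  then have x: "x \<le> 2 ^ g" using n_pow_mono[of 2] by (intro poly_le) simp
  have "computes g Z (Expr (Less (Div (Var 16) (Var 4)) (Var 6))) ?s b"
    using s one by (intro computes_Expr) (auto simp: b_def)
  moreover have "computes g Z (pow_comp 21 22 (Mod (Div (Var 16) (Var 4)) (Var 6)))
      (upd ?s 17 b) (r ^ (k div r mod L))"
    using s r L n_le pow_le_g kL by (intro computes_pow) auto
  moreover have "computes g Z (Expr (Add (Mul (Var 12) (Var 17)) (Mul (Var 13) (Sub (Const 1) (Var 17)))))
      (upd (upd ?s 17 b) 18 (r ^ (k div r mod L))) x"
    using s x by (intro computes_Expr) (auto simp: b_def x_def)
  moreover have "computes g Z (Expr (Add (Var 15)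
      (Mul (Equal (Mod (Div (Var 19) (Var 18)) (Var 4)) (Mod (Var 16) (Var 4)))
         (Mul (Mod (Var 16) (Var 4)) (Var 18)))))
      (upd (upd (upd ?s 17 b) 18 (r ^ (k div r mod L))) 19 x) (offset r L w w' (Suc k))"
    by (rule computes_Expr[OF _ le]) (use s in \<open>simp add: step move_def\<close>)
  ultimately show "computes g Z
     (LetC 17 (Expr (Less (Div (Var 16) (Var 4)) (Var 6)))
     (LetC 18 (pow_comp 21 22 (Mod (Div (Var 16) (Var 4)) (Var 6)))
     (LetC 19 (Expr (Add (Mul (Var 12) (Var 17)) (Mul (Var 13) (Sub (Const 1) (Var 17)))))
       (Expr (Add (Var 15) (Mul (Equal (Mod (Div (Var 19) (Var 18)) (Var 4)) (Mod (Var 16) (Var 4)))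
         (Mul (Mod (Var 16) (Var 4)) (Var 18)))))))) ?s (offset r L w w' (Suc k))"
    by (intro computes_LetC)
next
  have "u \<le> 2 * n ^ 2" using u U by simp
  then show "u \<le> Z" by (intro Z_ge) simp
qed (use s in \<open>auto simp: offset_def\<close>)

section \<open>The emitted schedule\<close>

definition enc_pair :: "nat \<times> nat \<Rightarrow> nat list" where
  "enc_pair = (\<lambda>(i, j). [i, j])"

definition enc_path :: "nat list \<times> nat \<times> nat \<Rightarrow> nat list" where
  "enc_path = (\<lambda>(vs, a, d). encode_list (\<lambda>v. [v]) vs @ [a, d])"

lemma emits_matchings:
  assumes s: "s 2 0 = n" "s 4 0 = r" "s 6 0 = L" "s 8 0 = U"
  shows "emits g Z emit_matchings s
    (concat (map (\<lambda>u. encode_list enc_pair (rotation n (shift n r L u))) [0..<U]))"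
  unfolding emit_matchings_def
proof (rule emits_For)
  show "U \<le> Z" using U by (intro Z_ge) simp
  fix u assume "u < U"
  define c where "c = shift n r L u"
  define m where "m = n * of_bool (0 < c)"
  have enc: "encode_list enc_pair (rotation n c) =
      [m] @ concat (map (\<lambda>v. [v] @ [(v + c) mod n]) [0..<m])"
    by (auto simp: rotation_def encode_list_def enc_pair_def m_def comp_def)
  have m: "m \<le> n" by (simp add: m_def)
  have "computes g Z shift_comp (upd s 9 u) c"
    unfolding c_def using s by (intro computes_shift) auto
  moreover have "computes g Z (Expr (Mul (Var 2) (Less (Const 0) (Var 10)))) (upd (upd s 9 u) 10 c) m"
    using s m n_le_g by (intro computes_Expr) (auto simp: m_def)
  moreover have "emits g Z (Sq (Emit (Var 11))
         (For 12 (Var 11) (Sq (Emit (Var 12)) (Emit (Mod (Add (Var 12) (Var 10)) (Var 2))))))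
       (upd (upd (upd s 9 u) 10 c) 11 m) (encode_list enc_pair (rotation n c))"
    unfolding enc using s m n_le by (intro emits_Sq emits_For emits_Emit) auto
  ultimately show "emits g Z (LetE 10 shift_comp
     (LetE 11 (Expr (Mul (Var 2) (Less (Const 0) (Var 10))))
       (Sq (Emit (Var 11))
         (For 12 (Var 11) (Sq (Emit (Var 12)) (Emit (Mod (Add (Var 12) (Var 10)) (Var 2))))))))
     (upd s 9 u) (encode_list enc_pair (rotation n (shift n r L u)))"
    unfolding c_def[symmetric] by (intro emits_LetE)
qed (use s in auto)

lemma emits_paths:
  assumes s: "input n D s" "s 2 0 = n" "s 4 0 = r" "s 5 0 = q" "s 6 0 = L" "s 7 0 = N" "s 8 0 = U"
  shows "emits g Z emit_paths s
    (concat (map (\<lambda>i. concat (map (\<lambda>j. concat (map (\<lambda>w.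
       enc_path (route n r L N i j w, num (D i j), den (D i j) * N * q)) [0..<N])) [0..<n])) [0..<n]))"
  unfolding emit_paths_def
proof (rule emits_For[OF _ _ emits_For[OF _ _ emits_For]])
  fix i j w assume ijw: "i < n" "j < n" "w < N"
  define s1 where "s1 = upd (upd (upd s 10 i) 11 j) 12 w"
  define w' where "w' = partner N i j w"
  define s2 where "s2 = upd s1 13 w'"
  have w': "w' < N" using N by (simp add: w'_def partner_def)
  have s2: "input n D s2" "s2 2 0 = n" "s2 4 0 = r" "s2 5 0 = q" "s2 6 0 = L" "s2 7 0 = N"
    "s2 8 0 = U" "s2 10 0 = i" "s2 11 0 = j" "s2 12 0 = w" "s2 13 0 = w'"
    using s by (simp_all add: s2_def s1_def)
  have enc: "enc_path (route n r L N i j w, num (D i j), den (D i j) * N * q) =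
    [U + 1] @ concat (map (\<lambda>u. [(i + offset r L w w' u) mod n]) [0..<U + 1]) @
    [num (D i j)] @ [den (D i j) * N * q]"
    by (simp add: enc_path_def encode_list_def route_def U_def w'_def comp_def del: upt_Suc)
  have "w' \<le> n ^ 2" using w' N(2) by simp
  then have "w' \<le> 2 ^ g" using n_pow_mono[of 2] by (intro poly_le) simp
  then have partner: "computes g Z (Expr (Mod (Sub (Sub (Add (Var 11) (Mul (Const 2) (Var 7))) (Var 10)) (Var 12)) (Var 7)))
      s1 w'"
    using s by (intro computes_Expr) (auto simp: w'_def partner_def s1_def)
  have nodes: "emits g Z (For 14 (Add (Var 8) (Const 1))
             (LetE 20 offset_comp (Emit (Mod (Add (Var 10) (Var 20)) (Var 2))))) s2
      (concat (map (\<lambda>u. [(i + offset r L w w' u) mod n]) [0..<U + 1]))"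
  proof (rule emits_For)
    have "1 \<le> n ^ 2" using n by simp
    then show "U + 1 \<le> Z" using U by (intro Z_ge) simp
    fix u assume "u < U + 1"
    then have "computes g Z offset_comp (upd s2 14 u) (offset r L w w' u)"
      using s2 ijw w' by (intro computes_offset) auto
    then show "emits g Z (LetE 20 offset_comp (Emit (Mod (Add (Var 10) (Var 20)) (Var 2))))
      (upd s2 14 u) [(i + offset r L w w' u) mod n]"
      using s2 by (intro emits_LetE emits_Emit) auto
  qed (use s2 in auto)
  have "eval_expr s2 (num_at (Var 10) (Var 11)) = num (D i j)"
    "eval_expr s2 (den_at (Var 10) (Var 11)) = den (D i j)"
    using s2 ijw by (simp_all add: eval_num_at eval_den_at)
  then have "emits g Z (Sq (Emit (Add (Var 8) (Const 1)))
       (Sq (For 14 (Add (Var 8) (Const 1))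
             (LetE 20 offset_comp (Emit (Mod (Add (Var 10) (Var 20)) (Var 2)))))
       (Sq (Emit (num_at (Var 10) (Var 11)))
         (Emit (Mul (Mul (den_at (Var 10) (Var 11)) (Var 7)) (Var 5)))))) s2
     (enc_path (route n r L N i j w, num (D i j), den (D i j) * N * q))"
    unfolding enc using s2 nodes by (intro emits_Sq emits_Emit) simp_all
  from emits_LetE[OF partner this[unfolded s2_def]]
  show "emits g Z (LetE 13
       (Expr (Mod (Sub (Sub (Add (Var 11) (Mul (Const 2) (Var 7))) (Var 10)) (Var 12)) (Var 7)))
       (Sq (Emit (Add (Var 8) (Const 1)))
       (Sq (For 14 (Add (Var 8) (Const 1))
             (LetE 20 offset_comp (Emit (Mod (Add (Var 10) (Var 20)) (Var 2)))))
       (Sq (Emit (num_at (Var 10) (Var 11)))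
         (Emit (Mul (Mul (den_at (Var 10) (Var 11)) (Var 7)) (Var 5)))))))
     (upd (upd (upd s 10 i) 11 j) 12 w)
     (enc_path (route n r L N i j w, num (D i j), den (D i j) * N * q))"
    unfolding s1_def .
next
  show "N \<le> Z" using N(2) by (intro Z_ge) simp
qed (use s n_le in auto)

lemma concat_map_concat: "concat (map f (concat xss)) = concat (map (\<lambda>xs. concat (map f xs)) xss)"
  by (induction xss) auto

lemma length_digit_paths: "length (digit_paths n r L N q D) = n * n * N"
  by (simp add: digit_paths_def length_concat comp_def sum_list_triv mult.assoc)

text \<open>Brings the encoding into nested concatenations over index ranges, the shape in which
  nested \<open>For\<close> loops produce output.\<close>

lemma encode_algorithm:
  "encode_schedule (algorithm (n, D)) = [1] @ [q] @ [U] @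
    concat (map (\<lambda>u. encode_list enc_pair (rotation n (shift n r L u))) [0..<U]) @
    [n * n * N] @
    concat (map (\<lambda>i. concat (map (\<lambda>j. concat (map (\<lambda>w.
       enc_path (route n r L N i j w, num (D i j), den (D i j) * N * q)) [0..<N])) [0..<n])) [0..<n])"
proof -
  have alg: "algorithm (n, D) = [(q, (digit_matchings n r L, digit_paths n r L N q D))]"
    by (simp add: algorithm_def Let_def X_def r_def q_def L_def N_def)
  have ms: "encode_list (encode_list enc_pair) (digit_matchings n r L) = [U] @
    concat (map (\<lambda>u. encode_list enc_pair (rotation n (shift n r L u))) [0..<U])"
    by (simp add: encode_list_def[of "encode_list enc_pair"] digit_matchings_def U_def comp_def)
  have fs: "encode_list enc_path (digit_paths n r L N q D) = [n * n * N] @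
    concat (map (\<lambda>i. concat (map (\<lambda>j. concat (map (\<lambda>w.
       enc_path (route n r L N i j w, num (D i j), den (D i j) * N * q)) [0..<N])) [0..<n])) [0..<n])"
    unfolding encode_list_def length_digit_paths
    by (simp add: digit_paths_def concat_map_concat comp_def)
  have block: "encode_block (a, b) =
      encode_list (encode_list enc_pair) a @ encode_list enc_path b" for a b
    by (simp add: encode_block_def enc_pair_def enc_path_def)
  have single: "encode_list f [x] = 1 # f x" for f :: "nat \<times> block \<Rightarrow> nat list" and x
    by (simp add: encode_list_def)
  show ?thesis
    unfolding encode_schedule_def alg single by (simp add: block ms fs)
qed

lemma emits_main:
  assumes s: "input n D s"
  shows "emits g Z main_emitter s (encode_schedule (algorithm (n, D)))"
proof -
  have "U \<le> 4 * n ^ 6" using U n_pow_mono[of 2] by simp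
  then have Ug: "U \<le> 2 ^ g" by (rule poly_le)
  define s8 where "s8 = upd (upd (upd (upd (upd (upd (upd s 2 n) 3 X) 4 r) 5 q) 6 L) 7 N) 8 U"
  have s8: "input n D s8" "s8 2 0 = n" "s8 4 0 = r" "s8 5 0 = q" "s8 6 0 = L" "s8 7 0 = N" "s8 8 0 = U"
    using s by (simp_all add: s8_def)
  have block: "emits g Z emit_block s8 (encode_schedule (algorithm (n, D)))"
    unfolding emit_block_def encode_algorithm
    using s8 by (intro emits_Sq emits_Emit emits_matchings emits_paths) auto
  show ?thesis
    unfolding main_emitter_def
  proof (intro emits_LetE)
    show "computes g Z (Expr (Read 0 (Const 1))) s n"
      using s n_le_g by (intro computes_Expr) (auto simp: input_def)
    show "computes g Z peak_comp (upd s 2 n) X"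
      using s by (intro computes_peak) auto
    show "computes g Z radix_comp (upd (upd s 2 n) 3 X) r"
      by (intro computes_radix) auto
    show "computes g Z copies_comp (upd (upd (upd s 2 n) 3 X) 4 r) q"
      by (intro computes_copies) auto
    show "computes g Z digits_comp (upd (upd (upd (upd s 2 n) 3 X) 4 r) 5 q) L"
      by (intro computes_digits) auto
    show "computes g Z words_comp (upd (upd (upd (upd (upd s 2 n) 3 X) 4 r) 5 q) 6 L) N"
      by (intro computes_words) auto
    show "computes g Z (Expr (Mul (Mul (Const 2) (Var 6)) (Var 4)))
        (upd (upd (upd (upd (upd (upd s 2 n) 3 X) 4 r) 5 q) 6 L) 7 N) U"
      using Ug by (intro computes_Expr) (auto simp: U_def)
  qed (use block in \<open>simp add: s8_def\<close>)
qed

end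

section \<open>Layout of the encoded input\<close>

lemma nth_concat_map:
  assumes "\<And>i. i < n \<Longrightarrow> length (f i) = m" "i < n" "k < m"
  shows "concat (map f [0..<n]) ! (i * m + k) = f i ! k"
proof -
  have len: "length (concat (map f [0..<i])) = i * m" if "i \<le> n" for i
    using that assms(1) by (induction i) auto
  have "[0..<n] = [0..<i] @ i # [Suc i..<n]"
    using assms(2) by (metis less_imp_le_nat le0 upt_add_eq_append upt_conv_Cons le_add_diff_inverse add_0)
  then have "concat (map f [0..<n]) = concat (map f [0..<i]) @ f i @ concat (map f [Suc i..<n])"
    by simp
  then show ?thesis using len[of i] assms by (simp add: nth_append)
qed

lemma length_encode_demand: "length (encode_demand (n, D)) = 1 + 2 * n * n"
  by (simp add: encode_demand_def encode_rat_def length_concat comp_def sum_list_triv)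

text \<open>A row takes \<open>n * 2\<close> cells and an entry 2, so a cell is located by using
  \<open>nth_concat_map\<close> once for the row and once for the entry.\<close>

lemma input_encode_demand: "input n D (initial_store (encode_demand (n, D)))"
proof -
  let ?row = "\<lambda>i. concat (map (\<lambda>j. encode_rat (D i j)) [0..<n])"
  let ?s = "initial_store (encode_demand (n, D)) 0"
  have cell: "?s (Suc k) = encode_demand (n, D) ! k" if "k < 1 + 2 * n * n" for k
    using that length_encode_demand[of n D] by (simp add: initial_store_def)
  have row: "length (?row i) = n * 2" for i
    by (simp add: encode_rat_def length_concat comp_def sum_list_triv)
  have "?s (Suc (Suc (2 * (i * n + j) + b))) = encode_rat (D i j) ! b"
    if "i < n" "j < n" "b < 2" for i j b
  proof -
    have b: "2 * (i * n + j) + b = i * (n * 2) + (j * 2 + b)" by simp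
    have "j * 2 + b < n * 2" using that by simp
    moreover have "i * (n * 2) + n * 2 \<le> n * (n * 2)"
      using mult_le_mono1[of "Suc i" n "n * 2"] that by simp
    ultimately have "2 * (i * n + j) + b < 2 * n * n" unfolding b by (simp add: mult.commute)
    then have "?s (Suc (Suc (2 * (i * n + j) + b))) = concat (map ?row [0..<n]) ! (i * (n * 2) + (j * 2 + b))"
      unfolding b[symmetric] by (subst cell) (auto simp: encode_demand_def)
    also have "\<dots> = ?row i ! (j * 2 + b)"
      using row that \<open>j * 2 + b < n * 2\<close> by (intro nth_concat_map) auto
    also have "\<dots> = encode_rat (D i j) ! b"
      using that by (intro nth_concat_map) (auto simp: encode_rat_def)
    finally show ?thesis .
  qed
  from this[of _ _ 0] this[of _ _ 1] show ?thesis
    using cell[of 0] unfolding input_def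
    by (simp add: encode_rat_def num_def den_def encode_demand_def eval_nat_numeral)
qed

lemma algorithm_poly_time:
  "computes_in_poly_time (compile main_emitter) {(n, D). 2 \<le> n \<and> nonneg_matrix n D}
     encode_demand encode_schedule algorithm"
proof -
  have emits: "emits g (8 * size_of (encode_demand (n, D)) ^ 2) main_emitter
      (initial_store (encode_demand (n, D))) (encode_schedule (algorithm (n, D)))"
    if "2 \<le> n" "nonneg_matrix n D" "8 * size_of (encode_demand (n, D)) \<le> g" for n D g
  proof -
    have inp: "input n D (initial_store (encode_demand (n, D)))" by (rule input_encode_demand)
    \<comment> \<open>All entries are listed in the input, so its size is at least \<open>n\<close>,
      however \<open>n\<close> itself is written.\<close>
    have "n \<le> 2 * n * n" by simp
    then have "n \<le> size_of (encode_demand (n, D))"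
      using size_of_ge(2)[of "encode_demand (n, D)"] length_encode_demand[of n D] by linarith
    moreover have "num (D i j) \<le> 2 ^ size_of (encode_demand (n, D))" if "i < n" "j < n" for i j
      using inp that initial_store_le[of "encode_demand (n, D)"] unfolding input_def by metis
    ultimately interpret bounded_run n g "8 * size_of (encode_demand (n, D)) ^ 2"
      "size_of (encode_demand (n, D))" D
      using that by unfold_locales auto
    show ?thesis using inp by (rule emits_main)
  qed
  show ?thesis
    by (rule computes_in_poly_time_compile[where a = 8 and b = 2, OF ewf_main])
      (use emits in \<open>auto simp: emits_def\<close>)
qed

section \<open>Optimality\<close>

lemma avg_algorithm:
  assumes "2 \<le> n" "0 < B" "D \<in> demands n B"
  shows "avg_completion_time n D (routing_of (algorithm (n, D))) \<le> 96 * rate n B"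
  using algorithm_correct(3)[of n D] makespan_algorithm[OF assms] assms
  by (auto simp: demands_def)

text \<open>The hard instance is the uniform matrix with line sum \<open>p\<close>, a rational
  strictly between \<open>B / 2\<close> and \<open>B\<close>. The constant multiplies the upper
  bound 96, the loss 8 from passing to \<open>p\<close>, and 256 from the lower bound.\<close>

lemma worst_case_optimal_if:
  assumes upper: "\<And>n B D. 2 \<le> n \<Longrightarrow> 0 < B \<Longrightarrow> D \<in> demands n B \<Longrightarrow>
      obj n D (routing_of (A (n, D))) \<le> 96 * rate n B"
    and lower: "\<And>n B D R. 2 \<le> n \<Longrightarrow> 0 < B \<Longrightarrow>
      (\<And>i j. i < n \<Longrightarrow> j < n \<Longrightarrow> of_rat (D i j) = B / real n) \<Longrightarrow>
      integral_routing_for n D R \<Longrightarrow> rate n B / 256 \<le> obj n D R"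
  shows "worst_case_optimal obj A"
  unfolding worst_case_optimal_def
proof (intro exI[of _ "96 * 8 * 256"] conjI allI impI)
  fix n :: nat and B :: real
  assume n: "2 \<le> n" and B: "0 < B"
  then obtain p :: rat where p: "B / 2 < of_rat p" "of_rat p < B"
    using of_rat_dense[of "B / 2" B] by auto
  define E where "E i j = p / of_nat n" for i j :: nat
  have p0: "0 < real_of_rat p" using p(1) B by linarith
  have E: "of_rat (E i j) = of_rat p / real n" for i j
    by (simp add: E_def of_rat_divide)
  have "E \<in> demands n B"
    using n p p0 by (auto simp: demands_def nonneg_matrix_def E zero_less_of_rat_iff) (simp add: E_def)
  moreover have "obj n D (routing_of (A (n, D))) \<le> 96 * 8 * 256 * obj n E R"
    if "D \<in> demands n B" "integral_routing_for n E R" for D R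
  proof -
    have "rate n B \<le> 8 * rate n (of_rat p)" using n p B by (intro rate_half_le) auto
    moreover have "rate n (of_rat p) / 256 \<le> obj n E R"
      using that(2) p0 by (intro lower n E) auto
    ultimately show ?thesis using upper[OF n B that(1)] by linarith
  qed
  ultimately show "\<exists>E\<in>demands n B. \<forall>D\<in>demands n B. \<forall>R. integral_routing_for n E R \<longrightarrow>
      obj n D (routing_of (A (n, D))) \<le> 96 * 8 * 256 * obj n E R"
    by blast
qed simp

theorem theorem2:
  shows "(\<exists>(p :: prog) (A :: nat \<times> (nat \<Rightarrow> nat \<Rightarrow> rat) \<Rightarrow> schedule).
      computes_in_poly_time p {(n, D). n \<ge> 2 \<and> nonneg_matrix n D}
        encode_demand encode_schedule A \<and>
      (\<forall>n\<ge>2. \<forall>D. nonneg_matrix n D \<longrightarrow>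
         wf_schedule (A (n, D)) \<and> integral_routing_for n D (routing_of (A (n, D)))) \<and>
      (\<exists>C>0. \<forall>n\<ge>2. \<forall>B>0. \<forall>D \<in> demands n B.
         makespan (routing_of (A (n, D))) \<le> C * rate n B \<and>
         avg_completion_time n D (routing_of (A (n, D))) \<le> C * rate n B) \<and>
      worst_case_optimal (\<lambda>n D R. makespan R) A \<and>
      worst_case_optimal avg_completion_time A) \<and>
    (\<exists>c>0. \<forall>n\<ge>2. \<forall>B>0. \<forall>D. (\<forall>i<n. \<forall>j<n. of_rat (D i j) = B / real n) \<longrightarrow>
       (\<forall>R. integral_routing_for n D R \<longrightarrow>
          c * rate n B \<le> makespan R \<and>
          c * rate n B \<le> avg_completion_time n D R))"
proof
  show "\<exists>(p :: prog) (A :: nat \<times> (nat \<Rightarrow> nat \<Rightarrow> rat) \<Rightarrow> schedule).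
      computes_in_poly_time p {(n, D). n \<ge> 2 \<and> nonneg_matrix n D}
        encode_demand encode_schedule A \<and>
      (\<forall>n\<ge>2. \<forall>D. nonneg_matrix n D \<longrightarrow>
         wf_schedule (A (n, D)) \<and> integral_routing_for n D (routing_of (A (n, D)))) \<and>
      (\<exists>C>0. \<forall>n\<ge>2. \<forall>B>0. \<forall>D \<in> demands n B.
         makespan (routing_of (A (n, D))) \<le> C * rate n B \<and>
         avg_completion_time n D (routing_of (A (n, D))) \<le> C * rate n B) \<and>
      worst_case_optimal (\<lambda>n D R. makespan R) A \<and>
      worst_case_optimal avg_completion_time A"
  proof (intro exI conjI)
    show "computes_in_poly_time (compile main_emitter) {(n, D). n \<ge> 2 \<and> nonneg_matrix n D}
        encode_demand encode_schedule algorithm"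
      by (rule algorithm_poly_time)
    show "\<forall>n\<ge>2. \<forall>D. nonneg_matrix n D \<longrightarrow>
        wf_schedule (algorithm (n, D)) \<and> integral_routing_for n D (routing_of (algorithm (n, D)))"
      using algorithm_correct(1,2) by blast
    show "\<forall>n\<ge>2. \<forall>B>0. \<forall>D \<in> demands n B.
        makespan (routing_of (algorithm (n, D))) \<le> 96 * rate n B \<and>
        avg_completion_time n D (routing_of (algorithm (n, D))) \<le> 96 * rate n B"
      using makespan_algorithm avg_algorithm by blast
    show "worst_case_optimal (\<lambda>n D R. makespan R) algorithm"
      by (intro worst_case_optimal_if makespan_algorithm rate_lower_bound(1))
    show "worst_case_optimal avg_completion_time algorithm"
      by (intro worst_case_optimal_if avg_algorithm rate_lower_bound(2))
  qed simp
  show "\<exists>c>0. \<forall>n\<ge>2. \<forall>B>0. \<forall>D. (\<forall>i<n. \<forall>j<n. of_rat (D i j) = B / real n) \<longrightarrow>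
       (\<forall>R. integral_routing_for n D R \<longrightarrow>
          c * rate n B \<le> makespan R \<and>
          c * rate n B \<le> avg_completion_time n D R)"
  proof (intro exI[of _ "1 / 256"] conjI allI impI)
    fix n :: nat and B :: real and D R
    assume "2 \<le> n" "0 < B" "\<forall>i<n. \<forall>j<n. of_rat (D i j) = B / real n" "integral_routing_for n D R"
    then show "1 / 256 * rate n B \<le> makespan R" "1 / 256 * rate n B \<le> avg_completion_time n D R"
      using rate_lower_bound[of n B D R] by simp_all
  qed simp
qed

end
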